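(* Assume the standing setting and the noisy iteration (I)–(III) below, with $U^{(0)}=(Z^{(0)},\beta^{(0)})$ and $X^{(0)}$ having finite second moments. Let $\tau_f=M_f/m_f$ and $\tau_G=\sigma_{\max}(M_+)/\sigma_{\min}(M_-)$, and suppose $$\tau_f^{-1}\sqrt{\tau_f^{-2}+4\tau_G^{-2}}-\tau_f^{-2}>m_f^{-1}.$$ Then there exist $\rho>0$ and $\kappa>1$ such that, for the iteration run with this $\rho$ and the constants $\delta,a,b,c,\tilde d,e$ and random variables $y^{(l)},r^{(l)}$ defined below with this $\kappa$ and $\rho$, one has $a<1$. Moreover, for every $k\ge 0$, $$W(\mu_{X^{(k+1)}},\boldsymbol{\mu}^* )\le \frac{1}{\sqrt{m_f}}(\sqrt a)^k\,W_G(\mu_{U^{(0)}},\mu_{U^*})+\frac{1}{\sqrt{a\,m_f}}\frac{Y}{1-\sqrt a}+\frac{1}{\sqrt{m_f}}\frac{\sqrt R}{1-\sqrt a}+\frac{1}{\sqrt2\,m_f}\sqrt{\mathbb{E}\|Dw^{(k+1)}\|^2}+W\big(\mu_{X^*-\frac{1}{\sqrt2 m_f}Dw^{(k+1)}},\boldsymbol{\mu}^*\big),$$ where $Y\ge 0$ and $R\ge0$ are any constants with $\mathbb{E}(y^{(l)})\le Y$ and $|\mathbb{E}(r^{(l)})|\le R$ for all $l\ge1$. Such constants exist, since the law of $(y^{(l)},r^{(l)})$ does not depend on $l$.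
   Context: Standing setting. $\mathcal{G}=(\mathcal{V},\mathcal{E})$ is a connected undirected graph without self-loops on $\mathcal{V}=\{1,\dots,N\}$. Set $\mathcal{N}_i=\{j:(i,j)\in\mathcal{E}\}$ and $N_i=|\mathcal{N}_i|$. $\mathcal{A}$ is the set of directed arcs obtained by taking both orientations $(i,j)$ and $(j,i)$ of every edge of $\mathcal{E}$, so $|\mathcal{A}|=2|\mathcal{E}|$. Fix an enumeration $q=1,\dots,|\mathcal{A}|$ of $\mathcal{A}$. Each $f_i:\mathbb{R}^d\to\mathbb{R}$ is differentiable and $m_{f_i}$-strongly convex, i.e. $\langle\nabla f_i(u)-\nabla f_i(v),u-v\rangle\ge m_{f_i}\|u-v\|^2$ with $m_{f_i}>0$. Its gradient is $M_{f_i}$-Lipschitz. The function $\sum_i f_i$ has a (unique) minimizer $x^*$. For $X=(x_1,\dots,x_N)\in\mathbb{R}^{Nd}$ let $f(X)=\sum_i f_i(x_i)$, $m_f=\min_i m_{f_i}$ and $M_f=\max_i M_{f_i}$. $M_+,M_-\in\mathbb{R}^{Nd\times|\mathcal{A}|d}$ are block matrices with $d\times d$ blocks. If the $q$-th arc is $(i,j)$, then: - the $(i,q)$ and $(j,q)$ blocks of $M_+$ are $I_d$; - the $(i,q)$ block of $M_-$ is $I_d$ and its $(j,q)$ block is $-I_d$; - all other blocks are zero. $D=\mathrm{diag}(N_1,\dots,N_N)\otimes I_d$. $\sigma_{\max}(M)$ and $\sigma_{\min}(M)$ denote the largest and the smallest nonzero singular value of a matrix $M$. $X^*=(x^*,\dots,x^*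 )$, $Z^*=\tfrac12M_+^TX^*$, and $\beta^*$ is the unique vector in the column space of $M_-^T$ with $\nabla f(X^* )+M_-\beta^*=0$. Set $U^*=(Z^*,\beta^* )$. For $\rho>0$, $G=\mathrm{diag}(\rho I_{|\mathcal{A}|d},\rho^{-1}I_{|\mathcal{A}|d})$ and $\|v\|_G^2=v^TGv$. Noisy iteration. Fix $\rho>0$. Let $w^{(1)},w^{(2)},\dots$ be i.i.d. $\mathcal{N}(0,I_{Nd})$, independent of a random initialization $(X^{(0)},\beta^{(0)})$ in which $\beta^{(0)}$ lies in the column space of $M_-^T$. Set $Z^{(0)}=\tfrac12M_+^TX^{(0)}$. For $k\ge0$ the random vectors $X^{(k+1)}\in\mathbb{R}^{Nd}$ and $Z^{(k+1)},\beta^{(k+1)}\in\mathbb{R}^{|\mathcal{A}|d}$ satisfy (I) $\nabla f(X^{(k+1)})+M_-\beta^{(k+1)}+\sqrt2Dw^{(k+1)}=\rho M_+(Z^{(k)}-Z^{(k+1)})$, (II) $\beta^{(k+1)}-\beta^{(k)}-\tfrac\rho2M_-^TX^{(k+1)}=0$, (III) $\tfrac12M_+^TX^{(k+1)}-Z^{(k+1)}=0$. Set $U^{(k)}=(Z^{(k)},\beta^{(k)})$. Distances. $W$ is the 2-Wasserstein distance, and $\mu_Y$ denotes the law of a random vector $Y$. $\mu_{U^*}$ is the Dirac mass at $U^*$, and $$W_G^2(\mu_{U^{(k)}},\mu_{U^*})=\rho W^2(\mu_{Z^{(k)}},\delta_{Z^*})+\rho^{-1}W^2(\mu_{\beta^{(k)}},\delta_{\beta^*}).$$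 $\mu^*$ is the probability density on $\mathbb{R}^d$ proportional to $\exp(-\sum_i f_i(x))$, and $\boldsymbol\mu^*(X)=\prod_{i=1}^N\mu^*(x_i)$ on $\mathbb{R}^{Nd}$. Constants (for given $\kappa>1$ and $\rho>0$): $$\delta=\min\Big\{\frac{(\kappa-1)\sigma_{\min}^2(M_-)}{\kappa\sigma_{\max}^2(M_+)},\ \frac{m_f}{\frac\rho4\sigma_{\max}^2(M_+)+\frac{\kappa M_f^2}{\rho\sigma_{\min}^2(M_-)}}\Big\},$$ $$a=\frac{2m_f+1}{2m_f(1+\delta)},\quad b=\frac1{2(1+\delta)},\quad c=\frac{2\sqrt2\,\delta}{(1+\delta)\sigma_{\min}^2(M_-)},\quad \tilde d=\frac{\rho\sigma_{\max}^2(M_-)}2,\quad e=\frac{2\delta}{(1+\delta)\rho\sigma_{\min}^2(M_-)}.$$ With $\bar w^{(k+1)}=\|\tfrac1{\sqrt2m_f}Dw^{(k+1)}\|+\|\sqrt2Dw^{(k+1)}\|$, define $$y^{(k+1)}=\frac{2b}{\sqrt{m_f}}\bar w^{(k+1)}+c\,\sigma_{\max}(M_-)\sqrt\rho\|Dw^{(k+1)}\|+\frac{c\tilde d}{\sqrt{m_f}}\|Dw^{(k+1)}\|,$$ $$r^{(k+1)}=\frac{\sqrt2b}{m_f}\bar w^{(k+1)}\|Dw^{(k+1)}\|+b(\bar w^{(k+1)})^2+\frac b{2m_f^2}\|Dw^{(k+1)}\|^2+\frac{\sqrt2c\tilde d}{m_f}\|Dw^{(k+1)}\|^2-e\|Dw^{(k+1)}\|^2.$$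 (Here $\tilde d$ is the paper's constant "$d$", renamed to avoid a clash with the dimension $d$.) *)

theory Defs
  imports "HOL-Probability.Probability"
begin

text \<open>Vertices are the elements of a finite type 'v; the graph is given by an edge
relation E.  Directed arcs are indexed by pairs (i,j) :: 'v \<times> 'v; a pair is an arc iff E i j.
Vectors in R^(Nd) are elements of (real^'d)^'v, vectors in R^(|A|d) are elements of
(real^'d)^('v\<times>'v) (components at non-arcs are extra coordinates on which all the block
matrices below vanish).\<close>

definition graph_connected :: "('v \<Rightarrow> 'v \<Rightarrow> bool) \<Rightarrow> bool" where
  "graph_connected E \<longleftrightarrow> (\<forall>i j. E\<^sup>*\<^sup>* i j)"

definition deg :: "('v \<Rightarrow> 'v \<Rightarrow> bool) \<Rightarrow> 'v \<Rightarrow> nat" where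
  "deg E i = card {j. E i j}"

definition Mplus :: "('v::finite \<Rightarrow> 'v \<Rightarrow> bool) \<Rightarrow> (real^'d)^('v \<times> 'v) \<Rightarrow> (real^'d)^'v" where
  "Mplus E z = (\<chi> i. (\<Sum>j\<in>{j. E i j}. z $ (i, j)) + (\<Sum>j\<in>{j. E j i}. z $ (j, i)))"

definition Mminus :: "('v::finite \<Rightarrow> 'v \<Rightarrow> bool) \<Rightarrow> (real^'d)^('v \<times> 'v) \<Rightarrow> (real^'d)^'v" where
  "Mminus E z = (\<chi> i. (\<Sum>j\<in>{j. E i j}. z $ (i, j)) - (\<Sum>j\<in>{j. E j i}. z $ (j, i)))"

definition MplusT :: "('v::finite \<Rightarrow> 'v \<Rightarrow> bool) \<Rightarrow> (real^'d)^'v \<Rightarrow> (real^'d)^('v \<times> 'v)" where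
  "MplusT E x = (\<chi> q. if E (fst q) (snd q) then x $ fst q + x $ snd q else 0)"

definition MminusT :: "('v::finite \<Rightarrow> 'v \<Rightarrow> bool) \<Rightarrow> (real^'d)^'v \<Rightarrow> (real^'d)^('v \<times> 'v)" where
  "MminusT E x = (\<chi> q. if E (fst q) (snd q) then x $ fst q - x $ snd q else 0)"

definition Dmat :: "('v::finite \<Rightarrow> 'v \<Rightarrow> bool) \<Rightarrow> (real^'d)^'v \<Rightarrow> (real^'d)^'v" where
  "Dmat E x = (\<chi> i. real (deg E i) *\<^sub>R x $ i)"

definition sing_vals :: "('a::euclidean_space \<Rightarrow> 'b::euclidean_space) \<Rightarrow> real set" where
  "sing_vals L = {sqrt lam | lam. lam > 0 \<and> (\<exists>x. x \<noteq> 0 \<and> adjoint L (L x) = lam *\<^sub>R x)}"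

definition sigma_max :: "('a::euclidean_space \<Rightarrow> 'b::euclidean_space) \<Rightarrow> real" where
  "sigma_max L = Max (sing_vals L)"

definition sigma_min :: "('a::euclidean_space \<Rightarrow> 'b::euclidean_space) \<Rightarrow> real" where
  "sigma_min L = Min (sing_vals L)"

definition gradF :: "('v::finite \<Rightarrow> real^'d \<Rightarrow> real^'d) \<Rightarrow> (real^'d)^'v \<Rightarrow> (real^'d)^'v" where
  "gradF g X = (\<chi> i. g i (X $ i))"

definition xstar :: "('v::finite \<Rightarrow> real^'d \<Rightarrow> real) \<Rightarrow> real^'d" where
  "xstar f = (THE x. \<forall>y. (\<Sum>i\<in>UNIV. f i x) \<le> (\<Sum>i\<in>UNIV. f i y))"

definition Xstar :: "('v::finite \<Rightarrow> real^'d \<Rightarrow> real) \<Rightarrow> (real^'d)^'v" where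
  "Xstar f = (\<chi> i. xstar f)"

definition Zstar :: "('v::finite \<Rightarrow> 'v \<Rightarrow> bool) \<Rightarrow> ('v \<Rightarrow> real^'d \<Rightarrow> real) \<Rightarrow> (real^'d)^('v \<times> 'v)" where
  "Zstar E f = (1/2) *\<^sub>R MplusT E (Xstar f)"

definition betastar :: "('v::finite \<Rightarrow> 'v \<Rightarrow> bool) \<Rightarrow> ('v \<Rightarrow> real^'d \<Rightarrow> real)
    \<Rightarrow> ('v \<Rightarrow> real^'d \<Rightarrow> real^'d) \<Rightarrow> (real^'d)^('v \<times> 'v)" where
  "betastar E f g = (THE b. b \<in> range (MminusT E) \<and> gradF g (Xstar f) + Mminus E b = 0)"

definition mu_dens :: "('v::finite \<Rightarrow> real^'d \<Rightarrow> real) \<Rightarrow> real^'d \<Rightarrow> real" where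
  "mu_dens f x = exp (- (\<Sum>i\<in>UNIV. f i x)) / (\<integral>y. exp (- (\<Sum>i\<in>UNIV. f i y)) \<partial>lborel)"

definition bold_mu_star :: "('v::finite \<Rightarrow> real^'d \<Rightarrow> real) \<Rightarrow> ((real^'d)^'v) measure" where
  "bold_mu_star f = density lborel (\<lambda>X. ennreal (\<Prod>i\<in>UNIV. mu_dens f (X $ i)))"

definition couplings :: "'a::euclidean_space measure \<Rightarrow> 'a measure \<Rightarrow> ('a \<times> 'a) measure set" where
  "couplings \<mu> \<nu> = {\<pi>. prob_space \<pi> \<and> sets \<pi> = sets (borel \<Otimes>\<^sub>M borel)
      \<and> distr \<pi> borel fst = \<mu> \<and> distr \<pi> borel snd = \<nu>}"

definition W2sq :: "'a::euclidean_space measure \<Rightarrow> 'a measure \<Rightarrow> ennreal" where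
  "W2sq \<mu> \<nu> = (INF \<pi>\<in>couplings \<mu> \<nu>. \<integral>\<^sup>+ p. ennreal ((dist (fst p) (snd p))\<^sup>2) \<partial>\<pi>)"

definition ennsqrt :: "ennreal \<Rightarrow> ennreal" where
  "ennsqrt x = (if x = \<top> then \<top> else ennreal (sqrt (enn2real x)))"

definition wass :: "'a::euclidean_space measure \<Rightarrow> 'a measure \<Rightarrow> ennreal" where
  "wass \<mu> \<nu> = ennsqrt (W2sq \<mu> \<nu>)"

text \<open>Arguments: kappa, rho, m_f, M_f, sigma_max(M_+), sigma_min(M_-), sigma_max(M_-).\<close>

definition delta_c :: "real \<Rightarrow> real \<Rightarrow> real \<Rightarrow> real \<Rightarrow> real \<Rightarrow> real \<Rightarrow> real" where
  "delta_c \<kappa> \<rho> mf Mf sPmax sMmin =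
     min (((\<kappa> - 1) * sMmin\<^sup>2) / (\<kappa> * sPmax\<^sup>2))
         (mf / (\<rho> / 4 * sPmax\<^sup>2 + (\<kappa> * Mf\<^sup>2) / (\<rho> * sMmin\<^sup>2)))"

definition a_c :: "real \<Rightarrow> real \<Rightarrow> real" where
  "a_c mf \<delta> = (2 * mf + 1) / (2 * mf * (1 + \<delta>))"

definition b_c :: "real \<Rightarrow> real" where
  "b_c \<delta> = 1 / (2 * (1 + \<delta>))"

definition c_c :: "real \<Rightarrow> real \<Rightarrow> real" where
  "c_c \<delta> sMmin = (2 * sqrt 2 * \<delta>) / ((1 + \<delta>) * sMmin\<^sup>2)"

definition dt_c :: "real \<Rightarrow> real \<Rightarrow> real" where
  "dt_c \<rho> sMmax = \<rho> * sMmax\<^sup>2 / 2"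

definition e_c :: "real \<Rightarrow> real \<Rightarrow> real \<Rightarrow> real" where
  "e_c \<delta> \<rho> sMmin = (2 * \<delta>) / ((1 + \<delta>) * \<rho> * sMmin\<^sup>2)"

definition wbar :: "('v::finite \<Rightarrow> 'v \<Rightarrow> bool) \<Rightarrow> real \<Rightarrow> (real^'d)^'v \<Rightarrow> real" where
  "wbar E mf w = norm ((1 / (sqrt 2 * mf)) *\<^sub>R Dmat E w) + norm (sqrt 2 *\<^sub>R Dmat E w)"

definition y_rv :: "('v::finite \<Rightarrow> 'v \<Rightarrow> bool) \<Rightarrow> real \<Rightarrow> real \<Rightarrow> real \<Rightarrow> real \<Rightarrow> real \<Rightarrow> real
    \<Rightarrow> real \<Rightarrow> (real^'d)^'v \<Rightarrow> real" where
  "y_rv E \<kappa> \<rho> mf Mf sPmax sMmin sMmax w =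
    (let \<delta> = delta_c \<kappa> \<rho> mf Mf sPmax sMmin; b = b_c \<delta>; c = c_c \<delta> sMmin; dt = dt_c \<rho> sMmax;
         nD = norm (Dmat E w)
     in 2 * b / sqrt mf * wbar E mf w + c * sMmax * sqrt \<rho> * nD + c * dt / sqrt mf * nD)"

definition r_rv :: "('v::finite \<Rightarrow> 'v \<Rightarrow> bool) \<Rightarrow> real \<Rightarrow> real \<Rightarrow> real \<Rightarrow> real \<Rightarrow> real \<Rightarrow> real
    \<Rightarrow> real \<Rightarrow> (real^'d)^'v \<Rightarrow> real" where
  "r_rv E \<kappa> \<rho> mf Mf sPmax sMmin sMmax w =
    (let \<delta> = delta_c \<kappa> \<rho> mf Mf sPmax sMmin; b = b_c \<delta>; c = c_c \<delta> sMmin; dt = dt_c \<rho> sMmax;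
         e = e_c \<delta> \<rho> sMmin; nD = norm (Dmat E w); wb = wbar E mf w
     in sqrt 2 * b / mf * wb * nD + b * wb\<^sup>2 + b / (2 * mf\<^sup>2) * nD\<^sup>2
        + sqrt 2 * c * dt / mf * nD\<^sup>2 - e * nD\<^sup>2)"

definition std_gauss_dens :: "'a::euclidean_space \<Rightarrow> ennreal" where
  "std_gauss_dens x = ennreal ((2 * pi) powr (- real DIM('a) / 2) * exp (- (norm x)\<^sup>2 / 2))"

definition noisy_iter ::
  "('v::finite \<Rightarrow> 'v \<Rightarrow> bool) \<Rightarrow> ('v \<Rightarrow> real^'d::finite \<Rightarrow> real^'d) \<Rightarrow> real \<Rightarrow> 'w measure
   \<Rightarrow> (nat \<Rightarrow> 'w \<Rightarrow> (real^'d)^'v) \<Rightarrow> (nat \<Rightarrow> 'w \<Rightarrow> (real^'d)^('v \<times> 'v))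
   \<Rightarrow> (nat \<Rightarrow> 'w \<Rightarrow> (real^'d)^('v \<times> 'v)) \<Rightarrow> (nat \<Rightarrow> 'w \<Rightarrow> (real^'d)^'v) \<Rightarrow> bool" where
  "noisy_iter E g \<rho> M X Z \<beta> w \<longleftrightarrow>
     prob_space M \<and>
     (\<forall>k. X k \<in> borel_measurable M \<and> Z k \<in> borel_measurable M \<and> \<beta> k \<in> borel_measurable M) \<and>
     \<comment> \<open>w^(1), w^(2), ... i.i.d. N(0, I_{Nd}), independent of (X^(0), beta^(0))\<close>
     (\<forall>k\<ge>1. distributed M lborel (w k) std_gauss_dens) \<and>
     \<comment> \<open>mutual independence of (X^(0), beta^(0)), w^(1), w^(2), ... (index None resp. Some k),
        stated via the sigma-algebras they generate\<close>
     prob_space.indep_sets M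
        (\<lambda>i. case i of
                None \<Rightarrow> {(\<lambda>\<omega>. (X 0 \<omega>, \<beta> 0 \<omega>)) -` A \<inter> space M | A. A \<in> sets borel}
              | Some k \<Rightarrow> {w k -` A \<inter> space M | A. A \<in> sets borel})
        (insert None (Some ` {1..})) \<and>
     \<comment> \<open>initialization\<close>
     (\<forall>\<omega>\<in>space M. \<beta> 0 \<omega> \<in> range (MminusT E)) \<and>
     (\<forall>\<omega>\<in>space M. Z 0 \<omega> = (1/2) *\<^sub>R MplusT E (X 0 \<omega>)) \<and>
     \<comment> \<open>finite second moments of X^(0) and U^(0) = (Z^(0), beta^(0))\<close>
     integrable M (\<lambda>\<omega>. (norm (X 0 \<omega>))\<^sup>2) \<and>
     integrable M (\<lambda>\<omega>. (norm (Z 0 \<omega>))\<^sup>2) \<and>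
     integrable M (\<lambda>\<omega>. (norm (\<beta> 0 \<omega>))\<^sup>2) \<and>
     \<comment> \<open>(I), (II), (III)\<close>
     (\<forall>k. \<forall>\<omega>\<in>space M.
        gradF g (X (Suc k) \<omega>) + Mminus E (\<beta> (Suc k) \<omega>) + sqrt 2 *\<^sub>R Dmat E (w (Suc k) \<omega>)
          = \<rho> *\<^sub>R Mplus E (Z k \<omega> - Z (Suc k) \<omega>) \<and>
        \<beta> (Suc k) \<omega> - \<beta> k \<omega> - (\<rho> / 2) *\<^sub>R MminusT E (X (Suc k) \<omega>) = 0 \<and>
        (1/2) *\<^sub>R MplusT E (X (Suc k) \<omega>) - Z (Suc k) \<omega> = 0)"

end

theory Submission
  imports Defs
begin

text \<open>The noise-free ADMM step contracts the energy \<open>V = \<rho> |Z - Z*|^2 + |\<beta> - \<beta>*|^2 / \<rho>\<close> by the factor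
  \<open>1 / (1 + \<delta>)\<close>. With noise, compare the new primal iterate with the noise-free update of the same
  dual state: the latter is independent of the fresh noise, so all terms linear in the noise have mean
  zero, and the two updates differ by at most \<open>sqrt 2 |D w| / m_f\<close>, because the update inverts a strongly
  monotone map. What remains is quadratic in the noise. Since \<open>\<delta> \<sigma>_max(M_+)^2 \<le> \<sigma>_min(M_-)^2\<close> and
  \<open>4 / m_f \<le> (1 + 1 / m_f)^2\<close>, it is dominated by \<open>r\<close>, so that \<open>E V' \<le> a E V + R\<close>, without any contribution
  of \<open>Y\<close>. Estimating the linear terms by \<open>y\<close> instead is problematic for \<open>\<rho> < 1\<close>: that argument needs
  \<open>c / \<rho>\<close> in place of \<open>c\<close>.\<close>

section \<open>Incidence matrices and singular values\<close>

text \<open>The energy controls only the dual state. It reaches the law of the primal iterate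
  because the same energy inequality, with its noise product completed to a square, bounds the
  distance of \<open>X (Suc k)\<close> from \<open>xs\<close> shifted by
  \<open>- Dmat E (w (Suc k))\<close> over \<open>sqrt 2 * mf\<close>, built from the same noise.
  This is where the shifted Gaussian and the term with the second moment of \<open>Dmat E w\<close>
  in the bound come from: the joint law of these two vectors is a coupling, and only the triangle
  inequality towards the target law is left. The iteration is implicit: (I) contains the new
  \<open>Z\<close> and \<beta>. Saying that a noise is fresh therefore requires solving it first, so
  that each state becomes a measurable function of the initial data and of the earlier noises. The
  condition on the ratios \<tau> serves a single purpose: with the right \<rho> and \<kappa> half of
  its left side is the value of \<delta>, and \<delta> > 1 / (2 m_f) is the same as a < 1. The
  definitions of \<open>sigma_max\<close>, \<open>sigma_min\<close>, \<open>xstar\<close> and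
  \<open>betastar\<close> through \<open>Max\<close>, \<open>Min\<close> and \<open>THE\<close> say
  nothing by themselves; finiteness, existence and uniqueness have to be supplied before they can be
  used.\<close>

lemma norm_vec_sq:
  fixes x :: "('a::real_inner)^'n"
  shows "(norm x)\<^sup>2 = (\<Sum>i\<in>UNIV. (norm (x $ i))\<^sup>2)"
  by (simp add: power2_norm_eq_inner inner_vec_def)

section \<open>Linearity and adjointness of the incidence operators\<close>

lemma linear_Mplus: "linear (Mplus E)"
  by (rule linearI)
    (simp_all add: Mplus_def vec_eq_iff sum.distrib scaleR_sum_right scaleR_add_right algebra_simps)

lemma linear_Mminus: "linear (Mminus E)"
  by (rule linearI)
    (simp_all add: Mminus_def vec_eq_iff sum.distrib scaleR_sum_right scaleR_diff_right algebra_simps)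

lemma linear_MplusT: "linear (MplusT E)"
  by (rule linearI) (simp_all add: MplusT_def vec_eq_iff algebra_simps)

lemma linear_MminusT: "linear (MminusT E)"
  by (rule linearI) (simp_all add: MminusT_def vec_eq_iff algebra_simps)

lemma linear_Dmat: "linear (Dmat E)"
  by (rule linearI) (simp_all add: Dmat_def vec_eq_iff algebra_simps)

lemma sum_pairs: "(\<Sum>q\<in>UNIV. F q) = (\<Sum>i\<in>UNIV. \<Sum>j\<in>UNIV. F (i, j))"
  for F :: "'a::finite \<times> 'b::finite \<Rightarrow> 'c::comm_monoid_add"
  by (simp add: UNIV_Times_UNIV[symmetric] sum.cartesian_product del: UNIV_Times_UNIV)

lemma Mplus_adjoint: "inner (Mplus E z) x = inner z (MplusT E x)"
proof -
  have "inner (Mplus E z) x =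
      (\<Sum>i\<in>UNIV. \<Sum>j\<in>UNIV. if E i j then inner (z $ (i, j)) (x $ i) else 0)
    + (\<Sum>i\<in>UNIV. \<Sum>j\<in>UNIV. if E j i then inner (z $ (j, i)) (x $ i) else 0)"
    unfolding inner_vec_def[of "Mplus E z"]
    by (simp add: Mplus_def inner_add_left inner_sum_left sum.distrib
        sum.inter_filter[symmetric])
  \<comment> \<open>Incoming arcs are renamed, so that both sums run over the arcs (i, j).\<close>
  also have "(\<Sum>i\<in>UNIV. \<Sum>j\<in>UNIV. if E j i then inner (z $ (j, i)) (x $ i) else 0)
    = (\<Sum>i\<in>UNIV. \<Sum>j\<in>UNIV. if E i j then inner (z $ (i, j)) (x $ j) else 0)"
    by (rule sum.swap)
  finally show ?thesis
    unfolding inner_vec_def[of z]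
    by (simp add: sum_pairs MplusT_def sum.distrib[symmetric] inner_add_right
        if_distrib cong: if_cong)
qed

lemma Mminus_adjoint: "inner (Mminus E z) x = inner z (MminusT E x)"
proof -
  have "inner (Mminus E z) x =
      (\<Sum>i\<in>UNIV. \<Sum>j\<in>UNIV. if E i j then inner (z $ (i, j)) (x $ i) else 0)
    - (\<Sum>i\<in>UNIV. \<Sum>j\<in>UNIV. if E j i then inner (z $ (j, i)) (x $ i) else 0)"
    unfolding inner_vec_def[of "Mminus E z"]
    by (simp add: Mminus_def inner_diff_left inner_sum_left sum_subtractf
        sum.inter_filter[symmetric])
  also have "(\<Sum>i\<in>UNIV. \<Sum>j\<in>UNIV. if E j i then inner (z $ (j, i)) (x $ i) else 0)
    = (\<Sum>i\<in>UNIV. \<Sum>j\<in>UNIV. if E i j then inner (z $ (i, j)) (x $ j) else 0)"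
    by (rule sum.swap)
  finally show ?thesis
    unfolding inner_vec_def[of z]
    by (simp add: sum_pairs MminusT_def sum_subtractf[symmetric] inner_diff_right
        if_distrib cong: if_cong)
qed

lemma adjoint_Mplus: "adjoint (Mplus E) = MplusT E"
  by (rule adjoint_unique) (metis Mplus_adjoint inner_commute)

lemma adjoint_Mminus: "adjoint (Mminus E) = MminusT E"
  by (rule adjoint_unique) (metis Mminus_adjoint inner_commute)

text \<open>Replacing every block of \<open>x\<close> by its norm times one fixed unit vector
  removes all cancellation: on each arc |x_i - x_j| is at most |x_i| + |x_j|, the norm of the
  corresponding block of \<open>MplusT E y\<close>. It lets \<sigma>_max(M_+), the only largest
  singular value in \<delta>, also control \<open>MminusT\<close>.\<close>

lemma MminusT_le_of_MplusT_le:
  fixes s :: real and x :: "(real^'d)^'v::finite"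
  assumes "\<And>y :: (real^'d)^'v. (norm (MplusT E y))\<^sup>2 \<le> s\<^sup>2 * (norm y)\<^sup>2"
  shows "(norm (MminusT E x))\<^sup>2 \<le> s\<^sup>2 * (norm x)\<^sup>2"
proof -
  obtain u :: "real^'d" where u: "norm u = 1"
    using vector_choose_size[of 1] by auto
  define y :: "(real^'d)^'v" where "y = (\<chi> i. norm (x $ i) *\<^sub>R u)"
  have "(norm (MminusT E x $ q))\<^sup>2 \<le> (norm (MplusT E y $ q))\<^sup>2" for q
  proof (cases "E (fst q) (snd q)")
    case True
    then have "norm (MplusT E y $ q) = norm (x $ fst q) + norm (x $ snd q)"
      by (simp add: MplusT_def y_def scaleR_add_left[symmetric] u)
    moreover have "norm (MminusT E x $ q) \<le> norm (x $ fst q) + norm (x $ snd q)"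
      using True by (simp add: MminusT_def norm_triangle_ineq4)
    ultimately show ?thesis by (simp add: power_mono)
  qed (simp add: MminusT_def MplusT_def)
  then have "(norm (MminusT E x))\<^sup>2 \<le> (norm (MplusT E y))\<^sup>2"
    by (simp only: norm_vec_sq[of "MminusT E x"] norm_vec_sq[of "MplusT E y"] sum_mono)
  also have "\<dots> \<le> s\<^sup>2 * (norm y)\<^sup>2" by (rule assms)
  also have "(norm y)\<^sup>2 = (norm x)\<^sup>2" unfolding norm_vec_sq[of y] norm_vec_sq[of x] by (simp add: y_def u)
  finally show ?thesis .
qed

section \<open>Rayleigh quotients and singular values\<close>

lemma real_eq_0_of_quadratic:
  fixes A C :: real
  assumes "\<And>t. 0 \<le> t * A + t\<^sup>2 * C"
  shows "A = 0"
proof (rule ccontr)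
  assume A: "A \<noteq> 0"
  \<comment> \<open>\<open>K\<close> is positive and exceeds \<open>C\<close>, so at t = - A / K the
    quadratic term cannot compensate the linear one.\<close>
  define K where "K = \<bar>C\<bar> + 1"
  have K: "K > 0" "C < K" by (auto simp: K_def)
  have "0 \<le> (- A / K) * A + (- A / K)\<^sup>2 * C" by (rule assms)
  also have "\<dots> = A\<^sup>2 / K\<^sup>2 * (C - K)"
    using K by (simp add: field_simps power2_eq_square)
  also have "\<dots> < 0"
    using K A by (intro mult_pos_neg) auto
  finally show False by simp
qed

text \<open>The minimiser of the Rayleigh quotient on the unit sphere of \<open>S\<close> is an
  eigenvector. An invariant subspace is allowed because the smallest nonzero singular value is a
  minimum over the range of the adjoint, not over the whole space.\<close>

lemma self_adjoint_min_eigenvalue: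
  fixes A :: "'a::euclidean_space \<Rightarrow> 'a"
  assumes lin: "linear A" and sa: "\<And>x y. inner (A x) y = inner x (A y)"
    and sub: "subspace S" and inv: "\<And>x. x \<in> S \<Longrightarrow> A x \<in> S" and ne: "\<exists>x\<in>S. x \<noteq> 0"
  obtains \<mu> b where "b \<in> S" "b \<noteq> 0" "A b = \<mu> *\<^sub>R b"
    and "\<And>x. x \<in> S \<Longrightarrow> \<mu> * (norm x)\<^sup>2 \<le> inner (A x) x"
proof -
  obtain x0 where x0: "x0 \<in> S" "x0 \<noteq> 0" using ne by auto
  let ?K = "S \<inter> sphere 0 1"
  have "x0 /\<^sub>R norm x0 \<in> ?K" using x0 sub by (auto simp: subspace_scale)
  moreover have "compact ?K"
    by (metis closed_subspace sub compact_sphere closed_Int_compact)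
  moreover have "continuous_on ?K (\<lambda>x. inner (A x) x)"
    using lin by (intro continuous_intros linear_continuous_on) (simp add: linear_conv_bounded_linear)
  ultimately obtain b where b: "b \<in> ?K" "\<And>x. x \<in> ?K \<Longrightarrow> inner (A b) b \<le> inner (A x) x"
    using continuous_attains_inf[of ?K "\<lambda>x. inner (A x) x"] by blast
  define \<mu> where "\<mu> = inner (A b) b"
  have bS: "b \<in> S" and nb: "norm b = 1" using b(1) by auto
  have min: "\<mu> * (norm x)\<^sup>2 \<le> inner (A x) x" if "x \<in> S" for x
  proof (cases "x = 0")
    case False
    have "x /\<^sub>R norm x \<in> ?K" using that sub False by (auto simp: subspace_scale)
    then have "\<mu> \<le> inner (A (x /\<^sub>R norm x)) (x /\<^sub>R norm x)" unfolding \<mu>_def by (rule b(2))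
    also have "\<dots> = inner (A x) x / (norm x)\<^sup>2"
      by (simp add: linear_scale[OF lin] power2_eq_square divide_inverse)
    finally show ?thesis using False by (simp add: pos_le_divide_eq)
  qed simp
  have orth: "inner (A b - \<mu> *\<^sub>R b) h = 0" if h: "h \<in> S" for h
  proof -
    \<comment> \<open>Minimality at \<open>b\<close> tested along the line through \<open>b\<close>
      in direction \<open>h\<close>; the linear coefficient in \<open>t\<close> must vanish.\<close>
    have "0 \<le> t * (2 * inner (A b - \<mu> *\<^sub>R b) h) + t\<^sup>2 * (inner (A h) h - \<mu> * (norm h)\<^sup>2)" for t
    proof -
      have "b + t *\<^sub>R h \<in> S" using bS h sub by (simp add: subspace_add subspace_scale)
      from min[OF this]
      have "\<mu> * inner (b + t *\<^sub>R h) (b + t *\<^sub>R h) \<le> inner (A (b + t *\<^sub>R h)) (b + t *\<^sub>R h)"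
        by (simp add: power2_norm_eq_inner)
      moreover have "inner b b = 1" using nb by (simp add: norm_eq_1)
      moreover have "inner (A h) b = inner (A b) h" by (metis sa inner_commute)
      moreover have "inner (A (b + t *\<^sub>R h)) (b + t *\<^sub>R h)
          = \<mu> + t * inner (A b) h + t * inner (A h) b + t * t * inner (A h) h"
        by (simp add: linear_add[OF lin] linear_scale[OF lin] inner_add_left inner_add_right \<mu>_def
            distrib_left)
      moreover have "inner (b + t *\<^sub>R h) (b + t *\<^sub>R h)
          = inner b b + 2 * (t * inner b h) + t * t * inner h h"
        by (simp add: inner_add_left inner_add_right inner_commute)
      ultimately show ?thesis
        unfolding power2_norm_eq_inner
        by (simp add: inner_diff_left power2_eq_square distrib_left
            right_diff_distrib mult.assoc mult.left_commute[of \<mu>])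
    qed
    then have "2 * inner (A b - \<mu> *\<^sub>R b) h = 0" by (rule real_eq_0_of_quadratic)
    then show ?thesis by simp
  qed
  \<comment> \<open>By invariance the residual lies in \<open>S\<close> itself, so it is orthogonal
    to itself.\<close>
  have "A b - \<mu> *\<^sub>R b \<in> S" using inv bS sub by (simp add: subspace_diff subspace_scale)
  from orth[OF this] have "A b = \<mu> *\<^sub>R b" by simp
  moreover have "b \<noteq> 0" using nb by auto
  ultimately show thesis using that bS min by blast
qed

text \<open>Eigenvectors of a self-adjoint map for distinct eigenvalues are orthogonal, hence
  independent, so there are finitely many. Without this \<open>Max\<close> and \<open>Min\<close>
  over the singular values would carry no information.\<close>

lemma finite_sing_vals:
  fixes L :: "'a::euclidean_space \<Rightarrow> 'b::euclidean_space"
  assumes "linear L"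
  shows "finite (sing_vals L)"
proof -
  let ?A = "\<lambda>x. adjoint L (L x)"
  define ev where "ev = {l. \<exists>x. x \<noteq> 0 \<and> ?A x = l *\<^sub>R x}"
  define v where "v l = (SOME x. x \<noteq> 0 \<and> ?A x = l *\<^sub>R x)" for l
  have v: "v l \<noteq> 0" "?A (v l) = l *\<^sub>R v l" if "l \<in> ev" for l
    using someI_ex[of "\<lambda>x. x \<noteq> 0 \<and> ?A x = l *\<^sub>R x"] that by (auto simp: ev_def v_def)
  have sa: "inner (?A x) y = inner x (?A y)" for x y
    by (simp add: adjoint_works[OF assms] adjoint_clauses[OF assms])
  have orth: "inner (v k) (v l) = 0" if "k \<in> ev" "l \<in> ev" "k \<noteq> l" for k l
    using sa[of "v k" "v l"] v[OF that(1)] v[OF that(2)] that(3) by simp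
  have inj: "inj_on v ev"
    using orth v by (metis inj_onI inner_eq_zero_iff)
  have "pairwise orthogonal (v ` ev)"
    using orth by (auto simp: pairwise_def orthogonal_def)
  moreover have "0 \<notin> v ` ev" using v by force
  ultimately have "finite (v ` ev)"
    using pairwise_orthogonal_independent independent_bound by blast
  then have "finite ev" using inj by (simp add: finite_image_iff)
  moreover have "sing_vals L \<subseteq> sqrt ` ev" by (auto simp: sing_vals_def ev_def)
  ultimately show ?thesis by (meson finite_imageI finite_subset)
qed

text \<open>Both bounds are stated with squares so that they survive the junk values of
  \<^const>\<open>sigma_max\<close> and \<^const>\<open>sigma_min\<close> on the zero map, which has no singular values.\<close>

lemma norm_le_sigma_max:
  fixes L :: "'a::euclidean_space \<Rightarrow> 'b::euclidean_space"
  assumes lin: "linear L"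
  shows "(norm (L x))\<^sup>2 \<le> (sigma_max L)\<^sup>2 * (norm x)\<^sup>2"
proof (cases "L x = 0")
  case False
  \<comment> \<open>The sign turns the existence of a minimal eigenvalue into that of a maximal
    one.\<close>
  let ?A = "\<lambda>x. - adjoint L (L x)"
  have linA: "linear ?A"
    using lin adjoint_linear[OF lin] by (simp add: linear_compose_neg linear_compose[unfolded o_def])
  have "x \<noteq> 0" using False linear_0[OF lin] by auto
  moreover have "inner (?A x) y = inner x (?A y)" for x y
    by (simp add: adjoint_works[OF lin] adjoint_clauses[OF lin])
  ultimately obtain \<mu> b where b: "b \<noteq> 0" "?A b = \<mu> *\<^sub>R b"
    and min: "\<And>x. \<mu> * (norm x)\<^sup>2 \<le> inner (?A x) x"
    using self_adjoint_min_eigenvalue[OF linA _ subspace_UNIV] by (metis UNIV_I)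
  have le: "(norm (L x))\<^sup>2 \<le> - \<mu> * (norm x)\<^sup>2"
    using min[of x] by (simp add: adjoint_clauses[OF lin] power2_norm_eq_inner)
  \<comment> \<open>\<open>L x\<close> is nonzero, so the largest eigenvalue is positive and its
    root counts as a singular value.\<close>
  have pos: "- \<mu> > 0"
  proof (rule ccontr)
    assume "\<not> - \<mu> > 0"
    then have "- \<mu> * (norm x)\<^sup>2 \<le> 0" by (simp add: mult_nonneg_nonneg)
    moreover have "(norm (L x))\<^sup>2 > 0" using False by simp
    ultimately show False using le by linarith
  qed
  have "adjoint L (L b) = (- \<mu>) *\<^sub>R b" using b(2) by (metis minus_minus scaleR_minus_left)
  then have "sqrt (- \<mu>) \<in> sing_vals L" using pos b(1) unfolding sing_vals_def by blast
  then have "sqrt (- \<mu>) \<le> sigma_max L"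
    unfolding sigma_max_def using finite_sing_vals[OF lin] by simp
  then have "(sqrt (- \<mu>))\<^sup>2 \<le> (sigma_max L)\<^sup>2" using pos by (intro power_mono) auto
  then have "- \<mu> * (norm x)\<^sup>2 \<le> (sigma_max L)\<^sup>2 * (norm x)\<^sup>2"
    using pos by (intro mult_right_mono) auto
  then show ?thesis using le by linarith
qed simp

lemma sigma_min_le_norm:
  fixes L :: "'a::euclidean_space \<Rightarrow> 'b::euclidean_space"
  assumes lin: "linear L" and x: "x \<in> range (adjoint L)"
  shows "(sigma_min L)\<^sup>2 * (norm x)\<^sup>2 \<le> (norm (L x))\<^sup>2"
proof (cases "x = 0")
  case False
  let ?A = "\<lambda>x. adjoint L (L x)"
  have linA: "linear ?A"
    using lin adjoint_linear[OF lin] by (simp add: linear_compose[unfolded o_def])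
  have sa: "inner (?A x) y = inner x (?A y)" for x y
    by (simp add: adjoint_works[OF lin] adjoint_clauses[OF lin])
  have sub: "subspace (range (adjoint L))"
    using adjoint_linear[OF lin] by (simp add: linear_subspace_image)
  have "\<exists>x\<in>range (adjoint L). x \<noteq> 0" using False x by blast
  from self_adjoint_min_eigenvalue[OF linA sa sub _ this]
  obtain \<mu> b where b: "b \<in> range (adjoint L)" "b \<noteq> 0" "?A b = \<mu> *\<^sub>R b"
    and min: "\<And>x. x \<in> range (adjoint L) \<Longrightarrow> \<mu> * (norm x)\<^sup>2 \<le> inner (?A x) x"
    by (metis rangeI)
  have le: "\<mu> * (norm x)\<^sup>2 \<le> (norm (L x))\<^sup>2"
    using min[OF x] by (simp add: adjoint_clauses[OF lin] power2_norm_eq_inner)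
  \<comment> \<open>The range of the adjoint is orthogonal to the kernel of \<open>L\<close>; hence
    the minimal eigenvalue on it is not zero and belongs to a singular value.\<close>
  have "L b \<noteq> 0"
  proof
    assume Lb: "L b = 0"
    obtain y where "b = adjoint L y" using b(1) by auto
    then have "inner b b = inner y (L b)" by (metis adjoint_clauses(2)[OF lin])
    then show False using Lb b(2) by simp
  qed
  moreover have "inner (L b) (L b) = \<mu> * inner b b"
    using arg_cong[OF b(3), of "\<lambda>u. inner u b"] by (simp add: adjoint_clauses[OF lin])
  ultimately have pos: "\<mu> > 0"
    using b(2) by (metis inner_gt_zero_iff zero_less_mult_pos2)
  have "sqrt \<mu> \<in> sing_vals L" using pos b unfolding sing_vals_def by blast
  then have "sigma_min L \<le> sqrt \<mu>" and "sigma_min L \<in> sing_vals L"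
    unfolding sigma_min_def using finite_sing_vals[OF lin] by (auto intro: Min_in)
  then have "(sigma_min L)\<^sup>2 \<le> (sqrt \<mu>)\<^sup>2"
    by (intro power_mono) (auto simp: sing_vals_def)
  then have "(sigma_min L)\<^sup>2 * (norm x)\<^sup>2 \<le> \<mu> * (norm x)\<^sup>2"
    using pos by (intro mult_right_mono) auto
  then show ?thesis using le by linarith
qed simp

text \<open>|L^T y|^2 = <L L^T y, y> is at most |s| |L^T y| |y|, and one factor cancels.\<close>

lemma norm_adjoint_le:
  fixes L :: "'a::euclidean_space \<Rightarrow> 'b::euclidean_space"
  assumes lin: "linear L" and le: "\<And>x. (norm (L x))\<^sup>2 \<le> s\<^sup>2 * (norm x)\<^sup>2"
  shows "(norm (adjoint L y))\<^sup>2 \<le> s\<^sup>2 * (norm y)\<^sup>2"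
proof -
  let ?z = "adjoint L y"
  have nL: "norm (L x) \<le> \<bar>s\<bar> * norm x" for x
    using le[of x] by (metis power2_abs power_mult_distrib power2_le_imp_le abs_ge_zero norm_ge_zero mult_nonneg_nonneg)
  have "(norm ?z)\<^sup>2 = inner (L ?z) y"
    by (simp add: power2_norm_eq_inner adjoint_works[OF lin, symmetric])
  also have "\<dots> \<le> norm (L ?z) * norm y" by (rule norm_cauchy_schwarz)
  also have "\<dots> \<le> (\<bar>s\<bar> * norm ?z) * norm y" by (intro mult_right_mono nL) auto
  finally have "norm ?z * norm ?z \<le> norm ?z * (\<bar>s\<bar> * norm y)"
    by (simp add: power2_eq_square algebra_simps)
  then have "norm ?z \<le> \<bar>s\<bar> * norm y"
    by (cases "?z = 0") (auto simp: mult_le_cancel_left)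
  then have "(norm ?z)\<^sup>2 \<le> (\<bar>s\<bar> * norm y)\<^sup>2" by (intro power_mono) auto
  then show ?thesis by (simp add: power_mult_distrib)
qed

section \<open>Kernel and range of the incidence operator on a connected graph\<close>

lemma MminusT_eq_0_imp_const:
  assumes "graph_connected E" "MminusT E x = 0"
  shows "x $ i = x $ j"
proof -
  have "x $ i = x $ j" if "E\<^sup>*\<^sup>* i j"
    using that
  proof induction
    case (step j k)
    have "MminusT E x $ (j, k) = 0" using assms(2) by simp
    then show ?case using step by (simp add: MminusT_def)
  qed simp
  then show ?thesis using assms(1) by (simp add: graph_connected_def)
qed

lemma MminusT_const [simp]: "MminusT E (\<chi> i. c) = 0"
  by (simp add: MminusT_def vec_eq_iff)

text \<open>The graph Laplacian M_- M_-^T is self-adjoint, so its range is the orthogonal complement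
  of its kernel, and connectedness reduces the kernel to the constant vectors. This yields the
  multiplier \<open>betastar\<close>, already in the range of \<open>MminusT\<close>.\<close>

lemma in_range_Mminus_MminusT:
  fixes v :: "(real^'d)^'v::finite"
  assumes conn: "graph_connected E" and sum0: "(\<Sum>i\<in>UNIV. v $ i) = 0"
  shows "\<exists>y. v = Mminus E (MminusT E y)"
proof -
  let ?S = "range (\<lambda>y :: (real^'d)^'v. Mminus E (MminusT E y))"
  have "linear (\<lambda>y :: (real^'d)^'v. Mminus E (MminusT E y))"
    using linear_compose[OF linear_MminusT linear_Mminus] by (simp add: o_def)
  then have "subspace ?S" by (simp add: linear_subspace_image)
  then have "span ?S = ?S" by (simp add: span_eq_iff)
  with orthogonal_subspace_decomp_exists[of ?S v]
  obtain s r where s: "s \<in> ?S" and r: "\<And>w. w \<in> ?S \<Longrightarrow> orthogonal r w" and v: "v = s + r"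
    by metis
  \<comment> \<open>The complement part \<open>r\<close> is tested against its own image, which
    gives the square of \<open>norm (MminusT E r)\<close>.\<close>
  have "inner r (Mminus E (MminusT E r)) = 0"
    using r by (auto simp: orthogonal_def)
  then have "MminusT E r = 0"
    by (metis Mminus_adjoint inner_commute inner_eq_zero_iff)
  then have const: "r $ i = r $ undefined" for i by (rule MminusT_eq_0_imp_const[OF conn])
  have "inner r v = inner (r $ undefined) (\<Sum>i\<in>UNIV. v $ i)"
    unfolding inner_vec_def[of r] inner_sum_right by (rule sum.cong[OF refl], subst const, rule refl)
  moreover have "inner r s = 0" using r s by (auto simp: orthogonal_def)
  ultimately have "r = 0" using sum0 v by (simp add: inner_add_right)
  then show ?thesis using s v by auto
qed

section \<open>Triangle inequality for the Wasserstein distance\<close>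

lemma borel_measurable_same_cell:
  fixes c :: "nat \<Rightarrow> ennreal"
  assumes [measurable]: "p \<in> measurable P (count_space UNIV)" "q \<in> measurable Q (count_space UNIV)"
  shows "(\<lambda>(x, y). if p x = q y then c (p x) else 0) \<in> borel_measurable (P \<Otimes>\<^sub>M Q)"
proof -
  have [measurable]: "(\<lambda>x. c (p x)) \<in> borel_measurable P"
    using measurable_compose[OF assms(1), of c borel] by simp
  \<comment> \<open>The equality of the two indices is written as a countable union over their
    common value.\<close>
  have [measurable]: "Measurable.pred (P \<Otimes>\<^sub>M Q) (\<lambda>z. \<exists>n. p (fst z) = n \<and> q (snd z) = n)"
    by measurable
  have "(\<lambda>z. if \<exists>n. p (fst z) = n \<and> q (snd z) = n then c (p (fst z)) else 0)
      \<in> borel_measurable (P \<Otimes>\<^sub>M Q)"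
    by measurable
  then show ?thesis by (simp add: case_prod_beta' eq_commute)
qed

text \<open>The two points are drawn independently conditionally on their cell: the product measure
  is restricted to equal cells and divided by the mass of the cell. Since both measures give each
  cell the same mass, integrating out either point leaves the factor 1, and both marginals
  survive.\<close>

lemma density_pair_same_cell:
  fixes P :: "'a measure" and Q :: "'b measure" and p :: "'a \<Rightarrow> nat" and q :: "'b \<Rightarrow> nat"
  assumes P: "prob_space P" and Q: "prob_space Q"
    and p[measurable]: "p \<in> measurable P (count_space UNIV)"
    and q[measurable]: "q \<in> measurable Q (count_space UNIV)"
    and eq: "distr P (count_space UNIV) p = distr Q (count_space UNIV) q"
  defines "h \<equiv> \<lambda>(x, y). if p x = q y then 1 / emeasure P {x' \<in> space P. p x' = p x} else 0"
  shows "distr (density (P \<Otimes>\<^sub>M Q) h) P fst = P"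
    and "distr (density (P \<Otimes>\<^sub>M Q) h) Q snd = Q"
proof -
  interpret P: prob_space P by fact
  interpret Q: prob_space Q by fact
  interpret PQ: pair_prob_space P Q ..
  define c where "c n = emeasure P {x \<in> space P. p x = n}" for n
  have cQ: "c n = emeasure Q {y \<in> space Q. q y = n}" for n
  proof -
    have "emeasure (distr P (count_space UNIV) p) {n} = emeasure (distr Q (count_space UNIV) q) {n}"
      by (simp add: eq)
    then show ?thesis
      by (simp add: emeasure_distr c_def vimage_def Int_def conj_commute)
  qed
  have c_fin: "c n \<noteq> \<top>" for n by (simp add: c_def)
  have h: "h = (\<lambda>(x, y). if p x = q y then 1 / c (p x) else 0)"
    unfolding h_def c_def ..
  have h_meas[measurable]: "h \<in> borel_measurable (P \<Otimes>\<^sub>M Q)"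
    unfolding h using borel_measurable_same_cell[OF p q, of "\<lambda>n. 1 / c n"] by simp
  have inv: "1 / c n * c n = 1" if "c n \<noteq> 0" for n
    using that c_fin[of n] by (simp add: ennreal_divide_times ennreal_divide_self less_top)
  \<comment> \<open>For a null cell the product of 1 / c n and c n is 0 instead of 1, so such cells
    have to be discarded almost everywhere.\<close>
  have "AE x in P. c n = 0 \<longrightarrow> p x \<noteq> n" for n
    by (cases "c n = 0") (auto simp: AE_iff_measurable c_def intro!: AE_I[of _ _ "{x \<in> space P. p x = n}"])
  then have "AE x in P. \<forall>n. c n = 0 \<longrightarrow> p x \<noteq> n" by (simp add: AE_all_countable)
  then have "AE x in P. c (p x) \<noteq> 0" by eventually_elim auto
  then have intQ: "AE x in P. (\<integral>\<^sup>+ y. h (x, y) \<partial>Q) = 1"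
  proof eventually_elim
    case (elim x)
    have "(\<integral>\<^sup>+ y. h (x, y) \<partial>Q) = (\<integral>\<^sup>+ y. 1 / c (p x) * indicator {y \<in> space Q. q y = p x} y \<partial>Q)"
      by (intro nn_integral_cong) (auto simp: h indicator_def)
    also have "\<dots> = 1 / c (p x) * c (p x)" by (simp add: nn_integral_cmult_indicator cQ)
    finally show ?case using inv elim by simp
  qed
  have "AE y in Q. c n = 0 \<longrightarrow> q y \<noteq> n" for n
    by (cases "c n = 0") (auto simp: AE_iff_measurable cQ intro!: AE_I[of _ _ "{x \<in> space Q. q x = n}"])
  then have "AE y in Q. \<forall>n. c n = 0 \<longrightarrow> q y \<noteq> n" by (simp add: AE_all_countable)
  then have "AE y in Q. c (q y) \<noteq> 0" by eventually_elim auto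
  then have intP: "AE y in Q. (\<integral>\<^sup>+ x. h (x, y) \<partial>P) = 1"
  proof eventually_elim
    case (elim y)
    have "(\<integral>\<^sup>+ x. h (x, y) \<partial>P) = (\<integral>\<^sup>+ x. 1 / c (q y) * indicator {x \<in> space P. p x = q y} x \<partial>P)"
      by (intro nn_integral_cong) (auto simp: h indicator_def)
    also have "\<dots> = 1 / c (q y) * c (q y)" by (simp add: nn_integral_cmult_indicator c_def)
    finally show ?case using inv elim by simp
  qed
  show "distr (density (P \<Otimes>\<^sub>M Q) h) P fst = P"
  proof (rule measure_eqI)
    fix A assume "A \<in> sets (distr (density (P \<Otimes>\<^sub>M Q) h) P fst)"
    then have A[measurable]: "A \<in> sets P" by simp
    have "emeasure (distr (density (P \<Otimes>\<^sub>M Q) h) P fst) A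
        = (\<integral>\<^sup>+ z. h z * indicator A (fst z) \<partial>(P \<Otimes>\<^sub>M Q))"
      by (subst emeasure_distr, simp, simp, subst emeasure_density)
        (auto intro!: nn_integral_cong simp: indicator_def space_pair_measure)
    also have "\<dots> = (\<integral>\<^sup>+ x. (\<integral>\<^sup>+ y. h (x, y) * indicator A x \<partial>Q) \<partial>P)"
      by (subst Q.nn_integral_fst[symmetric]) simp_all
    also have "\<dots> = (\<integral>\<^sup>+ x. (\<integral>\<^sup>+ y. h (x, y) \<partial>Q) * indicator A x \<partial>P)"
      by (intro nn_integral_cong nn_integral_multc) simp
    also have "\<dots> = (\<integral>\<^sup>+ x. indicator A x \<partial>P)"
      using intQ by (intro nn_integral_cong_AE) auto
    finally show "emeasure (distr (density (P \<Otimes>\<^sub>M Q) h) P fst) A = emeasure P A" by simp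
  qed simp
  show "distr (density (P \<Otimes>\<^sub>M Q) h) Q snd = Q"
  proof (rule measure_eqI)
    fix A assume "A \<in> sets (distr (density (P \<Otimes>\<^sub>M Q) h) Q snd)"
    then have A[measurable]: "A \<in> sets Q" by simp
    have "emeasure (distr (density (P \<Otimes>\<^sub>M Q) h) Q snd) A
        = (\<integral>\<^sup>+ z. h z * indicator A (snd z) \<partial>(P \<Otimes>\<^sub>M Q))"
      by (subst emeasure_distr, simp, simp, subst emeasure_density)
        (auto intro!: nn_integral_cong simp: indicator_def space_pair_measure)
    also have "\<dots> = (\<integral>\<^sup>+ y. (\<integral>\<^sup>+ x. h (x, y) * indicator A y \<partial>P) \<partial>Q)"
      by (subst PQ.nn_integral_snd[symmetric]) simp_all
    also have "\<dots> = (\<integral>\<^sup>+ y. (\<integral>\<^sup>+ x. h (x, y) \<partial>P) * indicator A y \<partial>Q)"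
      by (intro nn_integral_cong nn_integral_multc) simp
    also have "\<dots> = (\<integral>\<^sup>+ y. indicator A y \<partial>Q)"
      using intP by (intro nn_integral_cong_AE) auto
    finally show "emeasure (distr (density (P \<Otimes>\<^sub>M Q) h) Q snd) A = emeasure Q A" by simp
  qed simp
qed

text \<open>The index is that of the first point of a countable dense set within \<epsilon> / 2; two
  points with the same index are both close to that point.\<close>

lemma countable_cells:
  fixes \<epsilon> :: real
  assumes "\<epsilon> > 0"
  obtains q :: "'a::euclidean_space \<Rightarrow> nat"
  where "q \<in> measurable borel (count_space UNIV)" "\<And>x y. q x = q y \<Longrightarrow> dist x y < \<epsilon>"
proof -
  obtain D :: "'a set" where D: "countable D" "\<And>X. open X \<Longrightarrow> X \<noteq> {} \<Longrightarrow> \<exists>d\<in>D. d \<in> X"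
    using countable_dense_exists by blast
  define q where "q x = (LEAST n. dist x (from_nat_into D n) < \<epsilon> / 2)" for x :: 'a
  have near: "dist x (from_nat_into D (q x)) < \<epsilon> / 2" for x
  proof -
    obtain d where d: "d \<in> D" "d \<in> ball x (\<epsilon> / 2)"
      using D(2)[of "ball x (\<epsilon> / 2)"] assms by auto
    then obtain n where "from_nat_into D n = d"
      using from_nat_into_surj[OF D(1)] by blast
    then have "dist x (from_nat_into D n) < \<epsilon> / 2" using d(2) by simp
    then show ?thesis unfolding q_def by (rule LeastI)
  qed
  have "q \<in> measurable borel (count_space UNIV)"
    unfolding q_def by (intro measurable_Least) measurable
  moreover have "dist x y < \<epsilon>" if "q x = q y" for x y
    using near[of x] near[of y] that by (metis dist_triangle_half_l)
  ultimately show thesis by (rule that)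
qed

text \<open>Cauchy-Schwarz with free weights. If the squares of \<open>x\<close> and
  \<open>y\<close> have means at most \<alpha>^2 and \<beta>^2 and z = \<epsilon>, the right side
  has mean at most (\<alpha> + \<beta> + \<epsilon>)^2, so it acts as Minkowski's inequality while
  staying linear in the squares.\<close>

lemma weighted_square_sum:
  fixes x y z :: real
  assumes "\<alpha> > 0" "\<beta> > 0" "\<epsilon> > 0" "x \<ge> 0" "y \<ge> 0" "z \<ge> 0"
  shows "(x + y + z)\<^sup>2 \<le> (\<alpha> + \<beta> + \<epsilon>) * (x\<^sup>2 / \<alpha> + y\<^sup>2 / \<beta> + z\<^sup>2 / \<epsilon>)"
proof -
  have *: "2 * u * v \<le> s / r * u\<^sup>2 + r / s * v\<^sup>2" if "r > 0" "s > 0" for r s u v :: real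
  proof -
    have "s / r * u\<^sup>2 + r / s * v\<^sup>2 - 2 * u * v = (s * u - r * v)\<^sup>2 / (r * s)"
      using that by (simp add: field_simps power2_eq_square)
    also have "\<dots> \<ge> 0" using that by simp
    finally show ?thesis by simp
  qed
  have "(\<alpha> + \<beta> + \<epsilon>) * (x\<^sup>2 / \<alpha> + y\<^sup>2 / \<beta> + z\<^sup>2 / \<epsilon>) = x\<^sup>2 + y\<^sup>2 + z\<^sup>2
      + (\<beta> / \<alpha> * x\<^sup>2 + \<alpha> / \<beta> * y\<^sup>2) + (\<epsilon> / \<alpha> * x\<^sup>2 + \<alpha> / \<epsilon> * z\<^sup>2) + (\<epsilon> / \<beta> * y\<^sup>2 + \<beta> / \<epsilon> * z\<^sup>2)"
    using assms by (simp add: distrib_left distrib_right add_divide_distrib)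
  moreover have "(x + y + z)\<^sup>2 = x\<^sup>2 + y\<^sup>2 + z\<^sup>2 + 2 * x * y + 2 * x * z + 2 * y * z"
    by (simp add: power2_eq_square algebra_simps)
  ultimately show ?thesis
    using *[of \<alpha> \<beta> x y] *[of \<alpha> \<epsilon> x z] *[of \<beta> \<epsilon> y z] assms by linarith
qed

lemma ennreal_weighted_sum:
  fixes \<alpha> \<beta> \<epsilon> x y :: real
  assumes "\<alpha> > 0" "\<beta> > 0" "\<epsilon> > 0" "x \<ge> 0" "y \<ge> 0"
  shows "ennreal (\<alpha> + \<beta> + \<epsilon>) * (ennreal (1 / \<alpha>) * ennreal x + ennreal (1 / \<beta>) * ennreal y + ennreal \<epsilon>)
    = ennreal ((\<alpha> + \<beta> + \<epsilon>) * (x / \<alpha> + y / \<beta> + \<epsilon>))"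
proof -
  have "ennreal (1 / \<alpha>) * ennreal x = ennreal (x / \<alpha>)" "ennreal (1 / \<beta>) * ennreal y = ennreal (y / \<beta>)"
    using assms by (simp_all flip: ennreal_mult)
  then show ?thesis using assms by (simp add: ennreal_mult)
qed

text \<open>Couplings of \<open>(\<mu>, \<nu>)\<close> and \<open>(\<nu>, \<eta>)\<close> are glued only approximately: the two copies of the middle
  variable are made to lie in the same cell of a partition into small pieces. This avoids
  disintegration of measures.\<close>

lemma W2sq_glue:
  fixes \<mu> \<nu> \<eta> :: "'a::euclidean_space measure"
  assumes \<gamma>: "\<gamma> \<in> couplings \<mu> \<nu>" and \<pi>: "\<pi> \<in> couplings \<nu> \<eta>"
    and pos: "\<alpha> > 0" "\<beta> > 0" "\<epsilon> > 0"
    and c\<gamma>: "(\<integral>\<^sup>+ p. ennreal ((dist (fst p) (snd p))\<^sup>2) \<partial>\<gamma>) \<le> ennreal (\<alpha>\<^sup>2)"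
    and c\<pi>: "(\<integral>\<^sup>+ p. ennreal ((dist (fst p) (snd p))\<^sup>2) \<partial>\<pi>) \<le> ennreal (\<beta>\<^sup>2)"
  shows "W2sq \<mu> \<eta> \<le> ennreal ((\<alpha> + \<beta> + \<epsilon>)\<^sup>2)"
proof -
  obtain q :: "'a \<Rightarrow> nat" where q[measurable]: "q \<in> measurable borel (count_space UNIV)"
    and near: "\<And>x y. q x = q y \<Longrightarrow> dist x y < \<epsilon>"
    using countable_cells[OF pos(3)] by blast
  have G: "prob_space \<gamma>" and sG[measurable_cong]: "sets \<gamma> = sets (borel \<Otimes>\<^sub>M borel)"
    and dG1: "distr \<gamma> borel fst = \<mu>" and dG2: "distr \<gamma> borel snd = \<nu>"
    using \<gamma> by (auto simp: couplings_def)
  have H: "prob_space \<pi>" and sH[measurable_cong]: "sets \<pi> = sets (borel \<Otimes>\<^sub>M borel)"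
    and dH1: "distr \<pi> borel fst = \<nu>" and dH2: "distr \<pi> borel snd = \<eta>"
    using \<pi> by (auto simp: couplings_def)
  define h :: "('a \<times> 'a) \<times> ('a \<times> 'a) \<Rightarrow> ennreal" where "h = (\<lambda>(x, y). if (q \<circ> snd) x = (q \<circ> fst) y
      then 1 / emeasure \<gamma> {x' \<in> space \<gamma>. (q \<circ> snd) x' = (q \<circ> snd) x} else 0)"
  \<comment> \<open>A law on quadruples: the first pair follows \<gamma>, the second \<pi>, and the
    second point of the first pair shares its cell with the first point of the second pair.\<close>
  define K where "K = density (\<gamma> \<Otimes>\<^sub>M \<pi>) h"
  have sK[measurable_cong]: "sets K = sets ((borel \<Otimes>\<^sub>M borel) \<Otimes>\<^sub>M (borel \<Otimes>\<^sub>M borel))"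
    unfolding K_def sets_density by (rule sets_pair_measure_cong[OF sG sH])
  have "distr \<gamma> (count_space UNIV) (q \<circ> snd) = distr \<pi> (count_space UNIV) (q \<circ> fst)"
    by (simp add: distr_distr[symmetric, of q borel] dG2 dH1)
  from density_pair_same_cell[OF G H _ _ this]
  have K1: "distr K \<gamma> fst = \<gamma>" and K2: "distr K \<pi> snd = \<pi>"
    by (simp_all add: K_def h_def)
  interpret \<gamma>: prob_space \<gamma> by fact
  interpret K: prob_space K
  proof
    have "emeasure K (space K) = emeasure (distr K \<gamma> fst) (space \<gamma>)"
    proof (subst emeasure_distr)
      show "emeasure K (space K) = emeasure K (fst -` space \<gamma> \<inter> space K)"
        by (rule arg_cong[where f = "emeasure K"]) (auto simp: K_def space_pair_measure)
    qed auto
    then show "emeasure K (space K) = 1" by (simp add: K1 \<gamma>.emeasure_space_1)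
  qed
  have AEh: "AE z in K. q (snd (fst z)) = q (fst (snd z))"
  proof -
    have hm: "h \<in> borel_measurable (\<gamma> \<Otimes>\<^sub>M \<pi>)"
    proof -
      define c where "c n = emeasure \<gamma> {x' \<in> space \<gamma>. (q \<circ> snd) x' = n}" for n
      have "h = (\<lambda>(x, y). if (q \<circ> snd) x = (q \<circ> fst) y then 1 / c ((q \<circ> snd) x) else 0)"
        unfolding h_def c_def ..
      moreover have "q \<circ> snd \<in> measurable \<gamma> (count_space UNIV)" "q \<circ> fst \<in> measurable \<pi> (count_space UNIV)"
        by measurable
      ultimately show ?thesis
        using borel_measurable_same_cell[of "q \<circ> snd" \<gamma> "q \<circ> fst" \<pi> "\<lambda>n. 1 / c n"] by simp
    qed
    show ?thesis unfolding K_def AE_density[OF hm]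
      by (rule AE_I2) (simp add: h_def split: prod.splits)
  qed
  \<comment> \<open>Only the outer points are kept; the two middle ones, less than \<epsilon> apart,
    are forgotten.\<close>
  define J where "J = distr K (borel \<Otimes>\<^sub>M borel) (\<lambda>z. (fst (fst z), snd (snd z)))"
  have m[measurable]: "(\<lambda>z. (fst (fst z), snd (snd z))) \<in> measurable K (borel \<Otimes>\<^sub>M borel)"
    by measurable
  have "distr J borel fst = distr K borel (\<lambda>z. fst (fst z))"
    unfolding J_def by (subst distr_distr) (auto simp: o_def)
  also have "\<dots> = distr (distr K \<gamma> fst) borel fst"
    by (subst distr_distr) (auto simp: o_def)
  finally have J1: "distr J borel fst = \<mu>" by (simp add: K1 dG1)
  have "distr J borel snd = distr K borel (\<lambda>z. snd (snd z))"
    unfolding J_def by (subst distr_distr) (auto simp: o_def)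
  also have "\<dots> = distr (distr K \<pi> snd) borel snd"
    by (subst distr_distr) (auto simp: o_def)
  finally have J2: "distr J borel snd = \<eta>" by (simp add: K2 dH2)
  have "J \<in> couplings \<mu> \<eta>"
    using J1 J2 K.prob_space_distr[OF m] by (simp add: couplings_def J_def)
  then have "W2sq \<mu> \<eta> \<le> (\<integral>\<^sup>+ p. ennreal ((dist (fst p) (snd p))\<^sup>2) \<partial>J)"
    unfolding W2sq_def by (rule INF_lower)
  also have "\<dots> = (\<integral>\<^sup>+ z. ennreal ((dist (fst (fst z)) (snd (snd z)))\<^sup>2) \<partial>K)"
    unfolding J_def by (subst nn_integral_distr) auto
  also have "\<dots> \<le> (\<integral>\<^sup>+ z. ennreal (\<alpha> + \<beta> + \<epsilon>)
      * (ennreal (1 / \<alpha>) * ennreal ((dist (fst (fst z)) (snd (fst z)))\<^sup>2)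
       + ennreal (1 / \<beta>) * ennreal ((dist (fst (snd z)) (snd (snd z)))\<^sup>2) + ennreal \<epsilon>) \<partial>K)"
    using AEh
  proof (intro nn_integral_mono_AE, eventually_elim)
    case (elim z)
    let ?x = "dist (fst (fst z)) (snd (fst z))" and ?y = "dist (fst (snd z)) (snd (snd z))"
    have "dist (snd (fst z)) (fst (snd z)) < \<epsilon>" using near elim by simp
    then have "dist (fst (fst z)) (snd (snd z)) \<le> ?x + ?y + \<epsilon>"
      using dist_triangle[of "fst (fst z)" "snd (snd z)" "snd (fst z)"]
        dist_triangle[of "snd (fst z)" "snd (snd z)" "fst (snd z)"] by linarith
    then have "(dist (fst (fst z)) (snd (snd z)))\<^sup>2 \<le> (?x + ?y + \<epsilon>)\<^sup>2"
      by (intro power_mono) auto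
    also have "\<dots> \<le> (\<alpha> + \<beta> + \<epsilon>) * (?x\<^sup>2 / \<alpha> + ?y\<^sup>2 / \<beta> + \<epsilon>\<^sup>2 / \<epsilon>)"
      using pos by (intro weighted_square_sum) auto
    also have "\<epsilon>\<^sup>2 / \<epsilon> = \<epsilon>" using pos by (simp add: power2_eq_square)
    finally show ?case
      using pos by (subst ennreal_weighted_sum) (auto intro: ennreal_leI)
  qed
  also have "\<dots> = ennreal (\<alpha> + \<beta> + \<epsilon>)
      * (ennreal (1 / \<alpha>) * (\<integral>\<^sup>+ z. ennreal ((dist (fst (fst z)) (snd (fst z)))\<^sup>2) \<partial>K)
       + ennreal (1 / \<beta>) * (\<integral>\<^sup>+ z. ennreal ((dist (fst (snd z)) (snd (snd z)))\<^sup>2) \<partial>K) + ennreal \<epsilon>)"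
    by (subst nn_integral_cmult, simp, subst nn_integral_add, simp, simp, subst nn_integral_add, simp, simp,
        subst nn_integral_cmult, simp, subst nn_integral_cmult, simp) (simp add: K.emeasure_space_1)
  also have "(\<integral>\<^sup>+ z. ennreal ((dist (fst (fst z)) (snd (fst z)))\<^sup>2) \<partial>K)
      = (\<integral>\<^sup>+ p. ennreal ((dist (fst p) (snd p))\<^sup>2) \<partial>distr K \<gamma> fst)"
    by (subst nn_integral_distr) auto
  also have "(\<integral>\<^sup>+ z. ennreal ((dist (fst (snd z)) (snd (snd z)))\<^sup>2) \<partial>K)
      = (\<integral>\<^sup>+ p. ennreal ((dist (fst p) (snd p))\<^sup>2) \<partial>distr K \<pi> snd)"
    by (subst nn_integral_distr) auto
  also have "ennreal (\<alpha> + \<beta> + \<epsilon>)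
      * (ennreal (1 / \<alpha>) * (\<integral>\<^sup>+ p. ennreal ((dist (fst p) (snd p))\<^sup>2) \<partial>distr K \<gamma> fst)
       + ennreal (1 / \<beta>) * (\<integral>\<^sup>+ p. ennreal ((dist (fst p) (snd p))\<^sup>2) \<partial>distr K \<pi> snd) + ennreal \<epsilon>)
    \<le> ennreal (\<alpha> + \<beta> + \<epsilon>)
      * (ennreal (1 / \<alpha>) * ennreal (\<alpha>\<^sup>2) + ennreal (1 / \<beta>) * ennreal (\<beta>\<^sup>2) + ennreal \<epsilon>)"
    unfolding K1 K2 using c\<gamma> c\<pi> by (intro mult_left_mono add_mono) auto
  also have "\<dots> = ennreal ((\<alpha> + \<beta> + \<epsilon>)\<^sup>2)"
    using pos by (subst ennreal_weighted_sum) (auto simp: power2_eq_square)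
  finally show ?thesis .
qed

lemma ennsqrt_mono: "x \<le> y \<Longrightarrow> ennsqrt x \<le> ennsqrt y"
  by (auto simp: ennsqrt_def top_unique less_top[symmetric] intro!: ennreal_leI enn2real_mono)

lemma ennsqrt_ennreal: "ennsqrt (ennreal x) = ennreal (sqrt x)"
  by (cases "x \<ge> 0") (auto simp: ennsqrt_def ennreal_neg)

text \<open>The infima need not be attained, so nearly optimal couplings are glued and the error is
  sent to 0. If one distance is infinite there is nothing to show.\<close>

lemma wass_triangle:
  fixes \<mu> \<nu> \<eta> :: "'a::euclidean_space measure"
  shows "wass \<mu> \<eta> \<le> wass \<mu> \<nu> + wass \<nu> \<eta>"
proof (cases "W2sq \<mu> \<nu> = \<top> \<or> W2sq \<nu> \<eta> = \<top>")
  case False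
  then obtain A B where A: "W2sq \<mu> \<nu> = ennreal A" "A \<ge> 0" and B: "W2sq \<nu> \<eta> = ennreal B" "B \<ge> 0"
    by (cases "W2sq \<mu> \<nu>"; cases "W2sq \<nu> \<eta>") auto
  have w: "wass \<mu> \<nu> = ennreal (sqrt A)" "wass \<nu> \<eta> = ennreal (sqrt B)"
    by (simp_all add: wass_def A B ennsqrt_ennreal)
  have near: "\<exists>\<pi>\<in>couplings \<mu>' \<nu>'. (\<integral>\<^sup>+ p. ennreal ((dist (fst p) (snd p))\<^sup>2) \<partial>\<pi>) \<le> ennreal ((sqrt C + \<epsilon>)\<^sup>2)"
    if "W2sq \<mu>' \<nu>' = ennreal C" "C \<ge> 0" "\<epsilon> > 0" for \<mu>' \<nu>' :: "'a measure" and C \<epsilon>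
  proof -
    have "C = (sqrt C)\<^sup>2" using that by simp
    also have "\<dots> < (sqrt C + \<epsilon>)\<^sup>2" using that by (intro power_strict_mono) auto
    finally have "W2sq \<mu>' \<nu>' < ennreal ((sqrt C + \<epsilon>)\<^sup>2)"
      using that by (simp add: ennreal_less_iff)
    then show ?thesis unfolding W2sq_def INF_less_iff by (auto intro: less_imp_le)
  qed
  have *: "W2sq \<mu> \<eta> \<le> ennreal ((sqrt A + sqrt B + \<epsilon>)\<^sup>2)" if "\<epsilon> > 0" for \<epsilon>
  proof -
    \<comment> \<open>One third for each coupling and one for the cell size; the addition also keeps
      the weights positive when a distance vanishes.\<close>
    have e: "\<epsilon> / 3 > 0" using that by simp
    have A': "sqrt A + \<epsilon> / 3 > 0" and B': "sqrt B + \<epsilon> / 3 > 0"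
      using e real_sqrt_ge_zero[OF A(2)] real_sqrt_ge_zero[OF B(2)] by linarith+
    from near[OF A e] near[OF B e] show ?thesis
    proof (elim bexE)
      fix \<gamma> \<pi>
      assume "\<gamma> \<in> couplings \<mu> \<nu>" "\<pi> \<in> couplings \<nu> \<eta>"
        and "(\<integral>\<^sup>+ p. ennreal ((dist (fst p) (snd p))\<^sup>2) \<partial>\<gamma>) \<le> ennreal ((sqrt A + \<epsilon> / 3)\<^sup>2)"
        and "(\<integral>\<^sup>+ p. ennreal ((dist (fst p) (snd p))\<^sup>2) \<partial>\<pi>) \<le> ennreal ((sqrt B + \<epsilon> / 3)\<^sup>2)"
      note W2sq_glue[OF this(1,2) A' B' e this(3,4)]
      also have "sqrt A + \<epsilon> / 3 + (sqrt B + \<epsilon> / 3) + \<epsilon> / 3 = sqrt A + sqrt B + \<epsilon>"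
        by linarith
      finally show ?thesis .
    qed
  qed
  have "wass \<mu> \<eta> \<le> ennreal (sqrt A + sqrt B + \<epsilon>)" if "\<epsilon> > 0" for \<epsilon>
  proof -
    have "wass \<mu> \<eta> \<le> ennsqrt (ennreal ((sqrt A + sqrt B + \<epsilon>)\<^sup>2))"
      unfolding wass_def by (intro ennsqrt_mono *[OF that])
    also have "\<dots> = ennreal (sqrt A + sqrt B + \<epsilon>)"
      using that A(2) B(2) by (simp add: ennsqrt_ennreal)
    finally show ?thesis .
  qed
  then have "wass \<mu> \<eta> \<le> ennreal (sqrt A + sqrt B)"
    using A(2) B(2) by - (rule ennreal_le_epsilon, simp)
  then show ?thesis using A(2) B(2) by (simp add: w)
qed (auto simp: wass_def ennsqrt_def)

text \<open>In any coupling with a Dirac mass the second coordinate is almost surely the atom, so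
  the cost is fixed by the first marginal. This direction turns the initial expected energy into
  W_G.\<close>

lemma W2sq_return:
  fixes x :: "'a::euclidean_space"
  assumes [measurable]: "f \<in> borel_measurable M"
  shows "(\<integral>\<^sup>+ \<omega>. ennreal ((dist (f \<omega>) x)\<^sup>2) \<partial>M) \<le> W2sq (distr M borel f) (return borel x)"
  unfolding W2sq_def
proof (rule INF_greatest)
  fix \<pi> assume "\<pi> \<in> couplings (distr M borel f) (return borel x)"
  then have s[measurable_cong]: "sets \<pi> = sets (borel \<Otimes>\<^sub>M borel)"
    and d1: "distr \<pi> borel fst = distr M borel f" and d2: "distr \<pi> borel snd = return borel x"
    by (auto simp: couplings_def)
  have "AE y in return borel x. y = x" by (subst AE_return) auto
  then have "AE y in distr \<pi> borel snd. y = x" unfolding d2 .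
  then have AE: "AE p in \<pi>. snd p = x" by (subst (asm) AE_distr_iff) auto
  have "(\<integral>\<^sup>+ \<omega>. ennreal ((dist (f \<omega>) x)\<^sup>2) \<partial>M) = (\<integral>\<^sup>+ y. ennreal ((dist y x)\<^sup>2) \<partial>distr M borel f)"
    by (subst nn_integral_distr) auto
  also have "\<dots> = (\<integral>\<^sup>+ p. ennreal ((dist (fst p) x)\<^sup>2) \<partial>\<pi>)"
    unfolding d1[symmetric] by (subst nn_integral_distr) auto
  also have "\<dots> = (\<integral>\<^sup>+ p. ennreal ((dist (fst p) (snd p))\<^sup>2) \<partial>\<pi>)"
    using AE by (intro nn_integral_cong_AE) auto
  finally show "(\<integral>\<^sup>+ \<omega>. ennreal ((dist (f \<omega>) x)\<^sup>2) \<partial>M)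
      \<le> (\<integral>\<^sup>+ p. ennreal ((dist (fst p) (snd p))\<^sup>2) \<partial>\<pi>)" by simp
qed

text \<open>The joint law of \<open>f\<close> and \<open>g\<close> is one of the couplings.\<close>

lemma W2sq_distr_le:
  fixes f g :: "'w \<Rightarrow> 'a::euclidean_space"
  assumes M: "prob_space M" and [measurable]: "f \<in> borel_measurable M" "g \<in> borel_measurable M"
  shows "W2sq (distr M borel f) (distr M borel g) \<le> (\<integral>\<^sup>+ \<omega>. ennreal ((dist (f \<omega>) (g \<omega>))\<^sup>2) \<partial>M)"
proof -
  let ?\<pi> = "distr M (borel \<Otimes>\<^sub>M borel) (\<lambda>\<omega>. (f \<omega>, g \<omega>))"
  have "?\<pi> \<in> couplings (distr M borel f) (distr M borel g)"
    using prob_space.prob_space_distr[OF M, of "\<lambda>\<omega>. (f \<omega>, g \<omega>)" "borel \<Otimes>\<^sub>M borel"]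
    by (simp add: couplings_def distr_distr o_def)
  then have "W2sq (distr M borel f) (distr M borel g) \<le> (\<integral>\<^sup>+ p. ennreal ((dist (fst p) (snd p))\<^sup>2) \<partial>?\<pi>)"
    unfolding W2sq_def by (rule INF_lower)
  also have "\<dots> = (\<integral>\<^sup>+ \<omega>. ennreal ((dist (f \<omega>) (g \<omega>))\<^sup>2) \<partial>M)"
    by (subst nn_integral_distr) auto
  finally show ?thesis .
qed

section \<open>One noisy step\<close>

text \<open>A solution is a fixed point of x - t (T x - y), which contracts for small
  \<open>t\<close>: the squared factor is 1 - 2 t m + t^2 K^2, and t = m / K^2 makes it 1 - m^2 /
  K^2.\<close>

lemma strongly_monotone_solvable:
  fixes T :: "'a::euclidean_space \<Rightarrow> 'a"
  assumes mono: "\<And>x y. m * (norm (x - y))\<^sup>2 \<le> inner (T x - T y) (x - y)" and m: "m > 0"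
    and lip: "\<And>x y. norm (T x - T y) \<le> L * norm (x - y)"
  shows "\<exists>x. T x = y"
proof -
  \<comment> \<open>The maximum makes \<open>K\<close> positive and at least \<open>m\<close>, so
    the radicand below is nonnegative.\<close>
  define K where "K = max L m"
  have K: "K > 0" "m \<le> K" using m by (auto simp: K_def)
  have lipK: "norm (T x - T z) \<le> K * norm (x - z)" for x z
  proof -
    have "L * norm (x - z) \<le> K * norm (x - z)" by (intro mult_right_mono) (auto simp: K_def)
    then show ?thesis using lip[of x z] by linarith
  qed
  define t where "t = m / K\<^sup>2"
  have t: "t \<ge> 0" using m by (simp add: t_def)
  define c where "c = sqrt (1 - m\<^sup>2 / K\<^sup>2)"
  have mK: "m\<^sup>2 \<le> K\<^sup>2" using m K by (intro power_mono) auto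
  have c: "0 \<le> c" "c < 1" "c\<^sup>2 = 1 - m\<^sup>2 / K\<^sup>2"
    using m K mK by (auto simp: c_def)
  have "\<exists>!x. x - t *\<^sub>R (T x - y) = x"
  proof (rule banach_fix_type)
    show "\<forall>x z. dist (x - t *\<^sub>R (T x - y)) (z - t *\<^sub>R (T z - y)) \<le> c * dist x z"
    proof (intro allI)
      fix x z
      have "(norm ((x - z) - t *\<^sub>R (T x - T z)))\<^sup>2
          = (norm (x - z))\<^sup>2 - 2 * t * inner (T x - T z) (x - z) + t\<^sup>2 * (norm (T x - T z))\<^sup>2"
        unfolding power2_norm_eq_inner
        by (simp add: inner_diff_left inner_diff_right inner_commute power2_eq_square algebra_simps)
      also have "\<dots> \<le> (norm (x - z))\<^sup>2 - 2 * t * (m * (norm (x - z))\<^sup>2) + t\<^sup>2 * (K * norm (x - z))\<^sup>2"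
        using t lipK mono by (intro add_mono diff_mono mult_left_mono power_mono) auto
      also have "\<dots> = c\<^sup>2 * (norm (x - z))\<^sup>2"
        unfolding c(3) t_def using K by (simp add: power2_eq_square field_simps)
      also have "\<dots> = (c * norm (x - z))\<^sup>2" by (simp add: power_mult_distrib)
      finally have "norm ((x - z) - t *\<^sub>R (T x - T z)) \<le> c * norm (x - z)"
        by (rule power2_le_imp_le) (use c in auto)
      then show "dist (x - t *\<^sub>R (T x - y)) (z - t *\<^sub>R (T z - y)) \<le> c * dist x z"
        by (simp add: dist_norm algebra_simps)
    qed
  qed (use c in auto)
  then obtain x where "x - t *\<^sub>R (T x - y) = x" by blast
  then have "T x = y" using m K by (simp add: t_def)
  then show ?thesis ..
qed

text \<open>Young's inequality; the gap is the square of the norm of (\<kappa> - 1) u - v over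
  \<kappa> - 1. The parameter \<kappa> of the rate is the splitting weight in this
  inequality.\<close>

lemma norm_add_sq_le:
  fixes u v :: "'a::real_inner"
  assumes "\<kappa> > 1"
  shows "(norm (u + v))\<^sup>2 \<le> \<kappa> * (norm u)\<^sup>2 + \<kappa> / (\<kappa> - 1) * (norm v)\<^sup>2"
proof -
  have "\<kappa> * (norm u)\<^sup>2 + \<kappa> / (\<kappa> - 1) * (norm v)\<^sup>2 - (norm (u + v))\<^sup>2
      = (norm ((\<kappa> - 1) *\<^sub>R u - v))\<^sup>2 / (\<kappa> - 1)"
    using assms unfolding power2_norm_eq_inner
    by (simp add: inner_add_left inner_add_right inner_diff_left inner_diff_right inner_commute
        divide_simps) (simp add: algebra_simps)
  also have "\<dots> \<ge> 0" using assms by simp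
  finally show ?thesis by simp
qed

lemma borel_measurable_linear:
  fixes h :: "'p::euclidean_space \<Rightarrow> 'q::euclidean_space"
  shows "linear h \<Longrightarrow> h \<in> borel_measurable borel"
  by (simp add: borel_measurable_continuous_onI linear_continuous_on linear_conv_bounded_linear)

lemma borel_measurable_Mplus [measurable (raw)]:
  "u \<in> borel_measurable N \<Longrightarrow> (\<lambda>x. Mplus E (u x)) \<in> borel_measurable N"
  by (rule measurable_compose[OF _ borel_measurable_linear[OF linear_Mplus]])

lemma borel_measurable_Mminus [measurable (raw)]:
  "u \<in> borel_measurable N \<Longrightarrow> (\<lambda>x. Mminus E (u x)) \<in> borel_measurable N"
  by (rule measurable_compose[OF _ borel_measurable_linear[OF linear_Mminus]])

lemma borel_measurable_MplusT [measurable (raw)]: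
  "u \<in> borel_measurable N \<Longrightarrow> (\<lambda>x. MplusT E (u x)) \<in> borel_measurable N"
  by (rule measurable_compose[OF _ borel_measurable_linear[OF linear_MplusT]])

lemma borel_measurable_MminusT [measurable (raw)]:
  "u \<in> borel_measurable N \<Longrightarrow> (\<lambda>x. MminusT E (u x)) \<in> borel_measurable N"
  by (rule measurable_compose[OF _ borel_measurable_linear[OF linear_MminusT]])

lemma borel_measurable_Dmat [measurable (raw)]:
  "u \<in> borel_measurable N \<Longrightarrow> (\<lambda>x. Dmat E (u x)) \<in> borel_measurable N"
  by (rule measurable_compose[OF _ borel_measurable_linear[OF linear_Dmat]])

text \<open>The deterministic content of one step. The bounds involve only the squares of
  \<open>sP\<close> and \<open>sM\<close>, so nonzero values suffice, and that is what the condition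
  on the ratios delivers. The triple \<open>xs\<close>, \<open>zs\<close>, \<open>bs\<close> is the
  saddle point: consensus for \<open>xs\<close>, stationarity in \<open>opt\<close>.\<close>

locale noisy_step =
  fixes E :: "'v::finite \<Rightarrow> 'v \<Rightarrow> bool" and F :: "(real^'d)^'v \<Rightarrow> (real^'d)^'v"
    and mf Mf \<rho> \<kappa> sP sM :: real
    and xs :: "(real^'d)^'v" and zs bs :: "(real^'d)^('v \<times> 'v)"
  assumes mf: "mf > 0" and Mf: "Mf > 0" and \<rho>: "\<rho> > 0" and \<kappa>: "\<kappa> > 1" and sP: "sP \<noteq> 0" and sM: "sM \<noteq> 0"
    and mono: "\<And>x y. mf * (norm (x - y))\<^sup>2 \<le> inner (F x - F y) (x - y)"
    and lip: "\<And>x y. norm (F x - F y) \<le> Mf * norm (x - y)"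
    and Mplus_le: "\<And>z. (norm (Mplus E z :: (real^'d)^'v))\<^sup>2 \<le> sP\<^sup>2 * (norm z)\<^sup>2"
    and Mminus_ge: "\<And>z. z \<in> range (MminusT E :: (real^'d)^'v \<Rightarrow> _) \<Longrightarrow> sM\<^sup>2 * (norm z)\<^sup>2 \<le> (norm (Mminus E z))\<^sup>2"
    and zs: "zs = (1/2) *\<^sub>R MplusT E xs" and bs: "bs \<in> range (MminusT E)"
    and xs: "MminusT E xs = 0" and opt: "F xs + Mminus E bs = 0"
begin

text \<open>\<open>e\<close> stands for the whole noise term of (I), including the factor
  \<open>sqrt 2\<close>.\<close>

definition step_rel where
  "step_rel e z b x' z' b' \<longleftrightarrow>
     F x' + Mminus E b' + e = \<rho> *\<^sub>R Mplus E (z - z') \<and>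
     b' = b + (\<rho> / 2) *\<^sub>R MminusT E x' \<and> z' = (1/2) *\<^sub>R MplusT E x'"

definition \<delta> where "\<delta> = delta_c \<kappa> \<rho> mf Mf sP sM"

definition energy where "energy z b = \<rho> * (norm (z - zs))\<^sup>2 + (norm (b - bs))\<^sup>2 / \<rho>"

lemma energy_nonneg: "energy z b \<ge> 0"
  using \<rho> by (simp add: energy_def)

lemma \<delta>_pos: "\<delta> > 0"
proof -
  have "\<rho> / 4 * sP\<^sup>2 + (\<kappa> * Mf\<^sup>2) / (\<rho> * sM\<^sup>2) > 0"
    using \<rho> \<kappa> sP sM Mf by (intro add_pos_pos) auto
  then show ?thesis using \<kappa> sP sM mf by (simp add: \<delta>_def delta_c_def)
qed

text \<open>The last two bounds are the two entries of the minimum in \<delta>; they make \<delta>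
  times the energy fit under the two dissipative terms of \<open>step_energy\<close>. The first
  weakens (\<kappa> - 1) / \<kappa> to 1 and is spent on the noise in
  \<open>step_noise\<close>.\<close>

lemma \<delta>_bounds:
  shows \<delta>_sP: "\<delta> * sP\<^sup>2 \<le> sM\<^sup>2"
    and \<delta>_le_1: "\<delta> * (\<kappa> / (\<kappa> - 1) * (\<rho> * sP\<^sup>2 / sM\<^sup>2)) \<le> \<rho>"
    and \<delta>_le_2: "\<delta> * (\<rho> / 4 * sP\<^sup>2 + (\<kappa> * Mf\<^sup>2) / (\<rho> * sM\<^sup>2)) \<le> mf"
proof -
  have le: "\<delta> \<le> ((\<kappa> - 1) * sM\<^sup>2) / (\<kappa> * sP\<^sup>2)"
    "\<delta> \<le> mf / (\<rho> / 4 * sP\<^sup>2 + (\<kappa> * Mf\<^sup>2) / (\<rho> * sM\<^sup>2))"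
    by (simp_all add: \<delta>_def delta_c_def)
  have "\<delta> * sP\<^sup>2 \<le> ((\<kappa> - 1) * sM\<^sup>2) / (\<kappa> * sP\<^sup>2) * sP\<^sup>2"
    by (intro mult_right_mono le) simp
  also have "\<dots> = (\<kappa> - 1) / \<kappa> * sM\<^sup>2" using sP \<kappa> by (simp add: field_simps)
  also have "\<dots> \<le> 1 * sM\<^sup>2" using \<kappa> by (intro mult_right_mono) auto
  finally show "\<delta> * sP\<^sup>2 \<le> sM\<^sup>2" by simp
  have "\<delta> * (\<kappa> / (\<kappa> - 1) * (\<rho> * sP\<^sup>2 / sM\<^sup>2))
      \<le> ((\<kappa> - 1) * sM\<^sup>2) / (\<kappa> * sP\<^sup>2) * (\<kappa> / (\<kappa> - 1) * (\<rho> * sP\<^sup>2 / sM\<^sup>2))"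
    using \<kappa> \<rho> by (intro mult_right_mono le) auto
  also have "\<dots> = \<rho>" using \<kappa> sP sM by simp
  finally show "\<delta> * (\<kappa> / (\<kappa> - 1) * (\<rho> * sP\<^sup>2 / sM\<^sup>2)) \<le> \<rho>" .
  have "\<rho> / 4 * sP\<^sup>2 + (\<kappa> * Mf\<^sup>2) / (\<rho> * sM\<^sup>2) > 0"
    using \<rho> \<kappa> sP sM Mf by (intro add_pos_pos) auto
  then show "\<delta> * (\<rho> / 4 * sP\<^sup>2 + (\<kappa> * Mf\<^sup>2) / (\<rho> * sM\<^sup>2)) \<le> mf"
    using le(2) by (simp add: pos_le_divide_eq)
qed

lemma MplusT_le: "(norm (MplusT E (x :: (real^'d)^'v)))\<^sup>2 \<le> sP\<^sup>2 * (norm x)\<^sup>2"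
  using norm_adjoint_le[OF linear_Mplus Mplus_le] by (simp add: adjoint_Mplus)

lemma MminusT_le: "(norm (MminusT E (x :: (real^'d)^'v)))\<^sup>2 \<le> sP\<^sup>2 * (norm x)\<^sup>2"
  by (rule MminusT_le_of_MplusT_le) (rule MplusT_le)

lemma step_residual:
  assumes "step_rel e z b x' z' b'"
  shows "Mminus E (b' - bs) = \<rho> *\<^sub>R Mplus E (z - z') - (F x' - F xs) - e"
proof -
  have "F x' + Mminus E b' + e = \<rho> *\<^sub>R Mplus E (z - z')"
    using assms unfolding step_rel_def by blast
  then have "Mminus E b' = \<rho> *\<^sub>R Mplus E (z - z') - F x' - e"
    by (simp add: algebra_simps)
  moreover have "Mminus E bs = - F xs"
    using opt by (simp add: add_eq_0_iff)
  ultimately show ?thesis by (simp add: linear_diff[OF linear_Mminus])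
qed

text \<open>Pair the residual equation with \<open>x' - xs\<close>. By adjointness and the two
  update rules the incidence terms become increments of \<open>b\<close> and \<open>z\<close>, and
  the three-point identity turns these products into differences of squares. Nothing is lost: this
  is an equality.\<close>

lemma step_energy:
  assumes "step_rel e z b x' z' b'"
  shows "energy z' b' + \<rho> * (norm (z' - z))\<^sup>2 + (norm (b' - b))\<^sup>2 / \<rho>
    + inner (F x' - F xs) (x' - xs) + inner e (x' - xs) = energy z b"
proof -
  have b': "MminusT E (x' - xs) = (2 / \<rho>) *\<^sub>R (b' - b)" and z': "MplusT E (x' - xs) = 2 *\<^sub>R (z' - zs)"
    using assms \<rho> xs by (auto simp: step_rel_def zs linear_diff[OF linear_MminusT] linear_diff[OF linear_MplusT]
        scaleR_diff_right)
  have "(F x' - F xs) + Mminus E (b' - bs) + e = \<rho> *\<^sub>R Mplus E (z - z')"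
    by (simp add: step_residual[OF assms])
  then have "inner ((F x' - F xs) + Mminus E (b' - bs) + e) (x' - xs) = inner (\<rho> *\<^sub>R Mplus E (z - z')) (x' - xs)"
    by simp
  then have I: "inner (F x' - F xs) (x' - xs) + inner e (x' - xs)
      = 2 * \<rho> * inner (z - z') (z' - zs) - 2 / \<rho> * inner (b' - bs) (b' - b)"
    by (simp add: inner_add_left Mminus_adjoint Mplus_adjoint b' z')
  have *: "(norm (u - w))\<^sup>2 = (norm (v - w))\<^sup>2 + (norm (v - u))\<^sup>2 - 2 * inner (v - w) (v - u)"
    for u v w :: "(real^'d)^('v \<times> 'v)"
    unfolding power2_norm_eq_inner
    by (simp add: inner_diff_left inner_diff_right inner_commute)
  have "inner (z - z') (z' - zs) = - inner (z' - zs) (z' - z)"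
    by (metis inner_commute inner_minus_right minus_diff_eq)
  with I have "inner (F x' - F xs) (x' - xs) + inner e (x' - xs)
      = - (\<rho> * (2 * inner (z' - zs) (z' - z))) - (2 * inner (b' - bs) (b' - b)) / \<rho>"
    by simp
  moreover have "energy z b = energy z' b' + \<rho> * (norm (z' - z))\<^sup>2 + (norm (b' - b))\<^sup>2 / \<rho>
      - \<rho> * (2 * inner (z' - zs) (z' - z)) - (2 * inner (b' - bs) (b' - b)) / \<rho>"
    unfolding energy_def *[of z zs z'] *[of b bs b']
    by (simp only: distrib_left right_diff_distrib add_divide_distrib diff_divide_distrib)
  ultimately show ?thesis by linarith
qed

text \<open>The dual error lies in the range of \<open>MminusT\<close>, where \<sigma>_min bounds it
  by \<open>Mminus E (b' - bs)\<close>; the residual equation expresses the latter through the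
  gradient difference and \<open>z - z'\<close>. The error of \<open>z'\<close> is bounded by that
  of \<open>x'\<close>. So \<delta> times the new energy is at most what \<open>step_energy\<close>
  dissipates, up to noise.\<close>

lemma step_contraction:
  assumes step: "step_rel e z b x' z' b'" and b: "b \<in> range (MminusT E)"
  shows "(1 + \<delta>) * energy z' b' \<le> energy z b - inner e (x' - xs)
    - 2 * \<delta> / (\<rho> * sM\<^sup>2) * inner e (Mminus E (b' - bs)) - \<delta> / (\<rho> * sM\<^sup>2) * (norm e)\<^sup>2"
proof -
  let ?x = "(norm (x' - xs))\<^sup>2" and ?z = "(norm (z - z'))\<^sup>2"
  have sub: "subspace (range (MminusT E))" by (simp add: linear_subspace_image[OF linear_MminusT])
  have "b' - bs \<in> range (MminusT E)"
    using step b bs by (auto simp: step_rel_def intro!: subspace_diff[OF sub] subspace_add[OF sub] subspace_scale[OF sub])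
  then have "sM\<^sup>2 * (norm (b' - bs))\<^sup>2 \<le> (norm (Mminus E (b' - bs)))\<^sup>2" by (rule Mminus_ge)
  \<comment> \<open>This keeps the noise out of Young's inequality: it survives as an exact cross
    term, linear in \<open>e\<close>, and as a negative square that later matches the
    \<open>e_c\<close> part of \<open>r_rv\<close>.\<close>
  also have "\<dots> = (norm (Mminus E (b' - bs) + e))\<^sup>2 - 2 * inner e (Mminus E (b' - bs)) - (norm e)\<^sup>2"
    unfolding power2_norm_eq_inner by (simp add: inner_add_left inner_add_right inner_commute)
  also have "Mminus E (b' - bs) + e = - (F x' - F xs) + \<rho> *\<^sub>R Mplus E (z - z')"
    by (simp add: step_residual[OF step])
  also have "(norm (- (F x' - F xs) + \<rho> *\<^sub>R Mplus E (z - z')))\<^sup>2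
      \<le> \<kappa> * (norm (- (F x' - F xs)))\<^sup>2 + \<kappa> / (\<kappa> - 1) * (norm (\<rho> *\<^sub>R Mplus E (z - z')))\<^sup>2"
    by (rule norm_add_sq_le[OF \<kappa>])
  also have "\<dots> = \<kappa> * (norm (F x' - F xs))\<^sup>2 + \<kappa> / (\<kappa> - 1) * (\<rho>\<^sup>2 * (norm (Mplus E (z - z')))\<^sup>2)"
    by (simp add: norm_minus_commute power_mult_distrib)
  also have "\<dots> \<le> \<kappa> * (Mf\<^sup>2 * ?x) + \<kappa> / (\<kappa> - 1) * (\<rho>\<^sup>2 * (sP\<^sup>2 * ?z))"
  proof -
    have "(norm (F x' - F xs))\<^sup>2 \<le> (Mf * norm (x' - xs))\<^sup>2" by (intro power_mono lip) auto
    then show ?thesis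
      using \<kappa> by (intro add_mono mult_left_mono Mplus_le) (auto simp: power_mult_distrib)
  qed
  finally have bb: "sM\<^sup>2 * (norm (b' - bs))\<^sup>2 \<le> \<kappa> * (Mf\<^sup>2 * ?x) + \<kappa> / (\<kappa> - 1) * (\<rho>\<^sup>2 * (sP\<^sup>2 * ?z))
      - 2 * inner e (Mminus E (b' - bs)) - (norm e)\<^sup>2" by simp
  let ?c = "\<delta> / (\<rho> * sM\<^sup>2)"
  have c: "?c \<ge> 0" using \<delta>_pos \<rho> by simp
  have alg: "?c * (\<kappa> * (Mf\<^sup>2 * x) + k * (\<rho>\<^sup>2 * (sP\<^sup>2 * y)) - 2 * i - n)
      = \<delta> * (\<kappa> * Mf\<^sup>2 / (\<rho> * sM\<^sup>2)) * x + \<delta> * (k * (\<rho> * sP\<^sup>2 / sM\<^sup>2)) * y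
        - 2 * \<delta> / (\<rho> * sM\<^sup>2) * i - ?c * n" for x y i n k :: real
    using \<rho> sM by (simp add: field_simps) (simp add: power2_eq_square algebra_simps)
  have "\<delta> * ((norm (b' - bs))\<^sup>2 / \<rho>) = ?c * (sM\<^sup>2 * (norm (b' - bs))\<^sup>2)"
    using sM by simp
  also have "\<dots> \<le> ?c * (\<kappa> * (Mf\<^sup>2 * ?x) + \<kappa> / (\<kappa> - 1) * (\<rho>\<^sup>2 * (sP\<^sup>2 * ?z))
      - 2 * inner e (Mminus E (b' - bs)) - (norm e)\<^sup>2)"
    by (rule mult_left_mono[OF bb c])
  also have "\<dots> = \<delta> * (\<kappa> * Mf\<^sup>2 / (\<rho> * sM\<^sup>2)) * ?x + \<delta> * (\<kappa> / (\<kappa> - 1) * (\<rho> * sP\<^sup>2 / sM\<^sup>2)) * ?z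
      - 2 * \<delta> / (\<rho> * sM\<^sup>2) * inner e (Mminus E (b' - bs)) - ?c * (norm e)\<^sup>2"
    by (rule alg)
  also have "\<dots> \<le> \<delta> * (\<kappa> * Mf\<^sup>2 / (\<rho> * sM\<^sup>2)) * ?x + \<rho> * ?z
      - 2 * \<delta> / (\<rho> * sM\<^sup>2) * inner e (Mminus E (b' - bs)) - ?c * (norm e)\<^sup>2"
    by (intro add_left_mono diff_right_mono mult_right_mono \<delta>_le_1) simp
  finally have B: "\<delta> * ((norm (b' - bs))\<^sup>2 / \<rho>) \<le> \<delta> * (\<kappa> * Mf\<^sup>2 / (\<rho> * sM\<^sup>2)) * ?x + \<rho> * ?z
      - 2 * \<delta> / (\<rho> * sM\<^sup>2) * inner e (Mminus E (b' - bs)) - ?c * (norm e)\<^sup>2" .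
  have "(norm (z' - zs))\<^sup>2 = (norm (MplusT E (x' - xs)))\<^sup>2 / 4"
    using step by (simp add: step_rel_def zs linear_diff[OF linear_MplusT] power_divide
        scaleR_diff_right[symmetric])
  also have "\<dots> \<le> sP\<^sup>2 * ?x / 4" using MplusT_le[of "x' - xs"] by simp
  finally have "\<delta> * (\<rho> * (norm (z' - zs))\<^sup>2) \<le> \<delta> * (\<rho> * (sP\<^sup>2 * ?x / 4))"
    using \<delta>_pos \<rho> by (intro mult_left_mono) auto
  then have "\<delta> * energy z' b' \<le> \<delta> * (\<rho> / 4 * sP\<^sup>2 + (\<kappa> * Mf\<^sup>2) / (\<rho> * sM\<^sup>2)) * ?x + \<rho> * ?z
      - 2 * \<delta> / (\<rho> * sM\<^sup>2) * inner e (Mminus E (b' - bs)) - ?c * (norm e)\<^sup>2"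
    using B by (simp add: energy_def distrib_left distrib_right)
  also have "\<dots> \<le> mf * ?x + \<rho> * ?z
      - 2 * \<delta> / (\<rho> * sM\<^sup>2) * inner e (Mminus E (b' - bs)) - ?c * (norm e)\<^sup>2"
    by (intro add_right_mono diff_right_mono mult_right_mono \<delta>_le_2) simp
  finally have "\<delta> * energy z' b' \<le> mf * ?x + \<rho> * ?z
      - 2 * \<delta> / (\<rho> * sM\<^sup>2) * inner e (Mminus E (b' - bs)) - ?c * (norm e)\<^sup>2" .
  moreover have "mf * ?x \<le> inner (F x' - F xs) (x' - xs)" by (rule mono)
  moreover have "(norm (b' - b))\<^sup>2 / \<rho> \<ge> 0" using \<rho> by simp
  ultimately show ?thesis
    using step_energy[OF step] by (simp add: distrib_right norm_minus_commute[of z z'])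
qed

text \<open>The energy identity without its dissipation. The product with \<open>e\<close> stays, to
  be absorbed by completing the square.\<close>

lemma step_primal:
  assumes "step_rel e z b x' z' b'"
  shows "mf * (norm (x' - xs))\<^sup>2 + inner e (x' - xs) + energy z' b' \<le> energy z b"
proof -
  have "mf * (norm (x' - xs))\<^sup>2 \<le> inner (F x' - F xs) (x' - xs)" by (rule mono)
  moreover have "(norm (b' - b))\<^sup>2 / \<rho> \<ge> 0" "\<rho> * (norm (z' - z))\<^sup>2 \<ge> 0" using \<rho> by simp_all
  ultimately show ?thesis using step_energy[OF assms] by linarith
qed

text \<open>Eliminating \<open>z'\<close> and \<open>b'\<close>, a step solves \<open>T x' = \<rho> M\<^sub>+ z - M\<^sub>- b - e\<close> for a strongly monotone \<open>T\<close>.\<close>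

definition T where
  "T x = F x + (\<rho> / 2) *\<^sub>R (Mminus E (MminusT E x) + Mplus E (MplusT E x))"

definition S where "S = inv T"

lemma T_mono: "mf * (norm (x - y))\<^sup>2 \<le> inner (T x - T y) (x - y)"
proof -
  have "T x - T y = F x - F y + (\<rho> / 2) *\<^sub>R (Mminus E (MminusT E (x - y)) + Mplus E (MplusT E (x - y)))"
    by (simp add: T_def linear_diff[OF linear_Mminus] linear_diff[OF linear_Mplus]
        linear_diff[OF linear_MminusT] linear_diff[OF linear_MplusT] algebra_simps)
  then have "inner (T x - T y) (x - y) = inner (F x - F y) (x - y)
      + \<rho> / 2 * ((norm (MminusT E (x - y)))\<^sup>2 + (norm (MplusT E (x - y)))\<^sup>2)"
    by (simp add: inner_add_left Mminus_adjoint Mplus_adjoint power2_norm_eq_inner)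
  moreover have "\<rho> / 2 * ((norm (MminusT E (x - y)))\<^sup>2 + (norm (MplusT E (x - y)))\<^sup>2) \<ge> 0"
    using \<rho> by simp
  ultimately show ?thesis using mono[of x y] by linarith
qed

text \<open>Some constant is enough: it only makes the fixed point argument for surjectivity of
  \<open>T\<close> applicable.\<close>

lemma T_lipschitz: "\<exists>L. \<forall>x y. norm (T x - T y) \<le> L * norm (x - y)"
proof -
  let ?A = "\<lambda>x :: (real^'d)^'v. (\<rho> / 2) *\<^sub>R (Mminus E (MminusT E x) + Mplus E (MplusT E x))"
  have lin: "linear ?A"
    by (rule linearI)
      (simp_all add: linear_add[OF linear_Mminus] linear_add[OF linear_Mplus] linear_add[OF linear_MminusT]
        linear_add[OF linear_MplusT] linear_scale[OF linear_Mminus] linear_scale[OF linear_Mplus]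
        linear_scale[OF linear_MminusT] linear_scale[OF linear_MplusT] scaleR_add_right mult.commute add_ac)
  then have A: "bounded_linear ?A" by (simp add: linear_conv_bounded_linear)
  then obtain K where K: "\<And>x. norm (?A x) \<le> norm x * K" 
    using bounded_linear.bounded[OF A] by blast
  have "norm (T x - T y) \<le> (Mf + K) * norm (x - y)" for x y
  proof -
    have "T x - T y = (F x - F y) + (?A x - ?A y)" by (simp add: T_def)
    also have "?A x - ?A y = ?A (x - y)" by (rule linear_diff[OF lin, symmetric])
    finally have "norm (T x - T y) \<le> norm (F x - F y) + norm (?A (x - y))" by (metis norm_triangle_ineq)
    also have "\<dots> \<le> Mf * norm (x - y) + norm (x - y) * K" by (intro add_mono lip K)
    finally show ?thesis by (simp add: algebra_simps)
  qed
  then show ?thesis by blast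
qed

lemma T_inj: "T x = T y \<Longrightarrow> x = y"
  using T_mono[of x y] mf by (simp add: mult_le_0_iff)

lemma T_S [simp]: "T (S y) = y"
proof -
  obtain L where "\<And>x y. norm (T x - T y) \<le> L * norm (x - y)" using T_lipschitz by blast
  from strongly_monotone_solvable[OF T_mono mf this, of y]
  show ?thesis unfolding S_def by (metis f_inv_into_f rangeI)
qed

lemma S_lipschitz: "norm (S x - S y) \<le> norm (x - y) / mf"
proof (cases "S x = S y")
  case True then show ?thesis using mf by simp
next
  case False
  have "mf * (norm (S x - S y))\<^sup>2 \<le> inner (x - y) (S x - S y)"
    using T_mono[of "S x" "S y"] by simp
  also have "\<dots> \<le> norm (x - y) * norm (S x - S y)" by (rule norm_cauchy_schwarz)
  finally have "mf * norm (S x - S y) \<le> norm (x - y)"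
    using False by (simp add: power2_eq_square mult.assoc[symmetric])
  then show ?thesis using mf by (simp add: field_simps)
qed

lemma S_continuous: "continuous_on A S"
proof -
  have "(1 / mf)-lipschitz_on UNIV S"
    using S_lipschitz mf by (intro lipschitz_onI) (auto simp: dist_norm)
  then show ?thesis using lipschitz_on_continuous_on continuous_on_subset by blast
qed

text \<open>Makes the implicit step an explicit function of the previous state and the noise, which
  is the source of all measurability and independence statements.\<close>

lemma step_iff:
  "step_rel e z b x' z' b' \<longleftrightarrow> x' = S (\<rho> *\<^sub>R Mplus E z - Mminus E b - e)
     \<and> b' = b + (\<rho> / 2) *\<^sub>R MminusT E x' \<and> z' = (1/2) *\<^sub>R MplusT E x'"
proof -
  have "F x' + Mminus E b' + e = \<rho> *\<^sub>R Mplus E (z - z') \<longleftrightarrow> T x' = \<rho> *\<^sub>R Mplus E z - Mminus E b - e"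
    if "b' = b + (\<rho> / 2) *\<^sub>R MminusT E x'" "z' = (1/2) *\<^sub>R MplusT E x'"
    unfolding that T_def
    by (simp add: linear_add[OF linear_Mminus] linear_diff[OF linear_Mplus] linear_scale[OF linear_Mminus]
        linear_scale[OF linear_Mplus] scaleR_add_right scaleR_diff_right) (auto simp: algebra_simps)
  moreover have "T x' = y \<longleftrightarrow> x' = S y" for y by (metis T_S T_inj)
  ultimately show ?thesis by (auto simp: step_rel_def)
qed

definition noiseless where "noiseless z b = S (\<rho> *\<^sub>R Mplus E z - Mminus E b)"

text \<open>\<open>step_primal\<close> with zero noise.\<close>

lemma noiseless_bound: "mf * (norm (noiseless z b - xs))\<^sup>2 \<le> energy z b"
proof -
  have "step_rel 0 z b (noiseless z b) ((1/2) *\<^sub>R MplusT E (noiseless z b))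
      (b + (\<rho> / 2) *\<^sub>R MminusT E (noiseless z b))"
    by (simp add: step_iff noiseless_def)
  from step_primal[OF this] show ?thesis using energy_nonneg by simp (smt (verit))
qed

text \<open>The coefficient of the noise in the energy estimate after replacing \<open>x'\<close> by the noise-free update.\<close>

definition noise_factor where
  "noise_factor z b = (noiseless z b - xs)
     + (2 * \<delta> / (\<rho> * sM\<^sup>2)) *\<^sub>R (Mminus E (b - bs) + (\<rho> / 2) *\<^sub>R Mminus E (MminusT E (noiseless z b)))"

text \<open>Replacing \<open>x'\<close> by the noise-free update in the two terms of
  \<open>step_contraction\<close> that are linear in \<open>e\<close> costs at most |e|^2 / mf each:
  the first by Cauchy-Schwarz, the second because it carries the factor \<delta> sP^2 / sM^2, at
  most 1. Hence 2 / mf; the negative coefficient is inherited.\<close>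

lemma step_noise:
  assumes step: "step_rel e z b x' z' b'" and b: "b \<in> range (MminusT E)"
  shows "(1 + \<delta>) * energy z' b'
    \<le> energy z b - inner e (noise_factor z b) + (2 / mf - \<delta> / (\<rho> * sM\<^sup>2)) * (norm e)\<^sup>2"
proof -
  let ?x0 = "noiseless z b"
  let ?d = "x' - ?x0"
  have "norm ?d \<le> norm (- e) / mf"
    using S_lipschitz[of "\<rho> *\<^sub>R Mplus E z - Mminus E b - e" "\<rho> *\<^sub>R Mplus E z - Mminus E b"] step
    by (simp add: step_iff noiseless_def)
  then have d: "norm ?d \<le> norm e / mf" by simp
  have "- inner e ?d \<le> norm e * norm ?d"
    using norm_cauchy_schwarz[of "- e" ?d] by simp
  also have "\<dots> \<le> norm e * (norm e / mf)" using d by (intro mult_left_mono) auto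
  finally have A: "- inner e ?d \<le> (norm e)\<^sup>2 / mf" by (simp add: power2_eq_square)
  have nM: "norm (MminusT E x) \<le> \<bar>sP\<bar> * norm x" for x :: "(real^'d)^'v"
    by (rule power2_le_imp_le) (use MminusT_le[of x] in \<open>auto simp: power_mult_distrib\<close>)
  have "- inner e (Mminus E (MminusT E ?d)) = - inner (MminusT E e) (MminusT E ?d)"
    by (metis Mminus_adjoint inner_commute)
  also have "\<dots> \<le> norm (MminusT E e) * norm (MminusT E ?d)"
    using norm_cauchy_schwarz[of "- MminusT E e" "MminusT E ?d"] by simp
  also have "\<dots> \<le> (\<bar>sP\<bar> * norm e) * (\<bar>sP\<bar> * (norm e / mf))"
    using d nM[of ?d] by (intro mult_mono nM order_trans[OF nM[of ?d]] mult_left_mono) auto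
  finally have "\<delta> / sM\<^sup>2 * (- inner e (Mminus E (MminusT E ?d))) \<le> \<delta> / sM\<^sup>2 * (sP\<^sup>2 * ((norm e)\<^sup>2 / mf))"
    using \<delta>_pos by (intro mult_left_mono) (auto simp: power2_eq_square algebra_simps)
  also have "\<dots> = (\<delta> * sP\<^sup>2) / sM\<^sup>2 * ((norm e)\<^sup>2 / mf)" by simp
  also have "\<dots> \<le> 1 * ((norm e)\<^sup>2 / mf)"
    using \<delta>_sP sM mf by (intro mult_right_mono) auto
  finally have B: "- (\<delta> / sM\<^sup>2 * inner e (Mminus E (MminusT E ?d))) \<le> (norm e)\<^sup>2 / mf" by simp
  have x': "x' = ?x0 + ?d" by simp
  have "Mminus E (b' - bs) = Mminus E (b - bs) + (\<rho> / 2) *\<^sub>R Mminus E (MminusT E ?x0)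
      + (\<rho> / 2) *\<^sub>R Mminus E (MminusT E ?d)"
    using step by (simp add: step_rel_def linear_diff[OF linear_Mminus] linear_add[OF linear_Mminus]
        linear_scale[OF linear_Mminus] linear_diff[OF linear_MminusT] scaleR_diff_right)
  then have "inner e (x' - xs) + 2 * \<delta> / (\<rho> * sM\<^sup>2) * inner e (Mminus E (b' - bs))
      = inner e (noise_factor z b) + inner e ?d + \<delta> / sM\<^sup>2 * inner e (Mminus E (MminusT E ?d))"
    using \<rho> by (simp add: noise_factor_def inner_add_right inner_diff_right distrib_left)
  then show ?thesis
    using step_contraction[OF step b] A B by (simp add: left_diff_distrib)
qed

text \<open>Serves only the square integrability of the noise factor, so the constant is
  crude.\<close>

lemma noise_factor_bound: "\<exists>K\<ge>0. \<forall>z b. (norm (noise_factor z b))\<^sup>2 \<le> K * energy z b"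
proof -
  define c where "c = 2 * \<delta> / (\<rho> * sM\<^sup>2)"
  obtain K where K: "\<And>z. norm (Mminus E z :: (real^'d)^'v) \<le> norm z * K"
    using bounded_linear.bounded[OF linear_Mminus[unfolded linear_conv_bounded_linear]] by blast
  obtain L where L: "\<And>x. norm (MminusT E (x :: (real^'d)^'v)) \<le> norm x * L"
    using bounded_linear.bounded[OF linear_MminusT[unfolded linear_conv_bounded_linear]] by blast
  define A where "A = 1 + \<bar>c\<bar> * (\<rho> / 2 * (\<bar>L\<bar> * \<bar>K\<bar>))"
  define B where "B = \<bar>c\<bar> * \<bar>K\<bar>"
  have "(norm (noise_factor z b))\<^sup>2 \<le> (2 * A\<^sup>2 / mf + 2 * B\<^sup>2 * \<rho>) * energy z b" for z b
  proof -
    let ?x = "noiseless z b - xs"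
    have K': "norm (Mminus E z :: (real^'d)^'v) \<le> norm z * \<bar>K\<bar>" for z :: "(real^'d)^('v \<times> 'v)"
      using K[of z] by (smt (verit) mult_left_mono norm_ge_zero)
    have "norm (MminusT E ?x) \<le> norm ?x * \<bar>L\<bar>"
      using L[of ?x] by (smt (verit) mult_left_mono norm_ge_zero)
    then have KL: "norm (Mminus E (MminusT E ?x)) \<le> norm ?x * \<bar>L\<bar> * \<bar>K\<bar>"
      by (intro order_trans[OF K'] mult_right_mono) auto
    \<comment> \<open>\<open>MminusT\<close> kills \<open>xs\<close>, so the noise-free update may
      be replaced by its error, which the energy controls.\<close>
    have "noise_factor z b = ?x + c *\<^sub>R (Mminus E (b - bs) + (\<rho> / 2) *\<^sub>R Mminus E (MminusT E ?x))"
      by (simp add: noise_factor_def c_def linear_diff[OF linear_MminusT] xs)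
    also have "norm \<dots> \<le> norm ?x + \<bar>c\<bar> * (norm (Mminus E (b - bs)) + \<rho> / 2 * norm (Mminus E (MminusT E ?x)))"
      using \<rho> by (intro order_trans[OF norm_triangle_ineq] add_left_mono)
        (auto intro!: mult_left_mono order_trans[OF norm_triangle_ineq])
    also have "\<dots> \<le> norm ?x + \<bar>c\<bar> * (norm (b - bs) * \<bar>K\<bar> + \<rho> / 2 * (norm ?x * \<bar>L\<bar> * \<bar>K\<bar>))"
      using \<rho> by (intro add_left_mono mult_left_mono add_mono K' KL) auto
    also have "\<dots> = A * norm ?x + B * norm (b - bs)"
      by (simp add: A_def B_def algebra_simps)
    finally have "(norm (noise_factor z b))\<^sup>2 \<le> (A * norm ?x + B * norm (b - bs))\<^sup>2"
      by (intro power_mono) auto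
    also have "\<dots> \<le> 2 * A\<^sup>2 * (norm ?x)\<^sup>2 + 2 * B\<^sup>2 * (norm (b - bs))\<^sup>2"
      using sum_squares_bound[of "A * norm ?x" "B * norm (b - bs)"]
      by (simp add: power2_sum power_mult_distrib)
    also have "\<dots> \<le> 2 * A\<^sup>2 * (energy z b / mf) + 2 * B\<^sup>2 * (\<rho> * energy z b)"
    proof (intro add_mono mult_left_mono)
      show "(norm ?x)\<^sup>2 \<le> energy z b / mf"
        using noiseless_bound[of z b] mf by (simp add: field_simps)
      have "(norm (b - bs))\<^sup>2 / \<rho> \<le> energy z b" using \<rho> by (simp add: energy_def)
      then show "(norm (b - bs))\<^sup>2 \<le> \<rho> * energy z b" using \<rho> by (simp add: field_simps)
    qed auto
    also have "\<dots> = (2 * A\<^sup>2 / mf + 2 * B\<^sup>2 * \<rho>) * energy z b" by (simp add: algebra_simps)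
    finally show ?thesis .
  qed
  moreover have "2 * A\<^sup>2 / mf + 2 * B\<^sup>2 * \<rho> \<ge> 0" using mf \<rho> by simp
  ultimately show ?thesis by blast
qed

lemma S_measurable [measurable]: "S \<in> borel_measurable borel"
  by (intro borel_measurable_continuous_onI S_continuous)

lemma noiseless_measurable [measurable (raw)]:
  assumes [measurable]: "u \<in> borel_measurable N" "v \<in> borel_measurable N"
  shows "(\<lambda>\<omega>. noiseless (u \<omega>) (v \<omega>)) \<in> borel_measurable N"
  unfolding noiseless_def by measurable

lemma noise_factor_measurable [measurable (raw)]:
  assumes [measurable]: "u \<in> borel_measurable N" "v \<in> borel_measurable N"
  shows "(\<lambda>\<omega>. noise_factor (u \<omega>) (v \<omega>)) \<in> borel_measurable N"
  unfolding noise_factor_def by measurable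

lemma energy_measurable [measurable (raw)]:
  assumes [measurable]: "u \<in> borel_measurable N" "v \<in> borel_measurable N"
  shows "(\<lambda>\<omega>. energy (u \<omega>) (v \<omega>)) \<in> borel_measurable N"
  unfolding energy_def by measurable

end

section \<open>Gaussian moments\<close>

lemma nn_integral_lborel_scale:
  fixes h :: "'a::euclidean_space \<Rightarrow> ennreal" and c :: real
  assumes [measurable]: "h \<in> borel_measurable borel" and c: "c \<noteq> 0"
  shows "(\<integral>\<^sup>+ x. h x \<partial>lborel) = ennreal (\<bar>c\<bar> ^ DIM('a)) * (\<integral>\<^sup>+ x. h (c *\<^sub>R x) \<partial>lborel)"
  by (subst lborel_affine[OF c, of 0])
    (simp add: nn_integral_density nn_integral_distr nn_integral_cmult)

context prob_space
begin

text \<open>|x|^2 exp(-|x|^2 / 2) is at most 4 exp(-|x|^2 / 4), and scaling by \<open>sqrt 2\<close>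
  turns this back into the Gaussian density. Its total mass is 1 because it is the density of a
  random vector, so no Gaussian integral is computed.\<close>

lemma gauss_norm_sq_integrable:
  fixes w :: "'a \<Rightarrow> 'b::euclidean_space"
  assumes w: "distributed M lborel w std_gauss_dens"
  shows "integrable M (\<lambda>\<omega>. (norm (w \<omega>))\<^sup>2)"
proof (rule integrableI_nonneg)
  have [measurable]: "w \<in> borel_measurable M" using distributed_measurable[OF w] by simp
  show "(\<lambda>\<omega>. (norm (w \<omega>))\<^sup>2) \<in> borel_measurable M" by measurable
  let ?C = "(2 * pi) powr (- real DIM('b) / 2)"
  let ?h = "\<lambda>x :: 'b. ennreal (4 * ?C * exp (- (norm x)\<^sup>2 / 4))"
  have total: "(\<integral>\<^sup>+ x. std_gauss_dens x \<partial>(lborel :: 'b measure)) = 1"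
    using distributed_nn_integral[OF w, of "\<lambda>_. 1"] by (simp add: emeasure_space_1)
  have "(\<integral>\<^sup>+ \<omega>. ennreal ((norm (w \<omega>))\<^sup>2) \<partial>M) = (\<integral>\<^sup>+ x. std_gauss_dens x * ennreal ((norm x)\<^sup>2) \<partial>(lborel :: 'b measure))"
    by (rule distributed_nn_integral[OF w, symmetric]) measurable
  also have "\<dots> \<le> (\<integral>\<^sup>+ x. ?h x \<partial>lborel)"
  proof (intro nn_integral_mono)
    fix x :: 'b
    define u where "u = (norm x)\<^sup>2"
    have "u / 4 \<le> exp (u / 4)" using exp_ge_add_one_self[of "u / 4"] by linarith
    then have "exp (- u / 2) * u \<le> exp (- u / 2) * (4 * exp (u / 4))" by (intro mult_left_mono) auto
    also have "\<dots> = 4 * exp (- u / 4)" by (simp flip: exp_add)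
    finally have "?C * (exp (- u / 2) * u) \<le> ?C * (4 * exp (- u / 4))" by (intro mult_left_mono) auto
    then show "std_gauss_dens x * ennreal ((norm x)\<^sup>2) \<le> ?h x"
      unfolding std_gauss_dens_def u_def[symmetric]
      by (simp flip: ennreal_mult'' add: u_def mult_ac ennreal_leI)
  qed
  also have "\<dots> = ennreal (\<bar>sqrt 2\<bar> ^ DIM('b)) * (\<integral>\<^sup>+ x. ?h (sqrt 2 *\<^sub>R x) \<partial>lborel)"
    by (rule nn_integral_lborel_scale) auto
  also have "(\<integral>\<^sup>+ x. ?h (sqrt 2 *\<^sub>R x) \<partial>lborel) = (\<integral>\<^sup>+ x. 4 * std_gauss_dens x \<partial>(lborel :: 'b measure))"
  proof (intro nn_integral_cong)
    fix x :: 'b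
    show "?h (sqrt 2 *\<^sub>R x) = 4 * std_gauss_dens x"
      by (simp add: std_gauss_dens_def power_mult_distrib ennreal_mult mult.assoc)
  qed
  also have "\<dots> = 4"
  proof -
    have "std_gauss_dens \<in> borel_measurable (lborel :: 'b measure)"
      unfolding std_gauss_dens_def by measurable
    then show ?thesis by (subst nn_integral_cmult) (simp_all add: total)
  qed
  also have "ennreal (\<bar>sqrt 2\<bar> ^ DIM('b)) * 4 < \<top>" by (simp add: ennreal_mult_less_top)
  finally show "(\<integral>\<^sup>+ \<omega>. ennreal ((norm (w \<omega>))\<^sup>2) \<partial>M) < \<infinity>" by simp
qed simp

text \<open>The integrand is odd and Lebesgue measure is invariant under reflection, so the integral
  equals its negative.\<close>

lemma gauss_inner_mean:
  fixes w :: "'a \<Rightarrow> 'b::euclidean_space"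
  assumes w: "distributed M lborel w std_gauss_dens"
  shows "(\<integral>\<omega>. inner (w \<omega>) b \<partial>M) = 0"
proof -
  let ?f = "\<lambda>x :: 'b. (2 * pi) powr (- real DIM('b) / 2) * exp (- (norm x)\<^sup>2 / 2)"
  have w': "distributed M lborel w (\<lambda>x. ennreal (?f x))"
    using w by (simp add: std_gauss_dens_def[abs_def])
  have "(\<integral>\<omega>. inner (w \<omega>) b \<partial>M) = (\<integral>x. ?f x * inner x b \<partial>lborel)"
    by (rule distributed_integral[OF w', symmetric]) auto
  also have "\<dots> = (\<integral>x. ?f x * inner x b \<partial>distr lborel borel (\<lambda>x. - x))"
    using lborel_affine[of "-1" "0 :: 'b"] by (simp add: density_1)
  also have "\<dots> = (\<integral>x. - (?f x * inner x b) \<partial>lborel)"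
    by (subst integral_distr) auto
  also have "\<dots> = - (\<integral>x. ?f x * inner x b \<partial>lborel)" by (rule Bochner_Integration.integral_minus)
  finally show ?thesis
    using distributed_integral[OF w', of "\<lambda>x. inner x b"] by simp
qed

text \<open>In coordinates the inner product is a finite sum of products of independent scalar
  variables, whose means factorise.\<close>

lemma indep_inner_mean_zero:
  fixes w h :: "'a \<Rightarrow> 'b::euclidean_space"
  assumes ind: "indep_var borel w borel h"
    and w: "integrable M (\<lambda>\<omega>. (norm (w \<omega>))\<^sup>2)" and h: "integrable M (\<lambda>\<omega>. (norm (h \<omega>))\<^sup>2)"
    and mean: "\<And>b. (\<integral>\<omega>. inner (w \<omega>) b \<partial>M) = 0"
  shows "integrable M (\<lambda>\<omega>. inner (w \<omega>) (h \<omega>))" and "(\<integral>\<omega>. inner (w \<omega>) (h \<omega>) \<partial>M) = 0"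
proof -
  have rv[measurable]: "w \<in> borel_measurable M" "h \<in> borel_measurable M"
    using ind indep_var_rv1 indep_var_rv2 by blast+
  have int: "integrable M (\<lambda>\<omega>. inner (v \<omega>) b)"
    if [measurable]: "v \<in> borel_measurable M" and v: "integrable M (\<lambda>\<omega>. (norm (v \<omega>))\<^sup>2)" for v :: "'a \<Rightarrow> 'b" and b
  proof (rule Bochner_Integration.integrable_bound)
    have "integrable M (\<lambda>\<omega>. norm (v \<omega>))" by (rule square_integrable_imp_integrable) (simp_all add: v)
    then show "integrable M (\<lambda>\<omega>. norm (v \<omega>) * norm b)" by simp
    show "AE \<omega> in M. norm (inner (v \<omega>) b) \<le> norm (norm (v \<omega>) * norm b)"
      by (auto simp: Cauchy_Schwarz_ineq2)
  qed simp
  have "indep_var borel (\<lambda>\<omega>. inner (w \<omega>) b) borel (\<lambda>\<omega>. inner (h \<omega>) b)" for b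
    using indep_var_compose[OF ind, of "\<lambda>x. inner x b" borel "\<lambda>x. inner x b" borel] by (simp add: o_def)
  note ib = this int[OF rv(1) w] int[OF rv(2) h]
  have eq: "inner (w \<omega>) (h \<omega>) = (\<Sum>b\<in>Basis. inner (w \<omega>) b * inner (h \<omega>) b)" for \<omega>
    by (rule euclidean_inner)
  show "integrable M (\<lambda>\<omega>. inner (w \<omega>) (h \<omega>))"
    unfolding eq by (intro Bochner_Integration.integrable_sum indep_var_integrable ib)
  have "(\<integral>\<omega>. inner (w \<omega>) (h \<omega>) \<partial>M) = (\<Sum>b\<in>Basis. \<integral>\<omega>. inner (w \<omega>) b * inner (h \<omega>) b \<partial>M)"
    unfolding eq by (intro Bochner_Integration.integral_sum indep_var_integrable ib)
  also have "\<dots> = 0"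
    by (intro sum.neutral ballI) (simp add: indep_var_lebesgue_integral[OF ib] mean)
  finally show "(\<integral>\<omega>. inner (w \<omega>) (h \<omega>) \<partial>M) = 0" .
qed

end

section \<open>The noisy chain\<close>

lemma Dmat_adjoint: "inner (Dmat E x) y = inner x (Dmat E y)"
  unfolding inner_vec_def[of "Dmat E x" y] inner_vec_def[of x "Dmat E y"] by (simp add: Dmat_def)

text \<open>\<open>wbar\<close> is itself a multiple of \<open>norm (Dmat E v)\<close>, so every
  term is quadratic in it; integrability of \<open>r_rv\<close> follows.\<close>

lemma r_rv_eq:
  obtains c where "\<And>v. r_rv E \<kappa> \<rho> mf Mf sP sM sMx v = c * (norm (Dmat E v))\<^sup>2"
proof -
  let ?\<delta> = "delta_c \<kappa> \<rho> mf Mf sP sM" and ?\<omega> = "\<bar>1 / (sqrt 2 * mf)\<bar> + sqrt 2"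
  let ?c = "sqrt 2 * b_c ?\<delta> / mf * ?\<omega> + b_c ?\<delta> * ?\<omega>\<^sup>2 + b_c ?\<delta> / (2 * mf\<^sup>2)
    + sqrt 2 * c_c ?\<delta> sM * dt_c \<rho> sMx / mf - e_c ?\<delta> \<rho> sM"
  have w: "wbar E mf v = ?\<omega> * norm (Dmat E v)" for v
    by (simp add: wbar_def algebra_simps)
  have alg: "s * b / m * (o' * n) * n + b * (o' * n)\<^sup>2 + b / (2 * m\<^sup>2) * n\<^sup>2 + s * c * d / m * n\<^sup>2 - e * n\<^sup>2
      = (s * b / m * o' + b * o'\<^sup>2 + b / (2 * m\<^sup>2) + s * c * d / m - e) * n\<^sup>2"
    for s b m o' n c d e :: real
    by (simp add: power_mult_distrib distrib_right left_diff_distrib) (simp add: power2_eq_square)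
  have "r_rv E \<kappa> \<rho> mf Mf sP sM sMx v = ?c * (norm (Dmat E v))\<^sup>2" for v
    unfolding r_rv_def Let_def w by (rule alg)
  then show thesis by (rule that)
qed

lemma integrable_nonneg_bound:
  fixes u h :: "'w \<Rightarrow> real"
  assumes "integrable M h" "u \<in> borel_measurable M"
    and "\<And>\<omega>. \<omega> \<in> space M \<Longrightarrow> 0 \<le> u \<omega>" "\<And>\<omega>. \<omega> \<in> space M \<Longrightarrow> u \<omega> \<le> h \<omega>"
  shows "integrable M u"
proof (rule Bochner_Integration.integrable_bound[OF assms(1,2)], rule AE_I2)
  fix \<omega> assume "\<omega> \<in> space M"
  then show "norm (u \<omega>) \<le> norm (h \<omega>)" using assms(3,4)[of \<omega>] by simp
qed

lemma measurable_eqI: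
  assumes "v \<in> measurable N L" "\<And>\<omega>. \<omega> \<in> space N \<Longrightarrow> u \<omega> = v \<omega>"
  shows "u \<in> measurable N L"
  using assms measurable_cong[of N u v L] by blast

text \<open>With e = sqrt 2 D w the shift e / (2 m) is D w / (sqrt 2 m): this is the origin of the
  shifted Gaussian in the final bound.\<close>

lemma complete_square:
  fixes x e :: "'b::real_inner"
  assumes "m > 0"
  shows "m * (norm (x + (1 / (2 * m)) *\<^sub>R e))\<^sup>2 = m * (norm x)\<^sup>2 + inner e x + (norm e)\<^sup>2 / (4 * m)"
proof -
  have "(norm (x + (1 / (2 * m)) *\<^sub>R e))\<^sup>2
      = (norm x)\<^sup>2 + 2 * (1 / (2 * m) * inner e x) + (1 / (2 * m))\<^sup>2 * (norm e)\<^sup>2"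
    unfolding power2_norm_eq_inner
    by (simp add: inner_add_left inner_add_right inner_commute power2_eq_square)
  then show ?thesis using assms by (simp add: distrib_left power2_eq_square)
qed

locale noisy_chain = noisy_step E "gradF g" mf Mf \<rho> \<kappa> sP sM xs zs bs + prob_space M
  for E :: "'v::finite \<Rightarrow> 'v \<Rightarrow> bool" and g :: "'v \<Rightarrow> real^'d \<Rightarrow> real^'d"
    and mf Mf \<rho> \<kappa> sP sM xs zs bs and M :: "'w measure" +
  fixes X :: "nat \<Rightarrow> 'w \<Rightarrow> (real^'d)^'v" and Z \<beta> :: "nat \<Rightarrow> 'w \<Rightarrow> (real^'d)^('v \<times> 'v)"
    and w :: "nat \<Rightarrow> 'w \<Rightarrow> (real^'d)^'v"
  assumes iter: "noisy_iter E g \<rho> M X Z \<beta> w"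
begin

lemma X_measurable [measurable]: "X k \<in> borel_measurable M"
  and Z_measurable [measurable]: "Z k \<in> borel_measurable M"
  and \<beta>_measurable [measurable]: "\<beta> k \<in> borel_measurable M"
  using iter unfolding noisy_iter_def by blast+

lemma w_distributed: "k \<ge> 1 \<Longrightarrow> distributed M lborel (w k) std_gauss_dens"
  using iter unfolding noisy_iter_def by blast+

text \<open>The index starts at 1, since the iteration says nothing about
  \<open>w 0\<close>.\<close>

lemma w_measurable [measurable]: "w (Suc k) \<in> borel_measurable M"
  using distributed_measurable[OF w_distributed[of "Suc k"]] by simp

abbreviation noise where "noise k \<omega> \<equiv> sqrt 2 *\<^sub>R Dmat E (w (Suc k) \<omega>)"

lemma step:
  assumes "\<omega> \<in> space M"
  shows "step_rel (noise k \<omega>) (Z k \<omega>) (\<beta> k \<omega>) (X (Suc k) \<omega>) (Z (Suc k) \<omega>) (\<beta> (Suc k) \<omega>)"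
proof -
  have "gradF g (X (Suc k) \<omega>) + Mminus E (\<beta> (Suc k) \<omega>) + sqrt 2 *\<^sub>R Dmat E (w (Suc k) \<omega>)
          = \<rho> *\<^sub>R Mplus E (Z k \<omega> - Z (Suc k) \<omega>)"
    and "\<beta> (Suc k) \<omega> - \<beta> k \<omega> - (\<rho> / 2) *\<^sub>R MminusT E (X (Suc k) \<omega>) = 0"
    and "(1/2) *\<^sub>R MplusT E (X (Suc k) \<omega>) - Z (Suc k) \<omega> = 0"
    using iter assms unfolding noisy_iter_def by blast+
  then show ?thesis unfolding step_rel_def by (simp add: algebra_simps)
qed

lemma \<beta>_in_range: "\<omega> \<in> space M \<Longrightarrow> \<beta> k \<omega> \<in> range (MminusT E)"
proof (induction k)
  case 0
  then show ?case using iter unfolding noisy_iter_def by blast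
next
  case (Suc k)
  have sub: "subspace (range (MminusT E :: (real^'d)^'v \<Rightarrow> _))"
    by (simp add: linear_subspace_image[OF linear_MminusT])
  have "\<beta> (Suc k) \<omega> = \<beta> k \<omega> + (\<rho> / 2) *\<^sub>R MminusT E (X (Suc k) \<omega>)"
    using step[OF Suc.prems, of k] by (simp add: step_rel_def)
  then show ?case
    using Suc by (auto intro!: subspace_add[OF sub] subspace_scale[OF sub])
qed

lemma Dw_integrable: "integrable M (\<lambda>\<omega>. (norm (Dmat E (w (Suc k) \<omega>)))\<^sup>2)"
proof -
  obtain K where K: "\<And>x. norm (Dmat E (x :: (real^'d)^'v)) \<le> norm x * K"
    using bounded_linear.bounded[OF linear_Dmat[unfolded linear_conv_bounded_linear]] by blast
  have K2: "(norm (Dmat E x))\<^sup>2 \<le> (norm x)\<^sup>2 * K\<^sup>2" for x :: "(real^'d)^'v"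
    using power_mono[OF K[of x], of 2] by (simp add: power_mult_distrib)
  show ?thesis
  proof (rule integrable_nonneg_bound)
    show "integrable M (\<lambda>\<omega>. (norm (w (Suc k) \<omega>))\<^sup>2 * K\<^sup>2)"
      using gauss_norm_sq_integrable[OF w_distributed[of "Suc k"]] by simp
  qed (use K2 in simp_all)
qed

text \<open>Completing the square in \<open>step_primal\<close> gives a pointwise growth bound: one
  step adds at most |D w|^2 / (2 mf).\<close>

lemma energy_integrable: "integrable M (\<lambda>\<omega>. energy (Z k \<omega>) (\<beta> k \<omega>))"
proof (induction k)
  case 0
  have sq: "(norm (u - v))\<^sup>2 \<le> 2 * (norm u)\<^sup>2 + 2 * (norm v)\<^sup>2" for u v :: "(real^'d)^('v \<times> 'v)"
    using norm_add_sq_le[of 2 u "- v"] by simp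
  show ?case
  proof (rule integrable_nonneg_bound)
    let ?h = "\<lambda>\<omega>. \<rho> * (2 * (norm (Z 0 \<omega>))\<^sup>2 + 2 * (norm zs)\<^sup>2) + (2 * (norm (\<beta> 0 \<omega>))\<^sup>2 + 2 * (norm bs)\<^sup>2) / \<rho>"
    show "integrable M ?h"
    proof -
      have "integrable M (\<lambda>\<omega>. (norm (Z 0 \<omega>))\<^sup>2)" "integrable M (\<lambda>\<omega>. (norm (\<beta> 0 \<omega>))\<^sup>2)"
        using iter unfolding noisy_iter_def by blast+
      then show ?thesis by simp
    qed
    show "energy (Z 0 \<omega>) (\<beta> 0 \<omega>) \<le> ?h \<omega>" for \<omega>
      unfolding energy_def using \<rho> sq by (intro add_mono mult_left_mono divide_right_mono) auto
  qed (simp_all add: energy_nonneg)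
next
  case (Suc k)
  show ?case
  proof (rule integrable_nonneg_bound)
    let ?h = "\<lambda>\<omega>. energy (Z k \<omega>) (\<beta> k \<omega>) + (norm (Dmat E (w (Suc k) \<omega>)))\<^sup>2 / (2 * mf)"
    show "integrable M ?h" using Suc Dw_integrable[of k] by simp
    show "energy (Z (Suc k) \<omega>) (\<beta> (Suc k) \<omega>) \<le> ?h \<omega>" if "\<omega> \<in> space M" for \<omega>
    proof -
      let ?x = "X (Suc k) \<omega> - xs" and ?e = "noise k \<omega>"
      have "0 \<le> mf * (norm (?x + (1 / (2 * mf)) *\<^sub>R ?e))\<^sup>2" using mf by simp
      also have "\<dots> = mf * (norm ?x)\<^sup>2 + inner ?e ?x + (norm ?e)\<^sup>2 / (4 * mf)"
        by (rule complete_square[OF mf])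
      also have "(norm ?e)\<^sup>2 / (4 * mf) = (norm (Dmat E (w (Suc k) \<omega>)))\<^sup>2 / (2 * mf)"
        by (simp add: power_mult_distrib)
      finally show ?thesis using step_primal[OF step[OF that, of k]] by linarith
    qed
  qed (simp_all add: energy_nonneg)
qed

section \<open>The filtration and the independence of the fresh noise\<close>

definition Fam :: "nat option \<Rightarrow> 'w set set" where
  "Fam i = (case i of
                None \<Rightarrow> {(\<lambda>\<omega>. (X 0 \<omega>, \<beta> 0 \<omega>)) -` A \<inter> space M | A. A \<in> sets borel}
              | Some k \<Rightarrow> {w k -` A \<inter> space M | A. A \<in> sets borel})"

text \<open>The natural filtration: the initial data and the first \<open>k\<close> noises, without
  \<open>w 0\<close>.\<close>

definition past :: "nat \<Rightarrow> 'w measure" where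
  "past k = sigma (space M) (\<Union>i\<in>insert None (Some ` {1..k}). Fam i)"

lemma Fam_subset: "(\<Union>i\<in>I. Fam i) \<subseteq> Pow (space M)"
  by (auto simp: Fam_def split: option.splits)

lemma space_past [simp]: "space (past k) = space M"
  unfolding past_def by (rule space_measure_of[OF Fam_subset])

lemma sets_past: "sets (past k) = sigma_sets (space M) (\<Union>i\<in>insert None (Some ` {1..k}). Fam i)"
  unfolding past_def by (rule sets_measure_of[OF Fam_subset])

lemma past_Suc: "f \<in> measurable (past k) N \<Longrightarrow> f \<in> measurable (past (Suc k)) N"
proof (rule measurable_from_subalg)
  have "sets (past k) \<subseteq> sets (past (Suc k))"
    unfolding sets_past by (intro sigma_sets_mono' UN_mono) auto
  then show "subalgebra (past (Suc k)) (past k)" by (simp add: subalgebra_def)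
qed

lemma w_past: "w (Suc k) \<in> borel_measurable (past (Suc k))"
proof (rule measurableI)
  fix A :: "((real^'d)^'v) set" assume "A \<in> sets borel"
  then have "w (Suc k) -` A \<inter> space M \<in> Fam (Some (Suc k))" by (auto simp: Fam_def)
  then show "w (Suc k) -` A \<inter> space (past (Suc k)) \<in> sets (past (Suc k))"
    unfolding sets_past by (intro sigma_sets.Basic) auto
qed simp

text \<open>Induction through \<open>step_iff\<close>. The iteration holds only on
  \<open>space M\<close>, hence each measurability is transferred from an explicit expression that
  agrees there.\<close>

lemma adapted: "Z k \<in> borel_measurable (past k) \<and> \<beta> k \<in> borel_measurable (past k)"
proof (induction k)
  case 0
  have "(\<lambda>\<omega>. (X 0 \<omega>, \<beta> 0 \<omega>)) \<in> borel_measurable (past 0)"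
  proof (rule measurableI)
    fix A :: "(((real^'d)^'v) \<times> ((real^'d)^('v \<times> 'v))) set" assume "A \<in> sets borel"
    then have "(\<lambda>\<omega>. (X 0 \<omega>, \<beta> 0 \<omega>)) -` A \<inter> space M \<in> Fam None" by (auto simp: Fam_def)
    then show "(\<lambda>\<omega>. (X 0 \<omega>, \<beta> 0 \<omega>)) -` A \<inter> space (past 0) \<in> sets (past 0)"
      unfolding sets_past by (intro sigma_sets.Basic) auto
  qed simp
  then have "(\<lambda>\<omega>. (X 0 \<omega>, \<beta> 0 \<omega>)) \<in> measurable (past 0) (borel \<Otimes>\<^sub>M borel)" by (simp only: borel_prod)
  then have [measurable]: "X 0 \<in> borel_measurable (past 0)" "\<beta> 0 \<in> borel_measurable (past 0)"
    by (simp_all add: measurable_pair_iff o_def)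
  have "(\<lambda>\<omega>. (1/2) *\<^sub>R MplusT E (X 0 \<omega>)) \<in> borel_measurable (past 0)" by measurable
  then have "Z 0 \<in> borel_measurable (past 0)"
  proof (rule measurable_eqI)
    fix \<omega> assume "\<omega> \<in> space (past 0)"
    then show "Z 0 \<omega> = (1/2) *\<^sub>R MplusT E (X 0 \<omega>)"
      using iter unfolding noisy_iter_def space_past by blast
  qed
  then show ?case by simp
next
  case (Suc k)
  then have [measurable]: "Z k \<in> borel_measurable (past (Suc k))" "\<beta> k \<in> borel_measurable (past (Suc k))"
    by (auto intro: past_Suc)
  note w_past[of k, measurable]
  have "(\<lambda>\<omega>. S (\<rho> *\<^sub>R Mplus E (Z k \<omega>) - Mminus E (\<beta> k \<omega>) - noise k \<omega>)) \<in> borel_measurable (past (Suc k))"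
    by measurable
  then have [measurable]: "X (Suc k) \<in> borel_measurable (past (Suc k))"
    by (rule measurable_eqI) (use step[of _ k] in \<open>simp add: step_iff\<close>)
  have "(\<lambda>\<omega>. (1/2) *\<^sub>R MplusT E (X (Suc k) \<omega>)) \<in> borel_measurable (past (Suc k))" by measurable
  then have "Z (Suc k) \<in> borel_measurable (past (Suc k))"
    by (rule measurable_eqI) (use step[of _ k] in \<open>simp add: step_iff\<close>)
  moreover have "(\<lambda>\<omega>. \<beta> k \<omega> + (\<rho> / 2) *\<^sub>R MminusT E (X (Suc k) \<omega>)) \<in> borel_measurable (past (Suc k))"
    by measurable
  then have "\<beta> (Suc k) \<in> borel_measurable (past (Suc k))"
    by (rule measurable_eqI) (use step[of _ k] in \<open>simp add: step_iff\<close>)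
  ultimately show ?case by blast
qed

text \<open>The independent generators are grouped into two blocks of indices, the fresh noise and
  the past; as they are closed under intersection, independence passes to the generated
  sigma-algebras.\<close>

lemma indep_noise:
  assumes [measurable]: "h \<in> borel_measurable (past k)" "h \<in> borel_measurable M"
  shows "indep_var borel (w (Suc k)) borel h"
  unfolding indep_var_eq
proof (intro conjI)
  let ?I = "case_bool {Some (Suc k)} (insert None (Some ` {1..k}))"
  have "indep_sets Fam (insert None (Some ` {1..}))"
    using iter unfolding noisy_iter_def Fam_def[abs_def] by blast
  then have "indep_sets Fam (\<Union>b\<in>UNIV. ?I b)"
    by (rule indep_sets_mono_index[rotated]) (auto split: bool.splits)
  then have "indep_sets (\<lambda>b. sigma_sets (space M) (\<Union>i\<in>?I b. Fam i)) UNIV"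
  proof (rule indep_sets_collect_sigma)
    show "Int_stable (Fam i)" for i
    proof (cases i)
      case None
      show ?thesis unfolding None Fam_def option.case
      proof (rule Int_stableI, clarify)
        fix A B :: "(((real^'d)^'v) \<times> ((real^'d)^('v \<times> 'v))) set" assume "A \<in> sets borel" "B \<in> sets borel"
        then show "\<exists>C. (\<lambda>\<omega>. (X 0 \<omega>, \<beta> 0 \<omega>)) -` A \<inter> space M \<inter> ((\<lambda>\<omega>. (X 0 \<omega>, \<beta> 0 \<omega>)) -` B \<inter> space M)
            = (\<lambda>\<omega>. (X 0 \<omega>, \<beta> 0 \<omega>)) -` C \<inter> space M \<and> C \<in> sets borel"
          by (intro exI[of _ "A \<inter> B"]) auto
      qed
    next
      case (Some j)
      show ?thesis unfolding Some Fam_def option.case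
      proof (rule Int_stableI, clarify)
        fix A B :: "((real^'d)^'v) set" assume "A \<in> sets borel" "B \<in> sets borel"
        then show "\<exists>C. w j -` A \<inter> space M \<inter> (w j -` B \<inter> space M) = w j -` C \<inter> space M \<and> C \<in> sets borel"
          by (intro exI[of _ "A \<inter> B"]) auto
      qed
    qed
    show "disjoint_family_on ?I UNIV"
      by (auto simp: disjoint_family_on_def split: bool.splits)
  qed
  then show "indep_set (sigma_sets (space M) {w (Suc k) -` A \<inter> space M |A. A \<in> sets borel})
      (sigma_sets (space M) {h -` A \<inter> space M |A. A \<in> sets borel})"
    unfolding indep_set_def
  proof (rule indep_sets_mono_sets)
    have "{h -` A \<inter> space M |A. A \<in> sets borel} \<subseteq> sets (past k)"
      using measurable_sets[OF assms(1), unfolded space_past] by blast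
    then have "sigma_sets (space M) {h -` A \<inter> space M |A. A \<in> sets borel} \<subseteq> sets (past k)"
      by (rule sets.sigma_sets_subset[of _ "past k", unfolded space_past])
    then show "(case b of True \<Rightarrow> sigma_sets (space M) {w (Suc k) -` A \<inter> space M |A. A \<in> sets borel}
          | False \<Rightarrow> sigma_sets (space M) {h -` A \<inter> space M |A. A \<in> sets borel})
        \<subseteq> sigma_sets (space M) (\<Union>i\<in>?I b. Fam i)" for b
      by (cases b) (simp_all add: sets_past Fam_def)
  qed
qed measurable

lemma noise_mean_zero:
  shows "integrable M (\<lambda>\<omega>. inner (noise k \<omega>) (noise_factor (Z k \<omega>) (\<beta> k \<omega>)))"
    and "(\<integral>\<omega>. inner (noise k \<omega>) (noise_factor (Z k \<omega>) (\<beta> k \<omega>)) \<partial>M) = 0"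
proof -
  \<comment> \<open>The self-adjoint \<open>Dmat\<close> is moved to the other side, leaving
    \<open>w (Suc k)\<close> itself against a vector known in the past.\<close>
  let ?h = "\<lambda>\<omega>. sqrt 2 *\<^sub>R Dmat E (noise_factor (Z k \<omega>) (\<beta> k \<omega>))"
  have eq: "inner (noise k \<omega>) (noise_factor (Z k \<omega>) (\<beta> k \<omega>)) = inner (w (Suc k) \<omega>) (?h \<omega>)" for \<omega>
    by (simp add: Dmat_adjoint)
  have [measurable]: "Z k \<in> borel_measurable (past k)" "\<beta> k \<in> borel_measurable (past k)"
    using adapted by auto
  have ind: "indep_var borel (w (Suc k)) borel ?h" by (rule indep_noise) measurable
  obtain K where K: "K \<ge> 0" "\<And>z b. (norm (noise_factor z b))\<^sup>2 \<le> K * energy z b"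
    using noise_factor_bound by blast
  obtain L where L: "\<And>x. norm (Dmat E (x :: (real^'d)^'v)) \<le> norm x * L"
    using bounded_linear.bounded[OF linear_Dmat[unfolded linear_conv_bounded_linear]] by blast
  have h: "integrable M (\<lambda>\<omega>. (norm (?h \<omega>))\<^sup>2)"
  proof (rule integrable_nonneg_bound)
    show "integrable M (\<lambda>\<omega>. 2 * L\<^sup>2 * (K * energy (Z k \<omega>) (\<beta> k \<omega>)))"
      using energy_integrable by simp
    show "(norm (?h \<omega>))\<^sup>2 \<le> 2 * L\<^sup>2 * (K * energy (Z k \<omega>) (\<beta> k \<omega>))" for \<omega>
    proof -
      have "(norm (?h \<omega>))\<^sup>2 = 2 * (norm (Dmat E (noise_factor (Z k \<omega>) (\<beta> k \<omega>))))\<^sup>2"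
        by (simp add: power_mult_distrib)
      also have "\<dots> \<le> 2 * (norm (noise_factor (Z k \<omega>) (\<beta> k \<omega>)) * L)\<^sup>2"
        by (intro mult_left_mono power_mono L) auto
      also have "\<dots> = 2 * L\<^sup>2 * (norm (noise_factor (Z k \<omega>) (\<beta> k \<omega>)))\<^sup>2"
        by (simp add: power_mult_distrib)
      also have "\<dots> \<le> 2 * L\<^sup>2 * (K * energy (Z k \<omega>) (\<beta> k \<omega>))"
        by (intro mult_left_mono K(2)) auto
      finally show ?thesis .
    qed
  qed simp_all
  note zero = indep_inner_mean_zero[OF ind gauss_norm_sq_integrable[OF w_distributed] h gauss_inner_mean[OF w_distributed]]
  show "integrable M (\<lambda>\<omega>. inner (noise k \<omega>) (noise_factor (Z k \<omega>) (\<beta> k \<omega>)))"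
    unfolding eq by (rule zero(1)) auto
  show "(\<integral>\<omega>. inner (noise k \<omega>) (noise_factor (Z k \<omega>) (\<beta> k \<omega>)) \<partial>M) = 0"
    unfolding eq by (rule zero(2)) auto
qed

section \<open>Recursion for the expected energy\<close>

definition V where "V k = (\<integral>\<omega>. energy (Z k \<omega>) (\<beta> k \<omega>) \<partial>M)"

lemma V_nonneg: "V k \<ge> 0"
  unfolding V_def by (intro integral_nonneg_AE) (simp add: energy_nonneg)

lemma V_rec:
  "(1 + \<delta>) * V (Suc k)
    \<le> V k + (4 / mf - 2 * \<delta> / (\<rho> * sM\<^sup>2)) * (\<integral>\<omega>. (norm (Dmat E (w (Suc k) \<omega>)))\<^sup>2 \<partial>M)"
proof -
  let ?c = "4 / mf - 2 * \<delta> / (\<rho> * sM\<^sup>2)"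
  let ?n = "\<lambda>\<omega>. (norm (Dmat E (w (Suc k) \<omega>)))\<^sup>2"
  let ?i = "\<lambda>\<omega>. inner (noise k \<omega>) (noise_factor (Z k \<omega>) (\<beta> k \<omega>))"
  have "(1 + \<delta>) * V (Suc k) = (\<integral>\<omega>. (1 + \<delta>) * energy (Z (Suc k) \<omega>) (\<beta> (Suc k) \<omega>) \<partial>M)"
    by (simp add: V_def)
  also have "\<dots> \<le> (\<integral>\<omega>. energy (Z k \<omega>) (\<beta> k \<omega>) - ?i \<omega> + ?c * ?n \<omega> \<partial>M)"
  proof (rule integral_mono)
    fix \<omega> assume "\<omega> \<in> space M"
    from step_noise[OF step[OF this, of k] \<beta>_in_range[OF this]]
    have "(1 + \<delta>) * energy (Z (Suc k) \<omega>) (\<beta> (Suc k) \<omega>)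
        \<le> energy (Z k \<omega>) (\<beta> k \<omega>) - ?i \<omega> + (2 / mf - \<delta> / (\<rho> * sM\<^sup>2)) * (norm (noise k \<omega>))\<^sup>2" .
    \<comment> \<open>The squared noise is twice the square of \<open>norm (Dmat E w)\<close>, which
      doubles both coefficients.\<close>
    also have "(2 / mf - \<delta> / (\<rho> * sM\<^sup>2)) * (norm (noise k \<omega>))\<^sup>2 = ?c * ?n \<omega>"
      by (simp add: power_mult_distrib algebra_simps)
    finally show "(1 + \<delta>) * energy (Z (Suc k) \<omega>) (\<beta> (Suc k) \<omega>)
        \<le> energy (Z k \<omega>) (\<beta> k \<omega>) - ?i \<omega> + ?c * ?n \<omega>" .
  qed (use energy_integrable noise_mean_zero(1) Dw_integrable in simp_all)
  also have "\<dots> = V k - 0 + ?c * (\<integral>\<omega>. ?n \<omega> \<partial>M)"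
    using energy_integrable[of k] noise_mean_zero[of k] Dw_integrable[of k]
    by (simp add: V_def)
  finally show ?thesis by simp
qed

text \<open>With s = 1 / mf the three terms with \<open>b_c\<close> add up exactly to (1 + s)^2 / (1
  + \<delta>), which dominates 4 s / (1 + \<delta>). The \<open>c_c\<close> term is nonnegative, and
  the \<open>e_c\<close> term is precisely the negative part on the left.\<close>

lemma r_rv_ge:
  "(4 / mf - 2 * \<delta> / (\<rho> * sM\<^sup>2)) / (1 + \<delta>) * (norm (Dmat E v))\<^sup>2 \<le> r_rv E \<kappa> \<rho> mf Mf sP sM sMx v"
proof -
  let ?n = "norm (Dmat E v)"
  define s where "s = 1 / mf"
  have s: "s > 0" using mf by (simp add: s_def)
  let ?K = "sqrt 2 * (s / 2 + 1)"
  have q: "1 / (sqrt 2 * mf) = sqrt 2 * (s / 2)" using mf by (simp add: s_def field_simps)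
  have wb: "wbar E mf v = ?K * ?n"
    unfolding wbar_def q norm_scaleR using s by (simp add: distrib_left distrib_right)
  have "sqrt 2 * b_c \<delta> / mf * (K * ?n) * ?n + b_c \<delta> * (K * ?n)\<^sup>2 + b_c \<delta> / (2 * mf\<^sup>2) * ?n\<^sup>2
      = b_c \<delta> * (sqrt 2 * s * K + K\<^sup>2 + s\<^sup>2 / 2) * ?n\<^sup>2" for K
    unfolding s_def by (simp add: power_mult_distrib distrib_left distrib_right) (simp add: power2_eq_square mult_ac)
  from this[of ?K]
  have "sqrt 2 * b_c \<delta> / mf * wbar E mf v * ?n + b_c \<delta> * (wbar E mf v)\<^sup>2 + b_c \<delta> / (2 * mf\<^sup>2) * ?n\<^sup>2
      = b_c \<delta> * (sqrt 2 * s * ?K + ?K\<^sup>2 + s\<^sup>2 / 2) * ?n\<^sup>2"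
    by (simp only: wb)
  also have "sqrt 2 * s * ?K + ?K\<^sup>2 + s\<^sup>2 / 2 = 2 * (1 + s)\<^sup>2"
  proof -
    have "sqrt 2 * s * ?K + ?K\<^sup>2 = (sqrt 2 * sqrt 2) * (s * (s / 2 + 1) + (s / 2 + 1)\<^sup>2)"
      by (simp only: power_mult_distrib) (simp only: power2_eq_square algebra_simps)
    then show ?thesis by (simp add: power2_eq_square algebra_simps)
  qed
  also have "b_c \<delta> * (2 * (1 + s)\<^sup>2) = (1 + s)\<^sup>2 / (1 + \<delta>)"
    using \<delta>_pos by (simp add: b_c_def field_simps)
  finally have B: "sqrt 2 * b_c \<delta> / mf * wbar E mf v * ?n + b_c \<delta> * (wbar E mf v)\<^sup>2 + b_c \<delta> / (2 * mf\<^sup>2) * ?n\<^sup>2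
      = (1 + s)\<^sup>2 / (1 + \<delta>) * ?n\<^sup>2" .
  have "4 * s \<le> (1 + s)\<^sup>2"
    using sum_squares_bound[of 1 s] by (simp add: power2_sum)
  then have "4 / mf / (1 + \<delta>) * ?n\<^sup>2 \<le> (1 + s)\<^sup>2 / (1 + \<delta>) * ?n\<^sup>2"
    using \<delta>_pos by (intro mult_right_mono divide_right_mono) (auto simp: s_def)
  moreover have "0 \<le> sqrt 2 * c_c \<delta> sM * dt_c \<rho> sMx / mf * ?n\<^sup>2"
    using \<delta>_pos \<rho> mf by (simp add: c_c_def dt_c_def)
  moreover have "e_c \<delta> \<rho> sM = 2 * \<delta> / (\<rho> * sM\<^sup>2) / (1 + \<delta>)"
    by (simp add: e_c_def mult_ac)
  ultimately show ?thesis
    unfolding r_rv_def Let_def \<delta>_def[symmetric] B by (simp add: diff_divide_distrib left_diff_distrib)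
qed

abbreviation a where "a \<equiv> a_c mf \<delta>"

text \<open>a is (1 + 1 / (2 mf)) / (1 + \<delta>); the recursion really contracts by the smaller
  factor 1 / (1 + \<delta>).\<close>

lemma inverse_le_a: "1 / (1 + \<delta>) \<le> a"
proof -
  have "a = (1 + 1 / (2 * mf)) / (1 + \<delta>)" using mf \<delta>_pos by (simp add: a_c_def field_simps)
  then show ?thesis using mf \<delta>_pos by (simp add: divide_right_mono)
qed

lemma a_pos: "a > 0"
  using inverse_le_a \<delta>_pos by (smt (verit) divide_pos_pos)

lemma r_rv_integrable: "integrable M (\<lambda>\<omega>. r_rv E \<kappa> \<rho> mf Mf sP sM sMx (w (Suc k) \<omega>))"
proof -
  obtain c where "\<And>v :: (real^'d)^'v. r_rv E \<kappa> \<rho> mf Mf sP sM sMx v = c * (norm (Dmat E v))\<^sup>2" by (rule r_rv_eq) blast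
  then show ?thesis using Dw_integrable by simp
qed

lemma V_step:
  assumes "\<bar>\<integral>\<omega>. r_rv E \<kappa> \<rho> mf Mf sP sM sMx (w (Suc k) \<omega>) \<partial>M\<bar> \<le> R"
  shows "V (Suc k) \<le> a * V k + R"
proof -
  let ?c = "4 / mf - 2 * \<delta> / (\<rho> * sM\<^sup>2)"
  let ?N = "\<integral>\<omega>. (norm (Dmat E (w (Suc k) \<omega>)))\<^sup>2 \<partial>M"
  have "V (Suc k) \<le> (V k + ?c * ?N) / (1 + \<delta>)"
    using V_rec[of k] \<delta>_pos by (simp add: pos_le_divide_eq mult.commute)
  also have "\<dots> = 1 / (1 + \<delta>) * V k + ?c / (1 + \<delta>) * ?N" by (simp add: add_divide_distrib)
  also have "?c / (1 + \<delta>) * ?N = (\<integral>\<omega>. ?c / (1 + \<delta>) * (norm (Dmat E (w (Suc k) \<omega>)))\<^sup>2 \<partial>M)"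
    by simp
  also have "\<dots> \<le> (\<integral>\<omega>. r_rv E \<kappa> \<rho> mf Mf sP sM sMx (w (Suc k) \<omega>) \<partial>M)"
    by (intro integral_mono r_rv_integrable r_rv_ge) (use Dw_integrable[of k] in simp)
  also have "\<dots> \<le> R" using assms by linarith
  also have "1 / (1 + \<delta>) * V k \<le> a * V k" by (intro mult_right_mono inverse_le_a V_nonneg)
  finally show ?thesis by simp
qed

text \<open>Subadditivity of the root linearises the recursion, and
  \<open>sqrt R / (1 - sqrt a)\<close> is the fixed point of s = sqrt a * s + sqrt R.\<close>

lemma sqrt_V_le:
  assumes R: "\<And>l. l \<ge> 1 \<Longrightarrow> \<bar>\<integral>\<omega>. r_rv E \<kappa> \<rho> mf Mf sP sM sMx (w l \<omega>) \<partial>M\<bar> \<le> R" and R0: "R \<ge> 0"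
    and a1: "a < 1"
  shows "sqrt (V k) \<le> (sqrt a) ^ k * sqrt (V 0) + sqrt R / (1 - sqrt a)"
proof (induction k)
  case 0
  show ?case using R0 a1 by simp
next
  case (Suc k)
  have sa: "sqrt a \<ge> 0" "sqrt a < 1" using a_pos a1 by simp_all
  have "sqrt (V (Suc k)) \<le> sqrt (a * V k + R)" using V_step[OF R[of "Suc k"]] by (intro real_sqrt_le_mono) simp
  also have "\<dots> \<le> sqrt (a * V k) + sqrt R" using a_pos V_nonneg R0 by (intro sqrt_add_le_add_sqrt) auto
  also have "\<dots> = sqrt a * sqrt (V k) + sqrt R" by (simp add: real_sqrt_mult)
  also have "\<dots> \<le> sqrt a * ((sqrt a) ^ k * sqrt (V 0) + sqrt R / (1 - sqrt a)) + sqrt R"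
    using Suc sa by (intro add_right_mono mult_left_mono)
  also have "\<dots> = (sqrt a) ^ Suc k * sqrt (V 0) + sqrt R / (1 - sqrt a)"
    using sa by (simp add: field_simps)
  finally show ?case .
qed

section \<open>From the energy to the Wasserstein distance\<close>

lemma V0_le: "ennreal (V 0) \<le> ennreal \<rho> * W2sq (distr M borel (Z 0)) (return borel zs)
    + ennreal (1 / \<rho>) * W2sq (distr M borel (\<beta> 0)) (return borel bs)"
proof -
  have "ennreal (V 0) = (\<integral>\<^sup>+ \<omega>. ennreal (energy (Z 0 \<omega>) (\<beta> 0 \<omega>)) \<partial>M)"
    unfolding V_def using energy_integrable energy_nonneg by (intro nn_integral_eq_integral[symmetric]) auto
  also have "\<dots> = (\<integral>\<^sup>+ \<omega>. ennreal \<rho> * ennreal ((dist (Z 0 \<omega>) zs)\<^sup>2)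
      + ennreal (1 / \<rho>) * ennreal ((dist (\<beta> 0 \<omega>) bs)\<^sup>2) \<partial>M)"
    using \<rho> by (intro nn_integral_cong) (simp add: energy_def dist_norm flip: ennreal_mult ennreal_plus)
  also have "\<dots> = ennreal \<rho> * (\<integral>\<^sup>+ \<omega>. ennreal ((dist (Z 0 \<omega>) zs)\<^sup>2) \<partial>M)
      + ennreal (1 / \<rho>) * (\<integral>\<^sup>+ \<omega>. ennreal ((dist (\<beta> 0 \<omega>) bs)\<^sup>2) \<partial>M)"
    by (subst nn_integral_add, simp, simp, subst nn_integral_cmult, simp, subst nn_integral_cmult) simp_all
  also have "\<dots> \<le> ennreal \<rho> * W2sq (distr M borel (Z 0)) (return borel zs)
    + ennreal (1 / \<rho>) * W2sq (distr M borel (\<beta> 0)) (return borel bs)"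
    by (intro add_mono mult_left_mono W2sq_return) auto
  finally show ?thesis .
qed

text \<open>Synchronous coupling: the iterate and the shifted Gaussian use the same noise. After
  completing the square in \<open>step_primal\<close> their squared distance is at most the previous
  energy over mf plus |D w|^2 / (2 mf^2).\<close>

lemma wass_primal_le:
  "wass (distr M borel (X (Suc k))) (distr M borel (\<lambda>\<omega>. xs - (1 / (sqrt 2 * mf)) *\<^sub>R Dmat E (w (Suc k) \<omega>)))
    \<le> ennreal (1 / sqrt mf * sqrt (V k)
        + 1 / (sqrt 2 * mf) * sqrt (\<integral>\<omega>. (norm (Dmat E (w (Suc k) \<omega>)))\<^sup>2 \<partial>M))"
proof -
  let ?N = "\<integral>\<omega>. (norm (Dmat E (w (Suc k) \<omega>)))\<^sup>2 \<partial>M"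
  let ?y = "\<lambda>\<omega>. xs - (1 / (sqrt 2 * mf)) *\<^sub>R Dmat E (w (Suc k) \<omega>)"
  let ?h = "\<lambda>\<omega>. energy (Z k \<omega>) (\<beta> k \<omega>) / mf + (norm (Dmat E (w (Suc k) \<omega>)))\<^sup>2 / (2 * mf\<^sup>2)"
  have "W2sq (distr M borel (X (Suc k))) (distr M borel ?y) \<le> (\<integral>\<^sup>+ \<omega>. ennreal ((dist (X (Suc k) \<omega>) (?y \<omega>))\<^sup>2) \<partial>M)"
    by (rule W2sq_distr_le) (rule prob_space_axioms, measurable)
  also have "\<dots> \<le> (\<integral>\<^sup>+ \<omega>. ennreal (?h \<omega>) \<partial>M)"
  proof (intro nn_integral_mono ennreal_leI)
    fix \<omega> assume \<omega>: "\<omega> \<in> space M"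
    let ?x = "X (Suc k) \<omega> - xs" and ?D = "Dmat E (w (Suc k) \<omega>)"
    \<comment> \<open>Identifies the shift with the full noise term divided by 2 mf, as
      \<open>complete_square\<close> expects.\<close>
    have r2: "1 / (sqrt 2 * mf) = sqrt 2 / (2 * mf)" using mf by (simp add: field_simps)
    have "mf * (dist (X (Suc k) \<omega>) (?y \<omega>))\<^sup>2 = mf * (norm (?x + (1 / (2 * mf)) *\<^sub>R noise k \<omega>))\<^sup>2"
      unfolding r2 by (simp add: dist_norm algebra_simps)
    also have "\<dots> = mf * (norm ?x)\<^sup>2 + inner (noise k \<omega>) ?x + (norm (noise k \<omega>))\<^sup>2 / (4 * mf)"
      by (rule complete_square[OF mf])
    also have "\<dots> \<le> energy (Z k \<omega>) (\<beta> k \<omega>) + (norm (noise k \<omega>))\<^sup>2 / (4 * mf)"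
      using step_primal[OF step[OF \<omega>, of k]] energy_nonneg[of "Z (Suc k) \<omega>" "\<beta> (Suc k) \<omega>"] by linarith
    also have "\<dots> = mf * ?h \<omega>"
      using mf by (simp add: power_mult_distrib field_simps power2_eq_square)
    finally show "(dist (X (Suc k) \<omega>) (?y \<omega>))\<^sup>2 \<le> ?h \<omega>" using mf by simp
  qed
  also have "\<dots> = ennreal (\<integral>\<omega>. ?h \<omega> \<partial>M)"
    using energy_integrable[of k] Dw_integrable[of k] energy_nonneg mf by (intro nn_integral_eq_integral) auto
  also have "(\<integral>\<omega>. ?h \<omega> \<partial>M) = V k / mf + ?N / (2 * mf\<^sup>2)"
    using energy_integrable[of k] Dw_integrable[of k] by (simp add: V_def)
  finally have "wass (distr M borel (X (Suc k))) (distr M borel ?y) \<le> ennsqrt (ennreal (V k / mf + ?N / (2 * mf\<^sup>2)))"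
    unfolding wass_def by (rule ennsqrt_mono)
  also have "\<dots> \<le> ennreal (sqrt (V k / mf) + sqrt (?N / (2 * mf\<^sup>2)))"
    unfolding ennsqrt_ennreal using V_nonneg mf
    by (intro ennreal_leI sqrt_add_le_add_sqrt) (auto intro!: divide_nonneg_nonneg)
  also have "sqrt (V k / mf) = 1 / sqrt mf * sqrt (V k)" by (simp add: real_sqrt_divide)
  also have "sqrt (?N / (2 * mf\<^sup>2)) = 1 / (sqrt 2 * mf) * sqrt ?N"
    using mf by (simp add: real_sqrt_divide real_sqrt_mult)
  finally show ?thesis .
qed

lemma wass_bound:
  fixes \<mu> :: "((real^'d)^'v) measure"
  assumes R: "\<And>l. l \<ge> 1 \<Longrightarrow> \<bar>\<integral>\<omega>. r_rv E \<kappa> \<rho> mf Mf sP sM sMx (w l \<omega>) \<partial>M\<bar> \<le> R" and R0: "R \<ge> 0"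
    and a1: "a < 1"
  shows "wass (distr M borel (X (Suc k))) \<mu> \<le>
      ennreal (1 / sqrt mf * (sqrt a) ^ k)
        * ennsqrt (ennreal \<rho> * W2sq (distr M borel (Z 0)) (return borel zs)
            + ennreal (1 / \<rho>) * W2sq (distr M borel (\<beta> 0)) (return borel bs))
    + ennreal (1 / sqrt mf * (sqrt R / (1 - sqrt a)))
    + ennreal (1 / (sqrt 2 * mf) * sqrt (\<integral>\<omega>. (norm (Dmat E (w (Suc k) \<omega>)))\<^sup>2 \<partial>M))
    + wass (distr M borel (\<lambda>\<omega>. xs - (1 / (sqrt 2 * mf)) *\<^sub>R Dmat E (w (Suc k) \<omega>))) \<mu>"
proof -
  let ?N = "\<integral>\<omega>. (norm (Dmat E (w (Suc k) \<omega>)))\<^sup>2 \<partial>M"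
  let ?\<nu> = "distr M borel (\<lambda>\<omega>. xs - (1 / (sqrt 2 * mf)) *\<^sub>R Dmat E (w (Suc k) \<omega>))"
  let ?WG = "ennsqrt (ennreal \<rho> * W2sq (distr M borel (Z 0)) (return borel zs)
            + ennreal (1 / \<rho>) * W2sq (distr M borel (\<beta> 0)) (return borel bs))"
  have sa: "0 \<le> sqrt a" "sqrt a < 1" using a_pos a1 by simp_all
  have N: "?N \<ge> 0" by simp
  have WG: "ennreal (sqrt (V 0)) \<le> ?WG"
    using ennsqrt_mono[OF V0_le] by (simp add: ennsqrt_ennreal)
  have "1 / sqrt mf * sqrt (V k) \<le> 1 / sqrt mf * ((sqrt a) ^ k * sqrt (V 0) + sqrt R / (1 - sqrt a))"
    using mf by (intro mult_left_mono sqrt_V_le[OF R R0 a1]) auto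
  then have "ennreal (1 / sqrt mf * sqrt (V k) + 1 / (sqrt 2 * mf) * sqrt ?N)
    \<le> ennreal (1 / sqrt mf * (sqrt a) ^ k * sqrt (V 0) + 1 / sqrt mf * (sqrt R / (1 - sqrt a))
        + 1 / (sqrt 2 * mf) * sqrt ?N)"
    by (intro ennreal_leI) (simp add: algebra_simps)
  also have "\<dots> = ennreal (1 / sqrt mf * (sqrt a) ^ k) * ennreal (sqrt (V 0))
      + ennreal (1 / sqrt mf * (sqrt R / (1 - sqrt a))) + ennreal (1 / (sqrt 2 * mf) * sqrt ?N)"
    using mf sa V_nonneg[of 0] R0 N by (subst ennreal_mult[symmetric]) auto
  also have "\<dots> \<le> ennreal (1 / sqrt mf * (sqrt a) ^ k) * ?WG
      + ennreal (1 / sqrt mf * (sqrt R / (1 - sqrt a))) + ennreal (1 / (sqrt 2 * mf) * sqrt ?N)"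
    by (intro add_right_mono mult_left_mono WG) simp
  finally have "wass (distr M borel (X (Suc k))) ?\<nu> \<le> ennreal (1 / sqrt mf * (sqrt a) ^ k) * ?WG
      + ennreal (1 / sqrt mf * (sqrt R / (1 - sqrt a))) + ennreal (1 / (sqrt 2 * mf) * sqrt ?N)"
    by (rule order_trans[OF wass_primal_le])
  then show ?thesis
    by (intro order_trans[OF wass_triangle[of _ \<mu> ?\<nu>]] add_right_mono)
qed

end

section \<open>Minimiser, multiplier and parameters\<close>

lemma gradF_mono:
  assumes "\<And>i u v. (g i u - g i v) \<bullet> (u - v) \<ge> m i * (norm (u - v))\<^sup>2"
  shows "Min (range m) * (norm (X - Y))\<^sup>2 \<le> (gradF g X - gradF g Y) \<bullet> (X - Y)"
proof -
  have "Min (range m) * (norm (X - Y))\<^sup>2 = (\<Sum>i\<in>UNIV. Min (range m) * (norm (X $ i - Y $ i))\<^sup>2)"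
    by (simp add: norm_vec_sq[of "X - Y"] sum_distrib_left)
  also have "\<dots> \<le> (\<Sum>i\<in>UNIV. (g i (X $ i) - g i (Y $ i)) \<bullet> (X $ i - Y $ i))"
  proof (rule sum_mono)
    fix i
    have "Min (range m) * (norm (X $ i - Y $ i))\<^sup>2 \<le> m i * (norm (X $ i - Y $ i))\<^sup>2"
      by (intro mult_right_mono) auto
    also have "\<dots> \<le> (g i (X $ i) - g i (Y $ i)) \<bullet> (X $ i - Y $ i)" by (rule assms)
    finally show "Min (range m) * (norm (X $ i - Y $ i))\<^sup>2 \<le> (g i (X $ i) - g i (Y $ i)) \<bullet> (X $ i - Y $ i)" .
  qed
  also have "\<dots> = (gradF g X - gradF g Y) \<bullet> (X - Y)"
    unfolding inner_vec_def[of "gradF g X - gradF g Y"] by (simp add: gradF_def)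
  finally show ?thesis .
qed

lemma gradF_lipschitz:
  assumes "\<And>i u v. norm (g i u - g i v) \<le> L i * norm (u - v)" and pos: "Max (range L) \<ge> 0"
  shows "norm (gradF g X - gradF g Y) \<le> Max (range L) * norm (X - Y)"
proof (rule power2_le_imp_le)
  have "(norm (gradF g X - gradF g Y))\<^sup>2 = (\<Sum>i\<in>UNIV. (norm (g i (X $ i) - g i (Y $ i)))\<^sup>2)"
    unfolding norm_vec_sq[of "gradF g X - gradF g Y"] by (simp add: gradF_def)
  also have "\<dots> \<le> (\<Sum>i\<in>UNIV. (Max (range L) * norm (X $ i - Y $ i))\<^sup>2)"
  proof (intro sum_mono power_mono)
    fix i
    have "norm (g i (X $ i) - g i (Y $ i)) \<le> L i * norm (X $ i - Y $ i)" by (rule assms(1))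
    also have "\<dots> \<le> Max (range L) * norm (X $ i - Y $ i)" by (intro mult_right_mono) auto
    finally show "norm (g i (X $ i) - g i (Y $ i)) \<le> Max (range L) * norm (X $ i - Y $ i)" .
  qed simp
  also have "\<dots> = (Max (range L) * norm (X - Y))\<^sup>2"
    by (simp add: norm_vec_sq[of "X - Y"] power_mult_distrib sum_distrib_left)
  finally show "(norm (gradF g X - gradF g Y))\<^sup>2 \<le> (Max (range L) * norm (X - Y))\<^sup>2" .
qed (use pos in simp)

text \<open>Compare the values at 0 and at a unit vector. Supplies the positivity of the largest
  Lipschitz constant.\<close>

lemma modulus_le_lipschitz:
  fixes h :: "real^'d \<Rightarrow> real^'d"
  assumes "\<And>u v. (h u - h v) \<bullet> (u - v) \<ge> m * (norm (u - v))\<^sup>2"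
    and "\<And>u v. norm (h u - h v) \<le> L * norm (u - v)"
  shows "m \<le> L"
proof -
  obtain u :: "real^'d" where u: "norm u = 1" using vector_choose_size[of 1] by auto
  have "m \<le> (h u - h 0) \<bullet> u" using assms(1)[of u 0] u by simp
  also have "\<dots> \<le> norm (h u - h 0) * norm u" by (rule norm_cauchy_schwarz)
  also have "\<dots> \<le> L" using assms(2)[of u 0] u by simp
  finally show ?thesis .
qed

text \<open>Strong monotonicity of the summed gradient makes the minimiser unique, so that
  \<open>THE\<close> denotes it; at a minimum the derivative, tested on the gradient itself,
  vanishes.\<close>

lemma sum_grad_xstar:
  fixes f :: "'v::finite \<Rightarrow> real^'d \<Rightarrow> real"
  assumes grad: "\<And>i x. (f i has_derivative (\<lambda>h. g i x \<bullet> h)) (at x)"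
    and mpos: "\<And>i. m i > 0"
    and strong_conv: "\<And>i u v. (g i u - g i v) \<bullet> (u - v) \<ge> m i * (norm (u - v))\<^sup>2"
    and minimizer: "\<exists>x. \<forall>y. (\<Sum>i\<in>UNIV. f i x) \<le> (\<Sum>i\<in>UNIV. f i y)"
  shows "(\<Sum>i\<in>UNIV. g i (xstar f)) = 0"
proof -
  let ?min = "\<lambda>x. \<forall>y. (\<Sum>i\<in>UNIV. f i x) \<le> (\<Sum>i\<in>UNIV. f i y)"
  have crit: "(\<Sum>i\<in>UNIV. g i x) = 0" if "?min x" for x
  proof -
    have "((\<lambda>x. \<Sum>i\<in>UNIV. f i x) has_derivative (\<lambda>h. \<Sum>i\<in>UNIV. g i x \<bullet> h)) (at x)"
      by (intro has_derivative_sum grad)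
    then have "(\<lambda>h. \<Sum>i\<in>UNIV. g i x \<bullet> h) = (\<lambda>h. 0)"
      by (rule has_derivative_local_min) (simp add: that)
    then have "(\<Sum>i\<in>UNIV. g i x) \<bullet> (\<Sum>i\<in>UNIV. g i x) = 0"
      by (metis inner_sum_left)
    then show ?thesis by simp
  qed
  have "x = y" if "?min x" "?min y" for x y
  proof (rule ccontr)
    assume "x \<noteq> y"
    have "0 < (\<Sum>i\<in>UNIV. m i) * (norm (x - y))\<^sup>2"
      using \<open>x \<noteq> y\<close> mpos by (intro mult_pos_pos sum_pos) auto
    also have "\<dots> \<le> (\<Sum>i\<in>UNIV. (g i x - g i y) \<bullet> (x - y))"
      unfolding sum_distrib_right by (intro sum_mono strong_conv)
    also have "\<dots> = ((\<Sum>i\<in>UNIV. g i x) - (\<Sum>i\<in>UNIV. g i y)) \<bullet> (x - y)"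
      unfolding sum_subtractf[symmetric] inner_sum_left ..
    also have "\<dots> = 0" using crit that by simp
    finally show False by simp
  qed
  then have "\<exists>!x. ?min x" using minimizer by blast
  then have "?min (xstar f)" unfolding xstar_def by (rule theI')
  then show ?thesis by (rule crit)
qed

text \<open>Existence: the blocks of the gradient at consensus sum to zero, so the Laplacian reaches
  it. Uniqueness: \<open>Mminus\<close> is injective on the range of its adjoint.\<close>

lemma betastar_props:
  fixes E :: "'v::finite \<Rightarrow> 'v \<Rightarrow> bool" and f :: "'v \<Rightarrow> real^'d \<Rightarrow> real"
  assumes conn: "graph_connected E" and sum0: "(\<Sum>i\<in>UNIV. g i (xstar f)) = 0"
  shows "betastar E f g \<in> range (MminusT E)"
    and "gradF g (Xstar f) + Mminus E (betastar E f g) = 0"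
proof -
  let ?P = "\<lambda>b. b \<in> range (MminusT E) \<and> gradF g (Xstar f) + Mminus E b = 0"
  have "(\<Sum>i\<in>UNIV. (- gradF g (Xstar f)) $ i) = 0"
    using sum0 by (simp add: gradF_def Xstar_def sum_negf)
  from in_range_Mminus_MminusT[OF conn this] obtain y where "- gradF g (Xstar f) = Mminus E (MminusT E y)"
    by blast
  then have ex: "?P (MminusT E y)" by (metis add.right_inverse rangeI)
  have "b = b'" if b: "?P b" "?P b'" for b b'
  proof -
    have "b - b' \<in> range (MminusT E)"
      using b by (intro subspace_diff) (auto simp: linear_subspace_image[OF linear_MminusT])
    then obtain z where z: "b - b' = MminusT E z" by blast
    have "Mminus E b = Mminus E b'" using b by (metis add_left_cancel)
    then have "Mminus E (b - b') = 0" by (simp add: linear_diff[OF linear_Mminus])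
    then have "(b - b') \<bullet> MminusT E z = 0" by (metis Mminus_adjoint inner_zero_left)
    then show ?thesis by (simp flip: z)
  qed
  with ex have "\<exists>!b. ?P b" by blast
  then have "?P (betastar E f g)" unfolding betastar_def by (rule theI')
  then show "betastar E f g \<in> range (MminusT E)" "gradF g (Xstar f) + Mminus E (betastar E f g) = 0"
    by blast+
qed

text \<open>The parameters balance the two terms of the minimum defining \<open>\<delta>\<close> and minimise the
  denominator over \<open>\<rho>\<close>; writing \<open>t = 1 / sqrt \<kappa>\<close>, balance means \<open>t\<^sup>2 + t \<tau>\<^sub>G / \<tau>\<^sub>f = 1\<close>.\<close>

lemma exists_parameters:
  fixes mf Mf P N :: real
  assumes mf: "mf > 0" and Mf: "Mf > 0"
    and cond: "(1 / (Mf / mf)) * sqrt ((1 / (Mf / mf))\<^sup>2 + 4 * (1 / (P / N))\<^sup>2) - (1 / (Mf / mf))\<^sup>2 > 1 / mf"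
  shows "P \<noteq> 0" and "N \<noteq> 0"
    and "\<exists>\<rho>>0. \<exists>\<kappa>>1. a_c mf (delta_c \<kappa> \<rho> mf Mf P N) < 1"
proof -
  define u where "u = mf / Mf"
  \<comment> \<open>\<open>u\<close> and \<open>v\<close> are the reciprocals of the two ratios; the
    absolute value is harmless since the condition contains only the square.\<close>
  define v where "v = \<bar>N / P\<bar>"
  have u: "u > 0" using mf Mf by (simp add: u_def)
  have cond': "u * sqrt (u\<^sup>2 + 4 * v\<^sup>2) - u\<^sup>2 > 1 / mf"
    using cond by (simp add: u_def v_def power_divide)
  \<comment> \<open>Division by zero yields 0, so this covers the degenerate cases
    \<open>P = 0\<close> and \<open>N = 0\<close>: the left side of the condition would
    vanish.\<close>
  have "v \<noteq> 0"
  proof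
    assume "v = 0"
    then have "u * sqrt (u\<^sup>2 + 4 * v\<^sup>2) - u\<^sup>2 = 0" using u by (simp add: power2_eq_square)
    then show False using cond' mf by simp
  qed
  then show P: "P \<noteq> 0" and N: "N \<noteq> 0" by (auto simp: v_def)
  have v: "v > 0" using \<open>v \<noteq> 0\<close> by (simp add: v_def)
  define s where "s = sqrt (u\<^sup>2 + 4 * v\<^sup>2)"
  have s2: "s\<^sup>2 = u\<^sup>2 + 4 * v\<^sup>2" by (simp add: s_def)
  have "u = sqrt (u\<^sup>2)" using u by simp
  also have "\<dots> < s" unfolding s_def using v by (intro real_sqrt_less_mono) simp
  finally have su: "u < s" .
  \<comment> \<open>The positive root of v t^2 + u t - v = 0.\<close>
  define t where "t = (s - u) / (2 * v)"
  have t: "t > 0" using su v by (simp add: t_def)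
  have bal: "(1 - t\<^sup>2) * v = t * u"
  proof -
    have "4 * v\<^sup>2 * (t\<^sup>2) = (s - u)\<^sup>2" using v by (simp add: t_def power_divide power_mult_distrib)
    then have "4 * v * ((1 - t\<^sup>2) * v) = 4 * v\<^sup>2 - (s - u)\<^sup>2" by (simp add: power2_eq_square algebra_simps)
    also have "\<dots> = 2 * u * (s - u)" using s2 by (simp add: power2_eq_square algebra_simps)
    also have "\<dots> = 4 * v * (t * u)" using v by (simp add: t_def)
    finally show ?thesis using v by simp
  qed
  have "(1 - t\<^sup>2) * v > 0" using bal t u by simp
  then have t2: "t\<^sup>2 < 1" using v by (simp add: zero_less_mult_iff)
  define \<kappa> where "\<kappa> = 1 / t\<^sup>2"
  have \<kappa>: "\<kappa> > 1" using t t2 by (simp add: \<kappa>_def)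
  \<comment> \<open>Makes the two summands of the denominator in \<delta> equal.\<close>
  define \<rho> where "\<rho> = 2 * Mf / (t * \<bar>P\<bar> * \<bar>N\<bar>)"
  have \<rho>: "\<rho> > 0" using Mf t P N by (simp add: \<rho>_def)
  have PP: "P\<^sup>2 = \<bar>P\<bar> * \<bar>P\<bar>" "N\<^sup>2 = \<bar>N\<bar> * \<bar>N\<bar>" by (simp_all add: power2_eq_square)
  have absPN: "\<bar>P\<bar> > 0" "\<bar>N\<bar> > 0" using P N by simp_all
  have "((\<kappa> - 1) * N\<^sup>2) / (\<kappa> * P\<^sup>2) = (1 - t\<^sup>2) * v\<^sup>2"
    using t P by (simp add: \<kappa>_def v_def power_divide field_simps)
  also have "\<dots> = t * u * v" using bal by (simp add: power2_eq_square)
  finally have d1: "((\<kappa> - 1) * N\<^sup>2) / (\<kappa> * P\<^sup>2) = t * u * v" .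
  have "\<rho> / 4 * P\<^sup>2 = Mf * \<bar>P\<bar> / (2 * t * \<bar>N\<bar>)"
    unfolding \<rho>_def PP using t absPN by (simp add: field_simps)
  moreover have "(\<kappa> * Mf\<^sup>2) / (\<rho> * N\<^sup>2) = Mf * \<bar>P\<bar> / (2 * t * \<bar>N\<bar>)"
    unfolding \<rho>_def \<kappa>_def PP using t absPN Mf by (simp add: field_simps power2_eq_square)
  ultimately have "\<rho> / 4 * P\<^sup>2 + (\<kappa> * Mf\<^sup>2) / (\<rho> * N\<^sup>2) = Mf * \<bar>P\<bar> / (t * \<bar>N\<bar>)"
    by simp
  then have d2: "mf / (\<rho> / 4 * P\<^sup>2 + (\<kappa> * Mf\<^sup>2) / (\<rho> * N\<^sup>2)) = t * u * v"
    by (simp add: u_def v_def abs_divide)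
  have "delta_c \<kappa> \<rho> mf Mf P N = t * u * v" unfolding delta_c_def d1 d2 by simp
  also have "\<dots> = u * (t * v)" by simp
  also have "t * v = (s - u) / 2" using v by (simp add: t_def)
  also have "u * ((s - u) / 2) = (u * s - u\<^sup>2) / 2" by (simp add: power2_eq_square right_diff_distrib)
  \<comment> \<open>\<delta> is half the left side of the condition, so a < 1 is the condition
    itself.\<close>
  finally have "delta_c \<kappa> \<rho> mf Mf P N > 1 / (2 * mf)" using cond' by (simp add: s_def)
  then have "2 * mf + 1 < 2 * mf * (1 + delta_c \<kappa> \<rho> mf Mf P N)"
    using mf by (simp add: field_simps)
  moreover have "2 * mf * (1 + delta_c \<kappa> \<rho> mf Mf P N) > 0" using calculation mf by linarith
  ultimately have "a_c mf (delta_c \<kappa> \<rho> mf Mf P N) < 1" by (simp add: a_c_def)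
  then show "\<exists>\<rho>>0. \<exists>\<kappa>>1. a_c mf (delta_c \<kappa> \<rho> mf Mf P N) < 1" using \<rho> \<kappa> by blast
qed

text \<open>Moments of the noise do not depend on the index, which gives uniform constants
  \<open>Y\<close> and \<open>R\<close>.\<close>

lemma (in noisy_chain) noise_law:
  fixes h :: "(real^'d)^'v \<Rightarrow> real"
  assumes "l \<ge> 1" and h: "h \<in> borel_measurable borel"
  shows "(\<integral>\<omega>. h (w l \<omega>) \<partial>M) = (\<integral>x. h x \<partial>density lborel std_gauss_dens)"
proof -
  note d = w_distributed[OF assms(1)]
  have "(\<integral>x. h x \<partial>density lborel std_gauss_dens) = (\<integral>x. h x \<partial>distr M lborel (w l))"
    by (simp add: distributed_distr_eq_density[OF d])
  also have "\<dots> = (\<integral>\<omega>. h (w l \<omega>) \<partial>M)"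
    by (rule integral_distr) (use distributed_measurable[OF d] h in simp_all)
  finally show ?thesis ..
qed

theorem theorem3:
  fixes E :: "'v::finite \<Rightarrow> 'v \<Rightarrow> bool"
    and f :: "'v \<Rightarrow> real^'d::finite \<Rightarrow> real"
    and g :: "'v \<Rightarrow> real^'d \<Rightarrow> real^'d"
    and m Mc :: "'v \<Rightarrow> real"
  assumes sym: "\<And>i j. E i j = E j i"
    and irrefl: "\<And>i. \<not> E i i"
    and conn: "graph_connected E"
    and grad: "\<And>i x. (f i has_derivative (\<lambda>h. g i x \<bullet> h)) (at x)"
    and mpos: "\<And>i. m i > 0"
    and strong_conv: "\<And>i u v. (g i u - g i v) \<bullet> (u - v) \<ge> m i * (norm (u - v))\<^sup>2"
    and lipschitz: "\<And>i u v. norm (g i u - g i v) \<le> Mc i * norm (u - v)"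
    and minimizer: "\<exists>x. \<forall>y. (\<Sum>i\<in>UNIV. f i x) \<le> (\<Sum>i\<in>UNIV. f i y)"
    and cond: "let mf = Min (range m); Mf = Max (range Mc);
                   \<tau>f = Mf / mf;
                   \<tau>G = sigma_max (Mplus E :: (real^'d)^('v \<times> 'v) \<Rightarrow> (real^'d)^'v)
                        / sigma_min (Mminus E :: (real^'d)^('v \<times> 'v) \<Rightarrow> (real^'d)^'v)
               in (1 / \<tau>f) * sqrt ((1 / \<tau>f)\<^sup>2 + 4 * (1 / \<tau>G)\<^sup>2) - (1 / \<tau>f)\<^sup>2 > 1 / mf"
  shows "let mf = Min (range m); Mf = Max (range Mc);
             sPmax = sigma_max (Mplus E :: (real^'d)^('v \<times> 'v) \<Rightarrow> (real^'d)^'v);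
             sMmin = sigma_min (Mminus E :: (real^'d)^('v \<times> 'v) \<Rightarrow> (real^'d)^'v);
             sMmax = sigma_max (Mminus E :: (real^'d)^('v \<times> 'v) \<Rightarrow> (real^'d)^'v)
         in \<exists>\<rho>>0. \<exists>\<kappa>>1.
              a_c mf (delta_c \<kappa> \<rho> mf Mf sPmax sMmin) < 1 \<and>
              (\<forall>(M :: 'w measure) X Z \<beta> w. noisy_iter E g \<rho> M X Z \<beta> w \<longrightarrow>
                (let a = a_c mf (delta_c \<kappa> \<rho> mf Mf sPmax sMmin);
                     yl = (\<lambda>l \<omega>. y_rv E \<kappa> \<rho> mf Mf sPmax sMmin sMmax (w l \<omega>));
                     rl = (\<lambda>l \<omega>. r_rv E \<kappa> \<rho> mf Mf sPmax sMmin sMmax (w l \<omega>));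
                     WG = ennsqrt (ennreal \<rho> * W2sq (distr M borel (Z 0)) (return borel (Zstar E f))
                                  + ennreal (1 / \<rho>) * W2sq (distr M borel (\<beta> 0)) (return borel (betastar E f g)))
                 in (\<exists>Y\<ge>0. \<exists>R\<ge>0. \<forall>l\<ge>1. (\<integral>\<omega>. yl l \<omega> \<partial>M) \<le> Y \<and> \<bar>\<integral>\<omega>. rl l \<omega> \<partial>M\<bar> \<le> R) \<and>
                    (\<forall>Y R. Y \<ge> 0 \<longrightarrow> R \<ge> 0 \<longrightarrow>
                       (\<forall>l\<ge>1. (\<integral>\<omega>. yl l \<omega> \<partial>M) \<le> Y \<and> \<bar>\<integral>\<omega>. rl l \<omega> \<partial>M\<bar> \<le> R) \<longrightarrow>
                       (\<forall>k. wass (distr M borel (X (Suc k))) (bold_mu_star f)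
                              \<le> ennreal (1 / sqrt mf * (sqrt a) ^ k) * WG
                                + ennreal (1 / sqrt (a * mf) * (Y / (1 - sqrt a)))
                                + ennreal (1 / sqrt mf * (sqrt R / (1 - sqrt a)))
                                + ennreal (1 / (sqrt 2 * mf)
                                     * sqrt (\<integral>\<omega>. (norm (Dmat E (w (Suc k) \<omega>)))\<^sup>2 \<partial>M))
                                + wass (distr M borel
                                          (\<lambda>\<omega>. Xstar f - (1 / (sqrt 2 * mf)) *\<^sub>R Dmat E (w (Suc k) \<omega>)))
                                       (bold_mu_star f)))))"
proof -
  define mf where "mf = Min (range m)"
  define Mf where "Mf = Max (range Mc)"
  define sP where "sP = sigma_max (Mplus E :: (real^'d)^('v \<times> 'v) \<Rightarrow> (real^'d)^'v)"
  define sM where "sM = sigma_min (Mminus E :: (real^'d)^('v \<times> 'v) \<Rightarrow> (real^'d)^'v)"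
  define sMx where "sMx = sigma_max (Mminus E :: (real^'d)^('v \<times> 'v) \<Rightarrow> (real^'d)^'v)"
  have mf: "mf > 0" using mpos by (simp add: mf_def)
  have "m undefined \<le> Mc undefined" by (rule modulus_le_lipschitz[OF strong_conv lipschitz])
  also have "\<dots> \<le> Mf" by (simp add: Mf_def)
  finally have Mf: "Mf > 0" using mpos[of undefined] by linarith
  note cond' = cond[unfolded Let_def, folded mf_def Mf_def sP_def sM_def]
  note par = exists_parameters[OF mf Mf cond']
  obtain \<rho> \<kappa> where \<rho>: "\<rho> > 0" and \<kappa>: "\<kappa> > 1" and a1: "a_c mf (delta_c \<kappa> \<rho> mf Mf sP sM) < 1"
    using par(3) by blast
  have sum0: "(\<Sum>i\<in>UNIV. g i (xstar f)) = 0" by (rule sum_grad_xstar[OF grad mpos strong_conv minimizer])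
  \<comment> \<open>Done before \<open>M\<close> is introduced: \<rho> and \<kappa> must not depend
    on the probability space.\<close>
  interpret noisy_step E "gradF g" mf Mf \<rho> \<kappa> sP sM "Xstar f" "Zstar E f" "betastar E f g"
  proof
    show "mf * (norm (x - y))\<^sup>2 \<le> (gradF g x - gradF g y) \<bullet> (x - y)" for x y
      unfolding mf_def by (rule gradF_mono[OF strong_conv])
    show "norm (gradF g x - gradF g y) \<le> Mf * norm (x - y)" for x y
      unfolding Mf_def by (rule gradF_lipschitz[OF lipschitz]) (use Mf in \<open>simp add: Mf_def\<close>)
    show "(norm (Mplus E z :: (real^'d)^'v))\<^sup>2 \<le> sP\<^sup>2 * (norm z)\<^sup>2" for z
      unfolding sP_def by (rule norm_le_sigma_max[OF linear_Mplus])
    show "sM\<^sup>2 * (norm z)\<^sup>2 \<le> (norm (Mminus E z))\<^sup>2"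
      if "z \<in> range (MminusT E :: (real^'d)^'v \<Rightarrow> _)" for z
      unfolding sM_def by (rule sigma_min_le_norm[OF linear_Mminus]) (use that in \<open>simp add: adjoint_Mminus\<close>)
    show "MminusT E (Xstar f) = 0" by (simp add: Xstar_def)
  qed (simp_all add: mf Mf \<rho> \<kappa> par(1,2) Zstar_def betastar_props[where g = g, OF conn sum0])
  have main: "(let a = a_c mf (delta_c \<kappa> \<rho> mf Mf sP sM);
         yl = (\<lambda>l \<omega>. y_rv E \<kappa> \<rho> mf Mf sP sM sMx (w l \<omega>));
         rl = (\<lambda>l \<omega>. r_rv E \<kappa> \<rho> mf Mf sP sM sMx (w l \<omega>));
         WG = ennsqrt (ennreal \<rho> * W2sq (distr M borel (Z 0)) (return borel (Zstar E f))
                      + ennreal (1 / \<rho>) * W2sq (distr M borel (\<beta> 0)) (return borel (betastar E f g)))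
     in (\<exists>Y\<ge>0. \<exists>R\<ge>0. \<forall>l\<ge>1. (\<integral>\<omega>. yl l \<omega> \<partial>M) \<le> Y \<and> \<bar>\<integral>\<omega>. rl l \<omega> \<partial>M\<bar> \<le> R) \<and>
        (\<forall>Y R. Y \<ge> 0 \<longrightarrow> R \<ge> 0 \<longrightarrow>
           (\<forall>l\<ge>1. (\<integral>\<omega>. yl l \<omega> \<partial>M) \<le> Y \<and> \<bar>\<integral>\<omega>. rl l \<omega> \<partial>M\<bar> \<le> R) \<longrightarrow>
           (\<forall>k. wass (distr M borel (X (Suc k))) (bold_mu_star f)
                  \<le> ennreal (1 / sqrt mf * (sqrt a) ^ k) * WG
                    + ennreal (1 / sqrt (a * mf) * (Y / (1 - sqrt a)))
                    + ennreal (1 / sqrt mf * (sqrt R / (1 - sqrt a)))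
                    + ennreal (1 / (sqrt 2 * mf)
                         * sqrt (\<integral>\<omega>. (norm (Dmat E (w (Suc k) \<omega>)))\<^sup>2 \<partial>M))
                    + wass (distr M borel
                              (\<lambda>\<omega>. Xstar f - (1 / (sqrt 2 * mf)) *\<^sub>R Dmat E (w (Suc k) \<omega>)))
                           (bold_mu_star f))))"
    if iter: "noisy_iter E g \<rho> M X Z \<beta> w" for M :: "'w measure" and X Z \<beta> w
  proof -
    interpret prob_space M using iter unfolding noisy_iter_def by blast
    interpret noisy_chain E g mf Mf \<rho> \<kappa> sP sM "Xstar f" "Zstar E f" "betastar E f g" M X Z \<beta> w
      by unfold_locales (rule iter)
    define y r where "y v = y_rv E \<kappa> \<rho> mf Mf sP sM sMx v" and "r v = r_rv E \<kappa> \<rho> mf Mf sP sM sMx v"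
      for v :: "(real^'d)^'v"
    have y_meas: "y \<in> borel_measurable borel" and r_meas: "r \<in> borel_measurable borel"
      unfolding y_def[abs_def] r_def[abs_def] y_rv_def r_rv_def wbar_def Let_def by measurable
    have ex: "\<exists>Y\<ge>0. \<exists>R\<ge>0. \<forall>l\<ge>1. (\<integral>\<omega>. y (w l \<omega>) \<partial>M) \<le> Y \<and> \<bar>\<integral>\<omega>. r (w l \<omega>) \<partial>M\<bar> \<le> R"
    proof (intro exI conjI allI impI)
      fix l :: nat assume l: "l \<ge> 1"
      \<comment> \<open>The witnesses are the absolute values of the means under the Gaussian
        law.\<close>
      show "(\<integral>\<omega>. y (w l \<omega>) \<partial>M) \<le> \<bar>\<integral>x. y x \<partial>density lborel std_gauss_dens\<bar>"
        by (simp add: noise_law[OF l y_meas])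
      show "\<bar>\<integral>\<omega>. r (w l \<omega>) \<partial>M\<bar> \<le> \<bar>\<integral>x. r x \<partial>density lborel std_gauss_dens\<bar>"
        by (simp add: noise_law[OF l r_meas])
    qed simp_all
    have bound: "wass (distr M borel (X (Suc k))) (bold_mu_star f)
        \<le> ennreal (1 / sqrt mf * (sqrt a) ^ k)
            * ennsqrt (ennreal \<rho> * W2sq (distr M borel (Z 0)) (return borel (Zstar E f))
                + ennreal (1 / \<rho>) * W2sq (distr M borel (\<beta> 0)) (return borel (betastar E f g)))
          + ennreal (1 / sqrt (a * mf) * (Y / (1 - sqrt a)))
          + ennreal (1 / sqrt mf * (sqrt R / (1 - sqrt a)))
          + ennreal (1 / (sqrt 2 * mf) * sqrt (\<integral>\<omega>. (norm (Dmat E (w (Suc k) \<omega>)))\<^sup>2 \<partial>M))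
          + wass (distr M borel (\<lambda>\<omega>. Xstar f - (1 / (sqrt 2 * mf)) *\<^sub>R Dmat E (w (Suc k) \<omega>))) (bold_mu_star f)"
      if "R \<ge> 0" "\<forall>l\<ge>1. (\<integral>\<omega>. y (w l \<omega>) \<partial>M) \<le> Y \<and> \<bar>\<integral>\<omega>. r (w l \<omega>) \<partial>M\<bar> \<le> R" for Y R k
    proof -
      have R: "\<bar>\<integral>\<omega>. r_rv E \<kappa> \<rho> mf Mf sP sM sMx (w l \<omega>) \<partial>M\<bar> \<le> R" if "l \<ge> 1" for l
        using \<open>\<forall>l\<ge>1. _ l\<close> that by (simp add: r_def)
      have "a < 1" using a1 by (simp add: \<delta>_def)
      show ?thesis
      proof (rule order_trans[OF wass_bound[where sMx = sMx and R = R]])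
        show "\<bar>\<integral>\<omega>. r_rv E \<kappa> \<rho> mf Mf sP sM sMx (w l \<omega>) \<partial>M\<bar> \<le> R" if "l \<ge> 1" for l
          by (rule R[OF that])
      \<comment> \<open>The term with \<open>Y\<close> enters here, as a nonnegative summand added
        to the bound.\<close>
      qed (fact, fact, intro add_right_mono, simp)
    qed
    show ?thesis
      unfolding Let_def y_def[symmetric] r_def[symmetric] \<delta>_def[symmetric]
      by (intro conjI ex allI impI) (rule bound, assumption+)
  qed
  show ?thesis
    unfolding Let_def mf_def[symmetric] Mf_def[symmetric] sP_def[symmetric] sM_def[symmetric] sMx_def[symmetric]
    using \<rho> \<kappa> a1 main[unfolded Let_def] by blast
qed

end
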